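(* Let the setting be as in the context, with $0<\sigma<\infty$ and $g\in C^{0,1}(\partial\Omega)$ with $L\le\sigma$. Assume that $f\in L^1(\Omega)$ and that there exists $\bar g\in S_g$ with $F(\bar g)<+\infty$. Let $u$ be the minimizer of $F$ on $S_g$ and, for every integer $n>N$, let $u_n$ be the minimizer of $$F_n(v)=\sum_{p=2}^{n}\frac{a_p}{p}\int_\Omega|\nabla v|^p-\int_\Omega fv$$ among $v\in W^{1,n}(\Omega)$ with $v-\bar g\in W^{1,n}_0(\Omega)$. Assume the uniform bound $$\|\nabla u_n\|_{L^\infty(\Omega)}\le K<\sigma\qquad\text{for every }n>N .$$ Then $u_n\to u$ uniformly on $\overline\Omega$, $\|\nabla u\|_\infty\le K$, $u$ is a weak solution of $-\sum_{p=2}^\infty a_p\Delta_pu=f$ in $\Omega$, $u=g$ on $\partial\Omega$, and the convergence is geometric: for every $\theta\in(K/\sigma,1)$ there is $C>0$ such that, for every $n>N$, $$\frac{a_2}{2}\int_\Omega|\nabla u_n-\nabla u|^2\ \le\ F(u_n)-F(u)\ \le\ |\Omega|\sum_{p>n}\frac{a_p}{p}K^p\ \le\ C\theta^{\,n}.$$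
   Context: $\Omega\subset\mathbb{R}^N$ ($N\ge1$) is a bounded, connected, open set with Lipschitz boundary. $\{a_p\}_{p\ge2}$ ($p$ integer) is a real sequence with $a_p\ge0$ for all $p$, $a_2>0$, and $a_p\ne0$ for infinitely many $p$; $\sigma$ is defined by $1/\sigma=\limsup_{p\to\infty}a_p^{1/p}$. Put $\Phi(t)=\sum_{p\ge2}\frac{a_p}{p}t^p\in[0,+\infty]$ for $t\in[0,\sigma]$, and $G(\xi)=\Phi(|\xi|)$ if $|\xi|\le\sigma$, $G(\xi)=+\infty$ if $|\xi|>\sigma$. For $g\in C^{0,1}(\partial\Omega)$ put $L=\sup_{x\ne y\in\partial\Omega}\frac{|g(x)-g(y)|}{|x-y|}$ and $S_g=\{v\in C^{0,1}(\overline\Omega):\ \|\nabla v\|_{L^\infty(\Omega)}\le\sigma,\ v=g\text{ on }\partial\Omega\}$; for $v\in S_g$, $F(v)=\int_\Omega G(\nabla v)-\int_\Omega fv\in(-\infty,+\infty]$. Under the stated assumptions $F$ has a unique minimizer on $S_g$. For $n>N$ one has $W^{1,n}(\Omega)\hookrightarrow C(\overline\Omega)$, so that $F_n$ is well defined and finite on $\bar g+W^{1,n}_0(\Omega)$ for every $f\in L^1(\Omega)$. Here $\Delta_pu=\operatorname{div}(|\nabla u|^{p-2}\nabla u)$. A function $u\in S_g$ is a weak solution of the Dirichlet problem if $\sum_{p=2}^{\infty}a_p\int_\Omega|\nabla u|^{p-2}\nabla u\cdot\nabla\psi=\int_\Omega f\psi$ for every $\psi\in W^{1,\infty}_0(\Omega)$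 (Lipschitz functions on $\overline\Omega$ vanishing on $\partial\Omega$) for which the series on the left is absolutely convergent, i.e. $\sum_pa_p\big|\int_\Omega|\nabla u|^{p-2}\nabla u\cdot\nabla\psi\big|<\infty$. *)

theory Defs
  imports "HOL-Analysis.Analysis"
begin

text \<open>
  The space \<open>\<real>\<^sup>N\<close> is a Euclidean space type \<open>'a\<close> with \<open>N = DIM('a)\<close>. Functions on
  \<open>\<Omega>\<close>, its closure or its boundary are total functions on \<open>'a\<close>, of which only the values on the
  set in question matter.
\<close>

subsection \<open>Domains and Lipschitz functions\<close>

text \<open>
  Near each boundary point, in suitable orthonormal coordinates whose last axis is \<open>e\<close>, the set
  is the strict epigraph of a Lipschitz function of the other \<open>N - 1\<close> coordinates.
\<close>

definition lipschitz_boundary :: "'a::euclidean_space set \<Rightarrow> bool" where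
  "lipschitz_boundary \<Omega> \<longleftrightarrow>
     (\<forall>x0\<in>frontier \<Omega>. \<exists>r>0. \<exists>e \<gamma> L. norm e = 1 \<and> L-lipschitz_on {y. y \<bullet> e = 0} \<gamma> \<and>
        (\<forall>x\<in>ball x0 r. x \<in> \<Omega> \<longleftrightarrow> \<gamma> (x - (x \<bullet> e) *\<^sub>R e) < x \<bullet> e))"

definition C01 :: "'a::metric_space set \<Rightarrow> ('a \<Rightarrow> real) set" where
  "C01 S = {v. \<exists>C. C-lipschitz_on S v}"

text \<open>Meaningful for \<open>g \<in> C01 S\<close> and \<open>S\<close> with at least two points, where the supremum
  is over a bounded nonempty set.\<close>

definition lip_const :: "'a::metric_space set \<Rightarrow> ('a \<Rightarrow> real) \<Rightarrow> real" where
  "lip_const S g = Sup {\<bar>g x - g y\<bar> / dist x y | x y. x \<in> S \<and> y \<in> S \<and> x \<noteq> y}"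

subsection \<open>Weak gradients and Sobolev spaces\<close>

primrec Ck :: "nat \<Rightarrow> ('a::euclidean_space \<Rightarrow> real) \<Rightarrow> bool" where
  "Ck 0 \<phi> \<longleftrightarrow> continuous_on UNIV \<phi>"
| "Ck (Suc k) \<phi> \<longleftrightarrow> (\<forall>x. \<phi> differentiable (at x)) \<and>
     (\<forall>b\<in>Basis. Ck k (\<lambda>x. frechet_derivative \<phi> (at x) b))"

definition test_functions :: "'a::euclidean_space set \<Rightarrow> ('a \<Rightarrow> real) set" where
  "test_functions \<Omega> =
     {\<phi>. (\<forall>k. Ck k \<phi>) \<and> compact (closure {x. \<phi> x \<noteq> 0}) \<and> closure {x. \<phi> x \<noteq> 0} \<subseteq> \<Omega>}"

definition locally_integrable ::
  "'a::euclidean_space set \<Rightarrow> ('a \<Rightarrow> 'b::euclidean_space) \<Rightarrow> bool" where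
  "locally_integrable \<Omega> h \<longleftrightarrow> (\<forall>S. compact S \<and> S \<subseteq> \<Omega> \<longrightarrow> set_integrable lebesgue S h)"

definition has_weak_gradient ::
  "'a::euclidean_space set \<Rightarrow> ('a \<Rightarrow> real) \<Rightarrow> ('a \<Rightarrow> 'a) \<Rightarrow> bool" where
  "has_weak_gradient \<Omega> v w \<longleftrightarrow> locally_integrable \<Omega> v \<and> locally_integrable \<Omega> w \<and>
     (\<forall>\<phi>\<in>test_functions \<Omega>. \<forall>b\<in>Basis.
        (LINT x|lebesgue_on \<Omega>. v x * frechet_derivative \<phi> (at x) b) =
        - (LINT x|lebesgue_on \<Omega>. (w x \<bullet> b) * \<phi> x))"

text \<open>
  A weak gradient is unique up to null sets; \<open>wgrad\<close> selects a representative. It is used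
  only for Sobolev functions and for Lipschitz functions, which are weakly differentiable on a
  bounded open set.
\<close>

definition wgrad :: "'a::euclidean_space set \<Rightarrow> ('a \<Rightarrow> real) \<Rightarrow> 'a \<Rightarrow> 'a" where
  "wgrad \<Omega> v = (SOME w. has_weak_gradient \<Omega> v w)"

definition Lp_space ::
  "'a::euclidean_space set \<Rightarrow> nat \<Rightarrow> ('a \<Rightarrow> 'b::euclidean_space) set" where
  "Lp_space \<Omega> p = {h \<in> borel_measurable (lebesgue_on \<Omega>).
     integrable (lebesgue_on \<Omega>) (\<lambda>x. norm (h x) ^ p)}"

definition W1 :: "'a::euclidean_space set \<Rightarrow> nat \<Rightarrow> ('a \<Rightarrow> real) set" where
  "W1 \<Omega> p = {v \<in> Lp_space \<Omega> p. (\<exists>w. has_weak_gradient \<Omega> v w) \<and> wgrad \<Omega> v \<in> Lp_space \<Omega> p}"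

definition W1_norm :: "'a::euclidean_space set \<Rightarrow> nat \<Rightarrow> ('a \<Rightarrow> real) \<Rightarrow> real" where
  "W1_norm \<Omega> p v = root p ((LINT x|lebesgue_on \<Omega>. \<bar>v x\<bar> ^ p) +
                            (LINT x|lebesgue_on \<Omega>. norm (wgrad \<Omega> v x) ^ p))"

definition W1_0 :: "'a::euclidean_space set \<Rightarrow> nat \<Rightarrow> ('a \<Rightarrow> real) set" where
  "W1_0 \<Omega> p = {v \<in> W1 \<Omega> p. \<exists>\<phi>. (\<forall>k. \<phi> k \<in> test_functions \<Omega>) \<and>
     (\<lambda>k. W1_norm \<Omega> p (\<lambda>x. \<phi> k x - v x)) \<longlonglongrightarrow> 0}"

definition W1_inf_0 :: "'a::euclidean_space set \<Rightarrow> ('a \<Rightarrow> real) set" where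
  "W1_inf_0 \<Omega> = {\<psi> \<in> C01 (closure \<Omega>). \<forall>x\<in>frontier \<Omega>. \<psi> x = 0}"

subsection \<open>The functionals and the Dirichlet problem\<close>

definition Phi :: "(nat \<Rightarrow> real) \<Rightarrow> real \<Rightarrow> ennreal" where
  "Phi a t = (\<Sum>\<^sub>\<infinity>p\<in>{2..}. ennreal (a p / real p * t ^ p))"

definition G :: "(nat \<Rightarrow> real) \<Rightarrow> real \<Rightarrow> 'a::euclidean_space \<Rightarrow> ennreal" where
  "G a \<sigma> \<xi> = (if norm \<xi> \<le> \<sigma> then Phi a (norm \<xi>) else \<infinity>)"

definition S :: "'a::euclidean_space set \<Rightarrow> real \<Rightarrow> ('a \<Rightarrow> real) \<Rightarrow> ('a \<Rightarrow> real) set" where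
  "S \<Omega> \<sigma> g = {v \<in> C01 (closure \<Omega>). (AE x in lebesgue_on \<Omega>. norm (wgrad \<Omega> v x) \<le> \<sigma>) \<and>
     (\<forall>x\<in>frontier \<Omega>. v x = g x)}"

definition F :: "(nat \<Rightarrow> real) \<Rightarrow> real \<Rightarrow> 'a::euclidean_space set \<Rightarrow> ('a \<Rightarrow> real) \<Rightarrow>
    ('a \<Rightarrow> real) \<Rightarrow> ereal" where
  "F a \<sigma> \<Omega> f v = enn2ereal (\<integral>\<^sup>+x. G a \<sigma> (wgrad \<Omega> v x) \<partial>lebesgue_on \<Omega>)
     - ereal (LINT x|lebesgue_on \<Omega>. f x * v x)"

definition F_trunc :: "(nat \<Rightarrow> real) \<Rightarrow> nat \<Rightarrow> 'a::euclidean_space set \<Rightarrow> ('a \<Rightarrow> real) \<Rightarrow>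
    ('a \<Rightarrow> real) \<Rightarrow> real" where
  "F_trunc a n \<Omega> f v =
     (\<Sum>p=2..n. a p / real p * (LINT x|lebesgue_on \<Omega>. norm (wgrad \<Omega> v x) ^ p))
     - (LINT x|lebesgue_on \<Omega>. f x * v x)"

text \<open>The term \<open>\<integral>\<^sub>\<Omega> |\<nabla>u|\<^sup>p\<^sup>-\<^sup>2 \<nabla>u \<cdot> \<nabla>\<psi>\<close>, i.e. the weak form of \<open>-\<Delta>\<^sub>p u\<close> tested with \<open>\<psi>\<close>.\<close>

definition p_form :: "'a::euclidean_space set \<Rightarrow> nat \<Rightarrow> ('a \<Rightarrow> real) \<Rightarrow> ('a \<Rightarrow> real) \<Rightarrow> real" where
  "p_form \<Omega> p u \<psi> = (LINT x|lebesgue_on \<Omega>.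
     norm (wgrad \<Omega> u x) ^ (p - 2) * (wgrad \<Omega> u x \<bullet> wgrad \<Omega> \<psi> x))"

definition weak_solution :: "(nat \<Rightarrow> real) \<Rightarrow> real \<Rightarrow> 'a::euclidean_space set \<Rightarrow> ('a \<Rightarrow> real) \<Rightarrow>
    ('a \<Rightarrow> real) \<Rightarrow> ('a \<Rightarrow> real) \<Rightarrow> bool" where
  "weak_solution a \<sigma> \<Omega> f g u \<longleftrightarrow> u \<in> S \<Omega> \<sigma> g \<and>
     (\<forall>\<psi>\<in>W1_inf_0 \<Omega>. (\<lambda>p. a p * \<bar>p_form \<Omega> p u \<psi>\<bar>) summable_on {2..} \<longrightarrow>
        (\<Sum>\<^sub>\<infinity>p\<in>{2..}. a p * p_form \<Omega> p u \<psi>) = (LINT x|lebesgue_on \<Omega>. f x * \<psi> x))"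

end

theory Submission imports Defs begin

text \<open>
  Since \<open>un n - gbar\<close> lies in \<open>W\<^sub>0\<^sup>1\<^sup>,\<^sup>n\<close> and has a bounded gradient, its extension by zero agrees almost
  everywhere with a Lipschitz function on the whole space, which vanishes off the domain. Hence
  \<open>un n\<close> has a representative in \<open>S\<close>, and conversely the minimizer \<open>u\<close> is admissible for every
  truncated problem. Dropping the nonnegative terms with \<open>p > n\<close> from the energy of \<open>u\<close> gives
  \<open>F (un n) \<le> F u + tail\<close>, where the tail is controlled by the gradient bound \<open>K\<close>; strong
  convexity of the term \<open>p = 2\<close> along the segment from \<open>u\<close> to \<open>un n\<close> bounds the squared distance of
  the gradients by \<open>F (un n) - F u\<close>. So the gradients converge in the mean square, whence
  \<open>norm (grad u) \<le> K\<close>, and by the Poincare inequality and the common Lipschitz constant the functions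
  converge uniformly. As \<open>K < \<sigma>\<close>, the function \<open>u + t \<psi>\<close> is admissible for small \<open>t\<close> of either sign,
  and differentiating the power series at \<open>t = 0\<close> gives the weak equation.

  Neither Rademacher's theorem nor weak compactness is used: weak gradients of Lipschitz functions
  are strong limits of gradients of suitably chosen smooth approximations.
\<close>

subsection \<open>Smooth functions\<close>

text \<open>The obstacle is that a gradient bound on a nonconvex domain controls differences only
  along paths inside it, so a Lipschitz constant for \<open>un n\<close> would depend on the shape
  of the domain. Subtracting \<open>gbar\<close> removes this: the difference extended by zero lives
  on the whole space, where straight segments are available, and has the constant
  \<open>K + \<sigma>\<close> for every \<open>n\<close>. The Lipschitz boundary is what turns
  vanishing almost everywhere outside into vanishing on the frontier. The order of the conclusions
  is forced. The series may diverge where the gradient has norm \<sigma>, so at the start only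
  finiteness of the energy of \<open>u\<close> is known, and \<open>u\<close> cannot be perturbed
  freely. Convex combinations of \<open>u\<close> and \<open>un n\<close> are safe, because the
  energy is convex and finite at both ends; they yield the error estimate. Only the resulting
  convergence gives \<open>u\<close> the strict bound \<open>K < \<sigma>\<close>, which makes room
  for variations of either sign. The weak equation is thus derived from the minimality of
  \<open>u\<close> itself, and no limit is taken in the equations of the truncated problems.\<close>

abbreviation smooth :: "('a::euclidean_space \<Rightarrow> real) \<Rightarrow> bool" where
  "smooth \<phi> \<equiv> \<forall>k. Ck k \<phi>"

definition grad :: "('a::euclidean_space \<Rightarrow> real) \<Rightarrow> 'a \<Rightarrow> 'a" where
  "grad \<phi> x = (\<Sum>b\<in>Basis. frechet_derivative \<phi> (at x) b *\<^sub>R b)"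

text \<open>Smoothness is proved by exhibiting a class of differentiable functions that is stable
  under partial derivatives: the recursion of \<open>Ck\<close> then never leaves the class.\<close>

lemma Ck_coinduct:
  assumes "P \<phi>"
    and "\<And>\<phi> x. P \<phi> \<Longrightarrow> \<phi> differentiable (at x)"
    and "\<And>\<phi> b. P \<phi> \<Longrightarrow> b \<in> Basis \<Longrightarrow> P (\<lambda>x. frechet_derivative \<phi> (at x) b)"
  shows "Ck k \<phi>"
  using assms(1)
proof (induction k arbitrary: \<phi>)
  case 0
  then show ?case
    using assms(2) by (auto simp: continuous_on_eq_continuous_at differentiable_imp_continuous_within)
next
  case (Suc k)
  then show ?case using assms(2,3) by auto
qed

lemma smooth_differentiable: "smooth \<phi> \<Longrightarrow> \<phi> differentiable (at x)"
  by (metis Ck.simps(2))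

lemma smooth_partial: "smooth \<phi> \<Longrightarrow> b \<in> Basis \<Longrightarrow> smooth (\<lambda>x. frechet_derivative \<phi> (at x) b)"
  by (metis Ck.simps(2))

lemma smooth_continuous_on: "smooth \<phi> \<Longrightarrow> continuous_on A \<phi>"
  using continuous_on_subset by (metis Ck.simps(1) subset_UNIV)

lemma smooth_partial_continuous_on:
  "smooth \<phi> \<Longrightarrow> b \<in> Basis \<Longrightarrow> continuous_on A (\<lambda>x. frechet_derivative \<phi> (at x) b)"
  by (rule smooth_continuous_on[OF smooth_partial])

lemma smooth_grad_continuous_on: "smooth \<phi> \<Longrightarrow> continuous_on A (grad \<phi>)"
  unfolding grad_def by (intro continuous_intros smooth_partial_continuous_on)

lemma frechet_derivative_eqI: "(\<phi> has_derivative D) (at x) \<Longrightarrow> frechet_derivative \<phi> (at x) = D"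
  by (metis frechet_derivative_at)

lemma smooth_has_derivative:
  assumes "smooth \<phi>" shows "(\<phi> has_derivative (\<lambda>h. grad \<phi> x \<bullet> h)) (at x)"
proof -
  let ?D = "frechet_derivative \<phi> (at x)"
  have D: "(\<phi> has_derivative ?D) (at x)"
    using assms frechet_derivative_works smooth_differentiable by blast
  then have lin: "linear ?D" by (rule has_derivative_linear)
  have "?D h = grad \<phi> x \<bullet> h" for h
  proof -
    have "?D h = ?D (\<Sum>b\<in>Basis. (h \<bullet> b) *\<^sub>R b)" by (simp add: euclidean_representation)
    also have "\<dots> = (\<Sum>b\<in>Basis. (h \<bullet> b) * ?D b)"
      by (simp add: linear_sum[OF lin] linear_cmul[OF lin])
    also have "\<dots> = grad \<phi> x \<bullet> h"
      unfolding grad_def inner_sum_left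
      by (intro sum.cong) (auto simp: inner_commute)
    finally show ?thesis .
  qed
  then have "?D = (\<bullet>) (grad \<phi> x)" by (rule ext)
  with D show ?thesis by simp
qed

lemma smooth_frechet: "smooth \<phi> \<Longrightarrow> frechet_derivative \<phi> (at x) h = grad \<phi> x \<bullet> h"
  by (simp add: frechet_derivative_eqI[OF smooth_has_derivative])

lemma smooth_lincomb:
  assumes "smooth \<phi>" "smooth \<psi>" shows "smooth (\<lambda>x. c * \<phi> x + d * \<psi> x)"
proof
  fix k
  have D: "((\<lambda>x. c * f x + d * g x) has_derivative
         (\<lambda>h. c * frechet_derivative f (at x) h + d * frechet_derivative g (at x) h)) (at x)"
    if "smooth f" "smooth g" for f g :: "'a \<Rightarrow> real" and x :: 'a
    using that smooth_differentiable frechet_derivative_works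
    by (intro derivative_intros) blast+
  show "Ck k (\<lambda>x. c * \<phi> x + d * \<psi> x)"
  proof (rule Ck_coinduct[where P = "\<lambda>h. \<exists>f g. smooth f \<and> smooth g \<and> h = (\<lambda>x. c * f x + d * g x)"])
    show "\<exists>f g. smooth f \<and> smooth g \<and> (\<lambda>x. c * \<phi> x + d * \<psi> x) = (\<lambda>x. c * f x + d * g x)"
      using assms by blast
  next
    fix h :: "'a \<Rightarrow> real" and x :: 'a assume "\<exists>f g. smooth f \<and> smooth g \<and> h = (\<lambda>x. c * f x + d * g x)"
    then obtain f g :: "'a \<Rightarrow> real" where "smooth f" "smooth g" "h = (\<lambda>x. c * f x + d * g x)" by blast
    with D[of f g x] show "h differentiable (at x)" unfolding differentiable_def by blast
  next
    fix h :: "'a \<Rightarrow> real" and b :: 'a assume "\<exists>f g. smooth f \<and> smooth g \<and> h = (\<lambda>x. c * f x + d * g x)"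
      and b: "b \<in> Basis"
    then obtain f g where fg: "smooth f" "smooth g" and h: "h = (\<lambda>x. c * f x + d * g x)" by blast
    have "(\<lambda>x. frechet_derivative h (at x) b) =
      (\<lambda>x. c * frechet_derivative f (at x) b + d * frechet_derivative g (at x) b)"
      unfolding h by (simp add: frechet_derivative_eqI[OF D[OF fg]])
    then show "\<exists>f g. smooth f \<and> smooth g \<and> (\<lambda>x. frechet_derivative h (at x) b) = (\<lambda>x. c * f x + d * g x)"
      using smooth_partial[OF fg(1) b] smooth_partial[OF fg(2) b] by blast
  qed
qed

lemma grad_lincomb:
  assumes "smooth \<phi>" "smooth \<psi>"
  shows "grad (\<lambda>x. c * \<phi> x + d * \<psi> x) x = c *\<^sub>R grad \<phi> x + d *\<^sub>R grad \<psi> x"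
proof -
  have "((\<lambda>x. c * \<phi> x + d * \<psi> x) has_derivative (\<lambda>h. c * (grad \<phi> x \<bullet> h) + d * (grad \<psi> x \<bullet> h))) (at x)"
    by (intro derivative_intros smooth_has_derivative assms)
  from frechet_derivative_eqI[OF this]
  have *: "\<And>h. grad (\<lambda>x. c * \<phi> x + d * \<psi> x) x \<bullet> h = (c *\<^sub>R grad \<phi> x + d *\<^sub>R grad \<psi> x) \<bullet> h"
    using smooth_frechet[OF smooth_lincomb[OF assms]] by (metis inner_add_left inner_scaleR_left)
  show ?thesis by (rule euclidean_eqI) (use * in blast)
qed

text \<open>Differentiate in the direction of the gradient itself: the derivative is the squared
  norm of the gradient, while every difference quotient is at most \<open>L\<close> times its
  norm.\<close>

lemma lipschitz_grad_le:
  assumes "smooth \<phi>" "L-lipschitz_on \<Omega> \<phi>" "open \<Omega>" "x \<in> \<Omega>"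
  shows "norm (grad \<phi> x) \<le> L"
proof -
  have L: "L \<ge> 0" using assms(2) lipschitz_on_nonneg by blast
  let ?g = "grad \<phi> x"
  have D: "((\<lambda>t. \<phi> (x + t *\<^sub>R ?g)) has_derivative (\<lambda>t. t * (?g \<bullet> ?g))) (at 0)"
  proof -
    have "(\<phi> has_derivative (\<lambda>h. ?g \<bullet> h)) (at (x + 0 *\<^sub>R ?g))"
      using smooth_has_derivative[OF assms(1)] by simp
    moreover have "((\<lambda>t. x + t *\<^sub>R ?g) has_derivative (\<lambda>t. t *\<^sub>R ?g)) (at 0)"
      by (auto intro!: derivative_eq_intros)
    ultimately show ?thesis
      using has_derivative_compose[of "\<lambda>t. x + t *\<^sub>R ?g" _ 0 UNIV \<phi>] by force
  qed
  then have "((\<lambda>t. \<phi> (x + t *\<^sub>R ?g)) has_field_derivative ?g \<bullet> ?g) (at 0)"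
    by (simp add: has_field_derivative_def mult.commute[of "_ \<bullet> _"] mult_commute_abs)
  then have lim: "((\<lambda>t. (\<phi> (x + t *\<^sub>R ?g) - \<phi> x) / t) \<longlongrightarrow> ?g \<bullet> ?g) (at 0)"
    by (simp add: has_field_derivative_iff)
  have ev: "\<forall>\<^sub>F t in at 0. x + t *\<^sub>R ?g \<in> \<Omega>"
  proof -
    have "((\<lambda>t. x + t *\<^sub>R ?g) \<longlongrightarrow> x + 0 *\<^sub>R ?g) (at 0)" by (intro tendsto_intros)
    then show ?thesis using topological_tendstoD[OF _ assms(3)] assms(4) by force
  qed
  have "?g \<bullet> ?g \<le> L * norm ?g"
  proof (rule tendsto_upperbound[OF lim])
    show "\<forall>\<^sub>F t in at 0. (\<phi> (x + t *\<^sub>R ?g) - \<phi> x) / t \<le> L * norm ?g"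
      using ev eventually_neq_at_within[of 0 0 UNIV]
    proof eventually_elim
      case (elim t)
      have "\<bar>\<phi> (x + t *\<^sub>R ?g) - \<phi> x\<bar> \<le> L * (\<bar>t\<bar> * norm ?g)"
        using lipschitz_onD[OF assms(2) elim(1) assms(4)] by (simp add: dist_real_def dist_norm)
      then have "\<bar>(\<phi> (x + t *\<^sub>R ?g) - \<phi> x) / t\<bar> \<le> L * norm ?g"
        using elim(2) by (simp add: field_simps abs_divide)
      then show ?case by linarith
    qed
  qed simp
  then have "norm ?g * norm ?g \<le> L * norm ?g" by (simp add: power2_norm_eq_inner flip: power2_eq_square)
  then show ?thesis using L by (cases "norm ?g = 0") auto
qed

subsection \<open>Bump functions\<close>

text \<open>With \<open>P = 1\<close> this is the classical flat function exp(-1/t). The polynomial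
  factor in 1/t makes the family closed under differentiation.\<close>

definition flat :: "real poly \<Rightarrow> real \<Rightarrow> real" where
  "flat P t = (if t > 0 then poly P (1 / t) * exp (- (1 / t)) else 0)"

lemma flat_tendsto_0: "(flat P \<longlongrightarrow> 0) (at_right 0)"
proof -
  have "((\<lambda>s. poly P s * exp (- s)) \<longlongrightarrow> 0) at_top"
  proof -
    have "((\<lambda>s. \<Sum>i\<le>degree P. coeff P i * (s ^ i / exp s)) \<longlongrightarrow> (\<Sum>i\<le>degree P. coeff P i * 0)) at_top"
      by (intro tendsto_intros tendsto_power_div_exp_0)
    then show ?thesis
      by (simp add: poly_altdef sum_distrib_right exp_minus divide_inverse mult.assoc)
  qed
  then have "((\<lambda>t. poly P (1/t) * exp (- (1/t))) \<longlongrightarrow> 0) (at_right 0)"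
    using filterlim_compose[OF _ filterlim_inverse_at_top_right, of "\<lambda>s. poly P s * exp (- s)"]
    by (simp add: inverse_eq_divide)
  moreover have "\<forall>\<^sub>F t in at_right 0. poly P (1/t) * exp (- (1/t)) = flat P t"
    by (auto simp: flat_def eventually_at_filter)
  ultimately show ?thesis by (rule Lim_transform_eventually)
qed

text \<open>The chain rule with inner derivative -1/t^2 turns \<open>P\<close> into X^2 (P - P'),
  which is the polynomial in the statement. At the origin the difference quotient is again a member
  of the family, with polynomial X P, and therefore tends to 0.\<close>

lemma flat_has_derivative:
  "(flat P has_real_derivative flat ([:0, 0, 1:] * (P - pderiv P)) t) (at t)"
proof (cases t "0::real" rule: linorder_cases)
  case less
  have "((\<lambda>_. 0::real) has_real_derivative 0) (at t)" by simp
  moreover have "\<forall>\<^sub>F x in nhds t. flat P x = 0"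
    using eventually_nhds_in_open[of "{..<0}" t] less by (auto simp: flat_def elim!: eventually_mono)
  ultimately show ?thesis using less
    by (subst DERIV_cong_ev[OF refl _ refl]) (auto simp: flat_def)
next
  case greater
  have ev: "\<forall>\<^sub>F x in nhds t. flat P x = poly P (1/x) * exp (-(1/x))"
    using eventually_nhds_in_open[of "{0<..}" t] greater by (auto simp: flat_def elim!: eventually_mono)
  have "((\<lambda>x. poly P (1/x) * exp (-(1/x))) has_real_derivative
     (poly (pderiv P) (1/t) * (- 1 / t^2) * exp (-(1/t)) + (exp (-(1/t)) * (1/t^2)) * poly P (1/t))) (at t)"
    using greater by (auto intro!: derivative_eq_intros DERIV_chain2[OF poly_DERIV] simp: power2_eq_square)
  moreover have "(poly (pderiv P) (1/t) * (- 1 / t^2) * exp (-(1/t)) + (exp (-(1/t)) * (1/t^2)) * poly P (1/t))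
     = flat ([:0, 0, 1:] * (P - pderiv P)) t"
    using greater by (simp add: flat_def field_simps power2_eq_square)
  ultimately show ?thesis
    by (subst DERIV_cong_ev[OF refl ev refl]) simp
next
  case equal
  have eq: "flat P h / h = flat ([:0,1:] * P) h" for h
    by (auto simp: flat_def)
  have "((\<lambda>h. flat P h / h) \<longlongrightarrow> 0) (at 0)"
  proof (rule filterlim_split_at)
    show "((\<lambda>h. flat P h / h) \<longlongrightarrow> 0) (at_right 0)" unfolding eq by (rule flat_tendsto_0)
    show "((\<lambda>h. flat P h / h) \<longlongrightarrow> 0) (at_left 0)"
      by (rule tendsto_eventually) (auto simp: flat_def eventually_at_filter)
  qed
  then show ?thesis using equal by (simp add: has_field_derivative_iff flat_def)
qed

text \<open>A class containing the bumps and stable under partial derivatives, made for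
  \<open>Ck_coinduct\<close>. Sums and constants are included because the product and chain rules
  produce them.\<close>

inductive flat_algebra :: "('a::euclidean_space \<Rightarrow> real) \<Rightarrow> bool" where
  const: "flat_algebra (\<lambda>_. c)"
| flat: "flat_algebra (\<lambda>x. flat P (m * (x \<bullet> b) + c))"
| add: "flat_algebra f \<Longrightarrow> flat_algebra g \<Longrightarrow> flat_algebra (\<lambda>x. f x + g x)"
| mult: "flat_algebra f \<Longrightarrow> flat_algebra g \<Longrightarrow> flat_algebra (\<lambda>x. f x * g x)"

lemma flat_algebra_derivative:
  "flat_algebra f \<Longrightarrow> \<exists>D. (\<forall>x. (f has_derivative D x) (at x)) \<and> (\<forall>b. flat_algebra (\<lambda>x. D x b))"
proof (induction rule: flat_algebra.induct)
  case (const c)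
  show ?case by (rule exI[of _ "\<lambda>_ _. 0"]) (auto intro: flat_algebra.const)
next
  case (flat P m e c)
  let ?Q = "[:0, 0, 1:] * (P - pderiv P)"
  have D: "((\<lambda>x. flat P (m * (x \<bullet> e) + c)) has_derivative
      (\<lambda>h. flat ?Q (m * (x \<bullet> e) + c) * (m * (h \<bullet> e)))) (at x)" for x
  proof -
    have "(flat P has_derivative (*) (flat ?Q (m * (x \<bullet> e) + c))) (at (m * (x \<bullet> e) + c))"
      using flat_has_derivative[of P "m * (x \<bullet> e) + c"] unfolding has_field_derivative_def .
    moreover have "((\<lambda>x. m * (x \<bullet> e) + c) has_derivative (\<lambda>h. m * (h \<bullet> e))) (at x)"
      by (auto intro!: derivative_eq_intros)
    ultimately show ?thesis
      using has_derivative_compose[of "\<lambda>x. m * (x \<bullet> e) + c" _ x UNIV "flat P"] by force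
  qed
  show ?case
    by (rule exI[of _ "\<lambda>x h. flat ?Q (m * (x \<bullet> e) + c) * (m * (h \<bullet> e))"])
       (intro conjI allI D flat_algebra.intros)
next
  case (add f g)
  then obtain D E where
    D: "\<forall>x. (f has_derivative D x) (at x)" "\<forall>b. flat_algebra (\<lambda>x. D x b)" and
    E: "\<forall>x. (g has_derivative E x) (at x)" "\<forall>b. flat_algebra (\<lambda>x. E x b)" by blast
  show ?case
    by (rule exI[of _ "\<lambda>x h. D x h + E x h"])
       (use D E in \<open>auto intro: flat_algebra.add has_derivative_add\<close>)
next
  case (mult f g)
  then obtain D E where
    D: "\<forall>x. (f has_derivative D x) (at x)" "\<forall>b. flat_algebra (\<lambda>x. D x b)" and
    E: "\<forall>x. (g has_derivative E x) (at x)" "\<forall>b. flat_algebra (\<lambda>x. E x b)" by blast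
  have "((\<lambda>x. f x * g x) has_derivative (\<lambda>h. f x * E x h + D x h * g x)) (at x)" for x
    by (rule has_derivative_mult) (use D E in auto)
  then show ?case
    by (intro exI[of _ "\<lambda>x h. f x * E x h + D x h * g x"] conjI allI
         flat_algebra.add flat_algebra.mult mult.hyps D(2)[rule_format] E(2)[rule_format])
qed

lemma flat_algebra_smooth:
  assumes "flat_algebra f" shows "smooth f"
proof
  fix k show "Ck k f"
  proof (rule Ck_coinduct[where P = flat_algebra, OF assms])
    fix h :: "'a \<Rightarrow> real" assume h: "flat_algebra h"
    then obtain D where D: "\<forall>x. (h has_derivative D x) (at x)" "\<forall>b. flat_algebra (\<lambda>x. D x b)"
      using flat_algebra_derivative by blast
    show "h differentiable (at x)" for x using D unfolding differentiable_def by blast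
    show "flat_algebra (\<lambda>x. frechet_derivative h (at x) b)" for b
      using D by (simp add: frechet_derivative_eqI[OF D(1)[rule_format]])
  qed
qed

lemma flat_algebra_prod: "(\<And>i. i \<in> I \<Longrightarrow> flat_algebra (f i)) \<Longrightarrow> flat_algebra (\<lambda>x. \<Prod>i\<in>I. f i x)"
  by (induction I rule: infinite_finite_induct) (auto intro: flat_algebra.intros)

text \<open>For \<open>m > 0\<close> it is positive exactly on the open box. The parameter
  \<open>m\<close> is a steepness: since exp(-1/(m s)) tends to 1 for every s > 0, the bumps tend to
  the indicator of the box as \<open>m\<close> grows.\<close>

definition bump :: "'a::euclidean_space \<Rightarrow> 'a \<Rightarrow> real \<Rightarrow> 'a \<Rightarrow> real" where
  "bump c d m x = (\<Prod>b\<in>Basis. flat 1 (m * (x \<bullet> b) + - m * (c \<bullet> b)) * flat 1 (- m * (x \<bullet> b) + m * (d \<bullet> b)))"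

lemma smooth_bump: "smooth (bump c d m)"
  unfolding bump_def by (intro flat_algebra_smooth flat_algebra_prod flat_algebra.mult flat_algebra.flat)

lemma flat_1_bounds: "0 \<le> flat 1 t" "flat 1 t \<le> 1" "flat 1 t = 0 \<longleftrightarrow> t \<le> 0"
  by (auto simp: flat_def)

lemma bump_nonneg: "0 \<le> bump c d m x"
  unfolding bump_def by (intro prod_nonneg mult_nonneg_nonneg flat_1_bounds ballI)

lemma bump_le_1: "bump c d m x \<le> 1"
  unfolding bump_def by (intro prod_le_1 conjI mult_nonneg_nonneg mult_le_one flat_1_bounds)

lemma bump_eq_0_iff:
  assumes "m > 0" shows "bump c d m x = 0 \<longleftrightarrow> x \<notin> box c d"
proof -
  have "m * (x \<bullet> b) + - m * (c \<bullet> b) \<le> 0 \<longleftrightarrow> x \<bullet> b \<le> c \<bullet> b"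
       "- m * (x \<bullet> b) + m * (d \<bullet> b) \<le> 0 \<longleftrightarrow> d \<bullet> b \<le> x \<bullet> b" for b
    using assms by auto
  then show ?thesis by (auto simp: bump_def flat_1_bounds mem_box not_less)
qed

lemma bump_tendsto_indicator:
  "(\<lambda>m. bump c d (real (Suc m)) x) \<longlonglongrightarrow> indicator (box c d) x"
proof -
  have fl: "(\<lambda>m. flat 1 (real (Suc m) * s)) \<longlonglongrightarrow> (if s > 0 then 1 else 0)" for s :: real
  proof (cases "s > 0")
    case True
    have "(\<lambda>m. exp (- (inverse (real (Suc m)) * inverse s))) \<longlonglongrightarrow> exp (- (0 * inverse s))"
      by (intro tendsto_intros LIMSEQ_inverse_real_of_nat)
    moreover have "flat 1 (real (Suc m) * s) = exp (- (inverse (real (Suc m)) * inverse s))" for m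
      using True by (simp add: flat_def divide_inverse)
    ultimately show ?thesis using True by simp
  next
    case False
    then have "flat 1 (real (Suc m) * s) = 0" for m by (auto simp: flat_1_bounds mult_le_0_iff)
    then show ?thesis using False by simp
  qed
  have "bump c d (real (Suc m)) x = (\<Prod>b\<in>Basis. flat 1 (real (Suc m) * (x \<bullet> b - c \<bullet> b)) *
         flat 1 (real (Suc m) * (d \<bullet> b - x \<bullet> b)))" for m
    unfolding bump_def by (simp only: right_diff_distrib minus_mult_left[symmetric]) (simp add: algebra_simps)
  moreover have "(\<lambda>m. \<Prod>b\<in>Basis. flat 1 (real (Suc m) * (x \<bullet> b - c \<bullet> b)) *
         flat 1 (real (Suc m) * (d \<bullet> b - x \<bullet> b))) \<longlonglongrightarrow>
       (\<Prod>b\<in>Basis. (if x \<bullet> b - c \<bullet> b > 0 then 1 else 0) * (if d \<bullet> b - x \<bullet> b > 0 then 1 else 0))"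
    by (intro tendsto_intros fl)
  moreover have "(\<Prod>b\<in>Basis. (if x \<bullet> b - c \<bullet> b > 0 then 1 else 0) * (if d \<bullet> b - x \<bullet> b > 0 then 1 else (0::real)))
     = indicator (box c d) x"
    by (force simp: indicator_def mem_box)
  ultimately show ?thesis by simp
qed

subsection \<open>Mollification of Lipschitz functions\<close>

text \<open>Integrating over a fixed compact box instead of the whole space puts the convolution
  within reach of the Leibniz rule for parameter integrals, for any continuous
  \<open>v\<close>.\<close>

lemma mollification_has_derivative:
  fixes \<rho> v :: "'a::euclidean_space \<Rightarrow> real"
  assumes \<rho>: "smooth \<rho>" and v: "continuous_on UNIV v"
  shows "((\<lambda>x. integral (cbox a b) (\<lambda>y. \<rho> (x - y) * v y)) has_derivative
          (\<lambda>h. integral (cbox a b) (\<lambda>y. frechet_derivative \<rho> (at (x - y)) h * v y))) (at x)"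
proof -
  let ?w = "\<lambda>x y. v y *\<^sub>R grad \<rho> (x - y)"
  have cg: "continuous_on A (grad \<rho>)" for A by (rule smooth_grad_continuous_on[OF \<rho>])
  have cv: "continuous_on A v" for A using v continuous_on_subset by blast
  have c\<rho>: "continuous_on A \<rho>" for A by (rule smooth_continuous_on[OF \<rho>])
  have cw: "continuous_on (cbox a b) (?w x)" for x
    by (intro continuous_intros cv continuous_on_compose2[OF cg[of UNIV]]) auto
  have "((\<lambda>x. integral (cbox a b) (\<lambda>y. \<rho> (x - y) * v y)) has_derivative
      integral (cbox a b) (\<lambda>y. blinfun_inner_right (?w x y))) (at x within UNIV)"
  proof (rule leibniz_rule)
    fix x y :: 'a
    have "((\<lambda>x. x - y) has_derivative (\<lambda>h. h)) (at x)"
      by (auto intro!: derivative_eq_intros)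
    then have "((\<lambda>x. \<rho> (x - y)) has_derivative (\<lambda>h. grad \<rho> (x - y) \<bullet> h)) (at x)"
      using has_derivative_compose[OF _ smooth_has_derivative[OF \<rho>]] by blast
    from has_derivative_mult_left[OF this, of "v y"]
    show "((\<lambda>x. \<rho> (x - y) * v y) has_derivative blinfun_apply (blinfun_inner_right (?w x y))) (at x within UNIV)"
      by (simp add: mult.commute fun_eq_iff inner_scaleR_left[abs_def])
  next
    fix x show "(\<lambda>y. \<rho> (x - y) * v y) integrable_on cbox a b"
      by (intro integrable_continuous continuous_intros cv continuous_on_compose2[OF c\<rho>[of UNIV]]) auto
  next
    show "continuous_on (UNIV \<times> cbox a b) (\<lambda>(x, y). blinfun_inner_right (?w x y))"
      unfolding split_beta
      by (intro bounded_linear.continuous_on[OF bounded_linear_blinfun_inner_right] continuous_intros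
           continuous_on_compose2[OF cv[of UNIV]] continuous_on_compose2[OF cg[of UNIV]]) auto
  qed auto
  also have "integral (cbox a b) (\<lambda>y. blinfun_inner_right (?w x y)) = blinfun_inner_right (integral (cbox a b) (?w x))"
    using integral_linear[OF integrable_continuous[OF cw] bounded_linear_blinfun_inner_right]
    by (simp add: o_def)
  finally have *: "((\<lambda>x. integral (cbox a b) (\<lambda>y. \<rho> (x - y) * v y)) has_derivative
      (\<lambda>h. integral (cbox a b) (?w x) \<bullet> h)) (at x)"
    by simp
  have "integral (cbox a b) (?w x) \<bullet> h =
      integral (cbox a b) (\<lambda>y. frechet_derivative \<rho> (at (x - y)) h * v y)" for h
    using integral_linear[OF integrable_continuous[OF cw] bounded_linear_inner_left[of h]]
    by (simp add: o_def smooth_frechet[OF \<rho>] mult.commute)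
  with * show ?thesis by (simp only: fun_eq_iff)
qed

text \<open>All derivatives fall on the kernel, so the mollifications of a fixed \<open>v\<close> by
  arbitrary smooth kernels form a class stable under partial derivatives.\<close>

lemma smooth_mollification:
  fixes \<rho> v :: "'a::euclidean_space \<Rightarrow> real"
  assumes \<rho>: "smooth \<rho>" and v: "continuous_on UNIV v"
  shows "smooth (\<lambda>x. integral (cbox a b) (\<lambda>y. \<rho> (x - y) * v y))"
proof
  fix k
  let ?J = "\<lambda>\<rho> x. integral (cbox a b) (\<lambda>y. \<rho> (x - y) * v y)"
  show "Ck k (?J \<rho>)"
  proof (rule Ck_coinduct[where P = "\<lambda>h. \<exists>\<rho>. smooth \<rho> \<and> h = ?J \<rho>"])
    show "\<exists>\<rho>'. smooth \<rho>' \<and> ?J \<rho> = ?J \<rho>'" using \<rho> by blast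
  next
    fix h :: "'a \<Rightarrow> real" and x :: 'a assume "\<exists>\<rho>. smooth \<rho> \<and> h = ?J \<rho>"
    then show "h differentiable (at x)"
      using mollification_has_derivative[OF _ v] unfolding differentiable_def by blast
  next
    fix h :: "'a \<Rightarrow> real" and e :: 'a assume "\<exists>\<rho>. smooth \<rho> \<and> h = ?J \<rho>" and e: "e \<in> Basis"
    then obtain \<rho> where \<rho>: "smooth \<rho>" and h: "h = ?J \<rho>" by blast
    have "(\<lambda>x. frechet_derivative h (at x) e) = ?J (\<lambda>z. frechet_derivative \<rho> (at z) e)"
      unfolding h by (simp add: frechet_derivative_eqI[OF mollification_has_derivative[OF \<rho> v]])
    then show "\<exists>\<rho>. smooth \<rho> \<and> (\<lambda>x. frechet_derivative h (at x) e) = ?J \<rho>"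
      using smooth_partial[OF \<rho> e] by blast
  qed
qed

lemma lborel_reflect: "distr lborel borel (\<lambda>y. x - y) = (lborel :: 'a::euclidean_space measure)"
  by (subst (2) lborel_affine[of "-1" x]) (auto simp: density_1)

lemma lborel_integral_reflect:
  fixes f :: "'a::euclidean_space \<Rightarrow> real"
  assumes "f \<in> borel_measurable borel"
  shows "(LINT y|lborel. f (x - y)) = (LINT y|lborel. f y)"
  by (subst lborel_reflect[of x, symmetric]) (rule integral_distr[symmetric]; use assms in measurable)

lemma integrable_continuous_bounded_support:
  fixes f :: "'a::euclidean_space \<Rightarrow> 'b::{banach, second_countable_topology}"
  assumes "continuous_on UNIV f" "bounded A" "\<And>x. x \<notin> A \<Longrightarrow> f x = 0"
  shows "integrable lborel f"
proof -
  have "integrable lborel (\<lambda>x. indicator (closure A) x *\<^sub>R f x)"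
    using assms by (intro borel_integrable_compact) (auto intro: continuous_on_subset)
  moreover have "(\<lambda>x. indicator (closure A) x *\<^sub>R f x) = f"
    using assms(3) closure_subset by (fastforce simp: indicator_def)
  ultimately show ?thesis by simp
qed

lemma mollifier_exists:
  fixes r :: real
  assumes "r > 0"
  obtains \<rho> :: "'a::euclidean_space \<Rightarrow> real" where
    "smooth \<rho>" "\<And>x. \<rho> x \<ge> 0" "\<And>x. norm x > r \<Longrightarrow> \<rho> x = 0" "(LINT x|lborel. \<rho> x) = 1"
proof -
  \<comment> \<open>With this half-width the cube has l1 radius \<open>r\<close>, and the Euclidean
    norm is at most the l1 norm, so the bump vanishes outside the ball of radius
    \<open>r\<close>.\<close>
  define \<delta> where "\<delta> = r / DIM('a)"
  have \<delta>: "\<delta> > 0" using assms by (simp add: \<delta>_def)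
  define c d :: 'a where "c = - \<delta> *\<^sub>R One" and "d = \<delta> *\<^sub>R One"
  have cd: "c \<bullet> b = - \<delta>" "d \<bullet> b = \<delta>" if "b \<in> Basis" for b
    using that by (auto simp: c_def d_def)
  let ?B = "bump c d 1"
  have out: "?B x = 0" if "norm x > r" for x
  proof -
    have "x \<notin> box c d"
    proof
      assume "x \<in> box c d"
      then have "\<bar>x \<bullet> b\<bar> \<le> \<delta>" if "b \<in> Basis" for b
        using that by (force simp: mem_box cd)
      then have "(\<Sum>b\<in>Basis. \<bar>x \<bullet> b\<bar>) \<le> (\<Sum>b\<in>(Basis :: 'a set). \<delta>)" by (intro sum_mono)
      also have "\<dots> = r" by (simp add: \<delta>_def)
      finally show False using that norm_le_l1[of x] by linarith
    qed
    then show ?thesis using bump_eq_0_iff[of 1 c d x] by simp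
  qed
  have cont: "continuous_on UNIV ?B" by (rule smooth_continuous_on[OF smooth_bump])
  have int: "integrable lborel ?B"
    by (rule integrable_continuous_bounded_support[OF cont bounded_cball[of 0 r]])
       (use out in \<open>auto simp: not_le\<close>)
  have "(LINT x|lborel. ?B x) \<noteq> 0"
  proof
    assume "(LINT x|lborel. ?B x) = 0"
    then have "AE x in lborel. ?B x = 0"
      by (subst (asm) integral_nonneg_eq_0_iff_AE[OF int]) (auto simp: bump_nonneg)
    then have "AE x in lborel. x \<notin> box c d" using bump_eq_0_iff[of 1 c d] by simp
    then have "emeasure lborel (box c d) = 0"
      by (subst (asm) AE_iff_measurable[OF _ refl]) auto
    moreover have "emeasure lborel (box c d) = (\<Prod>b\<in>(Basis :: 'a set). 2 * \<delta>)"
      using \<delta> by (subst emeasure_lborel_box) (auto simp: cd inner_diff_left prod_ennreal intro!: prod.cong)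
    ultimately show False using \<delta> by simp
  qed
  then have pos: "(LINT x|lborel. ?B x) > 0"
    by (simp add: order_less_le Bochner_Integration.integral_nonneg bump_nonneg)
  let ?c = "LINT x|lborel. ?B x"
  show thesis
  \<comment> \<open>The vanishing second summand gives the normalized bump the shape of
    \<open>smooth_lincomb\<close>.\<close>
  proof (rule that[of "\<lambda>x. (1 / ?c) * ?B x + 0 * ?B x"])
    show "smooth (\<lambda>x. (1 / ?c) * ?B x + 0 * ?B x)" by (rule smooth_lincomb[OF smooth_bump smooth_bump])
  qed (use pos out in \<open>auto simp: zero_le_divide_iff bump_nonneg\<close>)
qed

text \<open>The mollification is an average of translates of \<open>v\<close>. Averaging preserves
  the Lipschitz constant exactly, moves values by at most \<open>L\<close> times the radius of the
  kernel, and enlarges the support by at most that radius.\<close>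

lemma mollify_lipschitz:
  fixes v :: "'a::euclidean_space \<Rightarrow> real"
  assumes v: "L-lipschitz_on UNIV v" and "bounded \<Omega>" and "\<epsilon> > 0"
  obtains \<phi> where "smooth \<phi>" "\<And>x. x \<in> \<Omega> \<Longrightarrow> \<bar>\<phi> x - v x\<bar> \<le> \<epsilon>" "L-lipschitz_on \<Omega> \<phi>"
    "\<And>x. \<phi> x \<noteq> 0 \<Longrightarrow> \<exists>y. dist x y \<le> \<epsilon> \<and> v y \<noteq> 0"
proof -
  have L: "L \<ge> 0" using v lipschitz_on_nonneg by blast
  \<comment> \<open>One radius serves both purposes: it bounds the spread of the support,
    \<open>r \<le> \<epsilon>\<close>, and the error in the values,
    \<open>L * r \<le> \<epsilon>\<close>. The summand 1 also covers \<open>L = 0\<close>.\<close>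
  define r where "r = \<epsilon> / (L + 1)"
  have r: "r > 0" "r \<le> \<epsilon>" "L * r \<le> \<epsilon>"
    using assms(3) L by (auto simp: r_def field_simps)
  obtain \<rho> :: "'a \<Rightarrow> real" where \<rho>: "smooth \<rho>" "\<And>x. \<rho> x \<ge> 0" "\<And>x. norm x > r \<Longrightarrow> \<rho> x = 0"
      "(LINT x|lborel. \<rho> x) = 1"
    using mollifier_exists[OF r(1)] by blast
  have cv: "continuous_on UNIV v" by (rule lipschitz_on_continuous_on[OF v])
  have c\<rho>: "continuous_on UNIV \<rho>" by (rule smooth_continuous_on[OF \<rho>(1)])
  \<comment> \<open>A box containing the \<open>r\<close>-neighbourhood of the domain: for points of
    the domain the integral over this box is the full convolution.\<close>
  have "bounded ((\<lambda>(x, z). x + z) ` (\<Omega> \<times> cball 0 r))" by (intro bounded_plus assms bounded_cball)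
  then obtain c d where cd: "(\<lambda>(x, z). x + z) ` (\<Omega> \<times> cball 0 r) \<subseteq> cbox c d"
    using bounded_subset_cbox_symmetric by metis
  let ?\<phi> = "\<lambda>x. integral (cbox c d) (\<lambda>y. \<rho> (x - y) * v y)"
  have int: "integrable lborel (\<lambda>z. \<rho> z * v (x - z))" for x
    by (rule integrable_continuous_bounded_support[OF _ bounded_cball[of 0 r]])
       (use \<rho>(3) in \<open>auto intro!: continuous_intros c\<rho> continuous_on_compose2[OF cv] simp: not_le\<close>)
  have int\<rho>: "integrable lborel \<rho>"
    by (rule integrable_continuous_bounded_support[OF c\<rho> bounded_cball[of 0 r]])
       (use \<rho>(3) in \<open>auto simp: not_le\<close>)
  have eq: "?\<phi> x = (LINT z|lborel. \<rho> z * v (x - z))" if "x \<in> \<Omega>" for x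
  proof -
    let ?f = "\<lambda>y. \<rho> (x - y) * v y"
    have cf: "continuous_on UNIV ?f"
      by (intro continuous_intros cv continuous_on_compose2[OF c\<rho>]) auto
    have z: "?f y = 0" if "y \<notin> cbox c d" for y
    proof -
      have "y - x \<notin> cball 0 r"
        using cd that \<open>x \<in> \<Omega>\<close> by force
      then show ?thesis using \<rho>(3)[of "x - y"] by (simp add: not_le norm_minus_commute)
    qed
    have i: "integrable lborel ?f"
      by (rule integrable_continuous_bounded_support[OF cf bounded_cbox z])
    have "?\<phi> x = integral UNIV (\<lambda>y. if y \<in> cbox c d then ?f y else 0)"
      by (simp add: integral_restrict_UNIV)
    also have "\<dots> = integral UNIV ?f" by (rule integral_cong) (use z in auto)
    also have "\<dots> = (LINT y|lborel. ?f y)" by (rule integral_lborel[OF i])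
    also have "\<dots> = (LINT y|lborel. (\<lambda>z. \<rho> z * v (x - z)) (x - y))" by simp
    also have "\<dots> = (LINT z|lborel. \<rho> z * v (x - z))"
      using int by (intro lborel_integral_reflect) auto
    finally show ?thesis .
  qed
  show thesis
  proof
    show "smooth ?\<phi>" by (rule smooth_mollification[OF \<rho>(1) cv])
  next
    fix x assume x: "x \<in> \<Omega>"
    have "\<bar>?\<phi> x - v x\<bar> = \<bar>(LINT z|lborel. \<rho> z * v (x - z)) - (LINT z|lborel. \<rho> z * v x)\<bar>"
      using \<rho>(4) by (simp add: eq[OF x])
    also have "\<dots> = \<bar>LINT z|lborel. \<rho> z * v (x - z) - \<rho> z * v x\<bar>"
      using int int\<rho> by simp
    also have "\<dots> \<le> (LINT z|lborel. \<rho> z * \<epsilon>)"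
    proof (rule integral_abs_bound_integral)
      show "integrable lborel (\<lambda>z. \<rho> z * v (x - z) - \<rho> z * v x)" "integrable lborel (\<lambda>z. \<rho> z * \<epsilon>)"
        using int int\<rho> by auto
      fix z :: 'a
      show "\<bar>\<rho> z * v (x - z) - \<rho> z * v x\<bar> \<le> \<rho> z * \<epsilon>"
      proof (cases "norm z > r")
        case False
        have "\<bar>v (x - z) - v x\<bar> \<le> L * norm z"
          using lipschitz_onD[OF v, of "x - z" x] by (simp add: dist_real_def dist_norm)
        also have "\<dots> \<le> \<epsilon>" using False r(3) L by (meson mult_left_mono not_less order_trans)
        finally show ?thesis
          using \<rho>(2)[of z] by (metis abs_mult abs_of_nonneg mult_left_mono right_diff_distrib')
      qed (use \<rho>(3) in simp)
    qed
    also have "\<dots> = \<epsilon>" using \<rho>(4) by simp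
    finally show "\<bar>?\<phi> x - v x\<bar> \<le> \<epsilon>" .
  next
    show "L-lipschitz_on \<Omega> ?\<phi>"
    proof (rule lipschitz_onI[OF _ L])
      fix x y assume x: "x \<in> \<Omega>" and y: "y \<in> \<Omega>"
      have "\<bar>?\<phi> x - ?\<phi> y\<bar> = \<bar>LINT z|lborel. \<rho> z * v (x - z) - \<rho> z * v (y - z)\<bar>"
        using int by (simp add: eq[OF x] eq[OF y])
      also have "\<dots> \<le> (LINT z|lborel. \<rho> z * (L * dist x y))"
      proof (rule integral_abs_bound_integral)
        show "integrable lborel (\<lambda>z. \<rho> z * v (x - z) - \<rho> z * v (y - z))" "integrable lborel (\<lambda>z. \<rho> z * (L * dist x y))"
          using int int\<rho> by auto
        fix z :: 'a
        have "\<bar>v (x - z) - v (y - z)\<bar> \<le> L * dist x y"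
          using lipschitz_onD[OF v, of "x - z" "y - z"] by (simp add: dist_real_def dist_norm)
        then show "\<bar>\<rho> z * v (x - z) - \<rho> z * v (y - z)\<bar> \<le> \<rho> z * (L * dist x y)"
          using \<rho>(2)[of z] by (metis abs_mult abs_of_nonneg mult_left_mono right_diff_distrib')
      qed
      also have "\<dots> = L * dist x y" using \<rho>(4) by simp
      finally show "dist (?\<phi> x) (?\<phi> y) \<le> L * dist x y" by (simp add: dist_real_def)
    qed
  next
    fix x assume nz: "?\<phi> x \<noteq> 0"
    show "\<exists>y. dist x y \<le> \<epsilon> \<and> v y \<noteq> 0"
    proof (rule ccontr)
      assume n: "\<not> ?thesis"
      have "\<rho> (x - y) * v y = 0" for y
        using n \<rho>(3)[of "x - y"] r(2) by (cases "dist x y \<le> \<epsilon>") (auto simp: dist_norm)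
      then have "(\<lambda>y. \<rho> (x - y) * v y) = (\<lambda>_. 0)" by (rule ext)
      then have "?\<phi> x = 0" by (simp only: integral_0)
      with nz show False by simp
    qed
  qed
qed

subsection \<open>Weak gradients\<close>

lemma lebesgue_on_supported:
  fixes f :: "'a::euclidean_space \<Rightarrow> 'b::euclidean_space"
  assumes "\<Omega> \<in> sets lebesgue" "\<And>x. x \<notin> \<Omega> \<Longrightarrow> f x = 0"
  shows "integrable (lebesgue_on \<Omega>) f \<longleftrightarrow> integrable lebesgue f"
    and "(LINT x|lebesgue_on \<Omega>. f x) = (LINT x|lebesgue. f x)"
proof -
  have "(\<lambda>x. indicator \<Omega> x *\<^sub>R f x) = f" using assms(2) by (auto simp: fun_eq_iff indicator_def)
  then show "integrable (lebesgue_on \<Omega>) f \<longleftrightarrow> integrable lebesgue f"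
    "(LINT x|lebesgue_on \<Omega>. f x) = (LINT x|lebesgue. f x)"
    using assms(1) by (simp_all add: integrable_restrict_space integral_restrict_space)
qed

lemma locally_integrable_continuous:
  fixes f :: "'a::euclidean_space \<Rightarrow> 'b::euclidean_space"
  assumes "continuous_on UNIV f" shows "locally_integrable \<Omega> f"
  unfolding locally_integrable_def set_integrable_def
proof (intro allI impI)
  fix S :: "'a set" assume "compact S \<and> S \<subseteq> \<Omega>"
  then have "integrable lborel (\<lambda>x. indicator S x *\<^sub>R f x)"
    using assms by (intro borel_integrable_compact) (auto intro: continuous_on_subset)
  then show "integrable lebesgue (\<lambda>x. indicator S x *\<^sub>R f x)"
    using integrable_completion borel_measurable_integrable by blast
qed

lemma locally_integrable_lincomb:
  fixes f g :: "'a::euclidean_space \<Rightarrow> 'b::euclidean_space"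
  assumes "locally_integrable \<Omega> f" "locally_integrable \<Omega> g"
  shows "locally_integrable \<Omega> (\<lambda>x. c *\<^sub>R f x + d *\<^sub>R g x)"
  unfolding locally_integrable_def set_integrable_def
proof (intro allI impI)
  fix S :: "'a set" assume S: "compact S \<and> S \<subseteq> \<Omega>"
  have "integrable lebesgue (\<lambda>x. c *\<^sub>R (indicator S x *\<^sub>R f x) + d *\<^sub>R (indicator S x *\<^sub>R g x))"
    by (intro Bochner_Integration.integrable_add integrable_scaleR_right)
       (use assms S in \<open>auto simp: locally_integrable_def set_integrable_def\<close>)
  then show "integrable lebesgue (\<lambda>x. indicator S x *\<^sub>R (c *\<^sub>R f x + d *\<^sub>R g x))"
    by (rule back_subst[where P = "integrable lebesgue"]) (auto simp: fun_eq_iff indicator_def)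
qed

lemma locally_integrable_inner:
  fixes f :: "'a::euclidean_space \<Rightarrow> 'b::euclidean_space"
  assumes "locally_integrable \<Omega> f" shows "locally_integrable \<Omega> (\<lambda>x. f x \<bullet> b)"
  unfolding locally_integrable_def set_integrable_def
proof (intro allI impI)
  fix S :: "'a set" assume "compact S \<and> S \<subseteq> \<Omega>"
  then have "integrable lebesgue (\<lambda>x. indicator S x *\<^sub>R f x)"
    using assms by (auto simp: locally_integrable_def set_integrable_def)
  then have "integrable lebesgue (\<lambda>x. (indicator S x *\<^sub>R f x) \<bullet> b)" by (intro integrable_inner_left)
  then show "integrable lebesgue (\<lambda>x. indicator S x *\<^sub>R (f x \<bullet> b))"
    by (simp only: inner_scaleR_left real_scaleR_def)
qed

lemma integrable_continuous_times_locally: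
  fixes h :: "'a::euclidean_space \<Rightarrow> 'b::euclidean_space"
  assumes h: "locally_integrable \<Omega> h" and \<phi>: "continuous_on UNIV \<phi>"
    and K: "compact K" "K \<subseteq> \<Omega>" "\<And>x. x \<notin> K \<Longrightarrow> \<phi> x = (0::real)" and "\<Omega> \<in> sets lebesgue"
  shows "integrable (lebesgue_on \<Omega>) (\<lambda>x. \<phi> x *\<^sub>R h x)"
proof -
  have h': "integrable lebesgue (\<lambda>x. indicator K x *\<^sub>R h x)"
    using h K by (auto simp: locally_integrable_def set_integrable_def)
  have "compact (\<phi> ` K)" using K(1) \<phi> compact_continuous_image continuous_on_subset by blast
  from compact_imp_bounded[OF this] obtain B where "\<And>x. x \<in> K \<Longrightarrow> \<bar>\<phi> x\<bar> \<le> B"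
    unfolding bounded_iff by auto
  then have B: "\<bar>\<phi> x\<bar> \<le> max B 0" for x using K(3)[of x] by (cases "x \<in> K") force+
  have [measurable]: "\<phi> \<in> borel_measurable lebesgue"
    using borel_measurable_continuous_onI[OF \<phi>] by (simp add: measurable_completion)
  have "integrable lebesgue (\<lambda>x. \<phi> x *\<^sub>R (indicator K x *\<^sub>R h x))"
  proof (rule Bochner_Integration.integrable_bound)
    show "integrable lebesgue (\<lambda>x. max B 0 *\<^sub>R (indicator K x *\<^sub>R h x))"
      using h' by (rule integrable_scaleR_right)
    show "(\<lambda>x. \<phi> x *\<^sub>R (indicator K x *\<^sub>R h x)) \<in> borel_measurable lebesgue"
      using borel_measurable_integrable[OF h'] by measurable
    show "AE x in lebesgue. norm (\<phi> x *\<^sub>R indicat_real K x *\<^sub>R h x) \<le> norm (max B 0 *\<^sub>R indicat_real K x *\<^sub>R h x)"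
      using B by (auto intro!: AE_I2 mult_right_mono simp: indicator_def)
  qed
  moreover have "(\<lambda>x. \<phi> x *\<^sub>R (indicator K x *\<^sub>R h x)) = (\<lambda>x. \<phi> x *\<^sub>R h x)"
    using K(3) by (auto simp: fun_eq_iff indicator_def)
  ultimately show ?thesis
    using K assms(6) by (subst lebesgue_on_supported) auto
qed

lemma test_functionsE:
  assumes "\<phi> \<in> test_functions \<Omega>"
  obtains K where "smooth \<phi>" "compact K" "K \<subseteq> \<Omega>" "\<And>x. x \<notin> K \<Longrightarrow> \<phi> x = 0" "\<And>x. x \<notin> K \<Longrightarrow> grad \<phi> x = 0"
proof
  define K where "K = closure {x. \<phi> x \<noteq> 0}"
  show sm: "smooth \<phi>" and K: "compact K" "K \<subseteq> \<Omega>"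
    using assms by (auto simp: test_functions_def K_def)
  show z: "\<phi> x = 0" if "x \<notin> K" for x
    using that closure_subset[of "{x. \<phi> x \<noteq> 0}"] by (auto simp: K_def)
  fix x assume x: "x \<notin> K"
  \<comment> \<open>On the open complement of the support the function is constant, hence Lipschitz
    with constant 0, and its gradient vanishes there.\<close>
  have "0-lipschitz_on (- K) \<phi>"
    by (rule lipschitz_onI) (simp_all add: z)
  moreover have "open (- K)" "x \<in> - K" using K(1) x by (auto simp: open_Compl compact_imp_closed)
  ultimately have "norm (grad \<phi> x) \<le> 0" by (rule lipschitz_grad_le[OF sm])
  then show "grad \<phi> x = 0" by simp
qed

lemma test_functionsI:
  assumes "smooth \<phi>" "compact K" "K \<subseteq> \<Omega>" "\<And>x. x \<notin> K \<Longrightarrow> \<phi> x = 0"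
  shows "\<phi> \<in> test_functions \<Omega>"
proof -
  have "closure {x. \<phi> x \<noteq> 0} \<subseteq> K"
    using assms(2,4) by (intro closure_minimal compact_imp_closed) blast+
  moreover from this have "compact (closure {x. \<phi> x \<noteq> 0})"
    using assms(2) by (simp only: compact_eq_bounded_closed closed_closure) (blast intro: bounded_subset)
  ultimately show ?thesis
    using assms(1,3) unfolding test_functions_def by blast
qed

lemma test_functions_lincomb:
  assumes "\<phi> \<in> test_functions \<Omega>" "\<psi> \<in> test_functions \<Omega>"
  shows "(\<lambda>x. c * \<phi> x + d * \<psi> x) \<in> test_functions \<Omega>"
proof -
  obtain K where K: "smooth \<phi>" "compact K" "K \<subseteq> \<Omega>" "\<And>x. x \<notin> K \<Longrightarrow> \<phi> x = 0" "\<And>x. x \<notin> K \<Longrightarrow> grad \<phi> x = 0"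
    by (rule test_functionsE[OF assms(1)]) (rule that; simp)
  obtain M where M: "smooth \<psi>" "compact M" "M \<subseteq> \<Omega>" "\<And>x. x \<notin> M \<Longrightarrow> \<psi> x = 0" "\<And>x. x \<notin> M \<Longrightarrow> grad \<psi> x = 0"
    by (rule test_functionsE[OF assms(2)]) (rule that; simp)
  show ?thesis
    by (rule test_functionsI[OF smooth_lincomb[OF K(1) M(1)], of "K \<union> M"]) (use K M in auto)
qed

lemma test_integrable:
  fixes v :: "'a::euclidean_space \<Rightarrow> real" and w :: "'a \<Rightarrow> 'a"
  assumes "\<phi> \<in> test_functions \<Omega>" "open \<Omega>" "b \<in> Basis"
  shows "locally_integrable \<Omega> v \<Longrightarrow>
           integrable (lebesgue_on \<Omega>) (\<lambda>x. v x * frechet_derivative \<phi> (at x) b)"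
    and "locally_integrable \<Omega> w \<Longrightarrow> integrable (lebesgue_on \<Omega>) (\<lambda>x. (w x \<bullet> b) * \<phi> x)"
proof -
  obtain K where T: "smooth \<phi>" "compact K" "K \<subseteq> \<Omega>" "\<And>x. x \<notin> K \<Longrightarrow> \<phi> x = 0" "\<And>x. x \<notin> K \<Longrightarrow> grad \<phi> x = 0"
    by (rule test_functionsE[OF assms(1)]) (rule that; simp)
  have [simp]: "\<Omega> \<in> sets lebesgue" using assms(2) by (simp add: borel_open lmeasurable_open)
  assume "locally_integrable \<Omega> v"
  then have "integrable (lebesgue_on \<Omega>) (\<lambda>x. frechet_derivative \<phi> (at x) b *\<^sub>R v x)"
    by (rule integrable_continuous_times_locally[OF _ smooth_partial_continuous_on[OF T(1) assms(3)] T(2,3)])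
       (use T(5) in \<open>simp_all add: smooth_frechet[OF T(1)]\<close>)
  then show "integrable (lebesgue_on \<Omega>) (\<lambda>x. v x * frechet_derivative \<phi> (at x) b)"
    by (simp add: mult.commute)
next
  obtain K where T: "smooth \<phi>" "compact K" "K \<subseteq> \<Omega>" "\<And>x. x \<notin> K \<Longrightarrow> \<phi> x = 0" "\<And>x. x \<notin> K \<Longrightarrow> grad \<phi> x = 0"
    by (rule test_functionsE[OF assms(1)]) (rule that; simp)
  have [simp]: "\<Omega> \<in> sets lebesgue" using assms(2) by (simp add: borel_open lmeasurable_open)
  assume "locally_integrable \<Omega> w"
  then have "integrable (lebesgue_on \<Omega>) (\<lambda>x. \<phi> x *\<^sub>R (w x \<bullet> b))"
    by (intro integrable_continuous_times_locally[OF _ smooth_continuous_on[OF T(1)] T(2,3)]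
         locally_integrable_inner) (use T(4) in auto)
  then show "integrable (lebesgue_on \<Omega>) (\<lambda>x. (w x \<bullet> b) * \<phi> x)"
    by (simp add: mult.commute)
qed

lemma has_weak_gradient_lincomb:
  assumes "open \<Omega>" "has_weak_gradient \<Omega> v1 w1" "has_weak_gradient \<Omega> v2 w2"
  shows "has_weak_gradient \<Omega> (\<lambda>x. c * v1 x + d * v2 x) (\<lambda>x. c *\<^sub>R w1 x + d *\<^sub>R w2 x)"
proof -
  have l: "locally_integrable \<Omega> v1" "locally_integrable \<Omega> v2" "locally_integrable \<Omega> w1" "locally_integrable \<Omega> w2"
    using assms by (auto simp: has_weak_gradient_def)
  have "(LINT x|lebesgue_on \<Omega>. (c * v1 x + d * v2 x) * frechet_derivative \<phi> (at x) b) =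
        - (LINT x|lebesgue_on \<Omega>. ((c *\<^sub>R w1 x + d *\<^sub>R w2 x) \<bullet> b) * \<phi> x)"
    if \<phi>: "\<phi> \<in> test_functions \<Omega>" and b: "b \<in> Basis" for \<phi> b
  proof -
    note i = test_integrable[OF \<phi> assms(1) b]
    have "(LINT x|lebesgue_on \<Omega>. (c * v1 x + d * v2 x) * frechet_derivative \<phi> (at x) b) =
      (LINT x|lebesgue_on \<Omega>. c * (v1 x * frechet_derivative \<phi> (at x) b) + d * (v2 x * frechet_derivative \<phi> (at x) b))"
      by (simp add: algebra_simps)
    also have "\<dots> = c * (LINT x|lebesgue_on \<Omega>. v1 x * frechet_derivative \<phi> (at x) b) +
        d * (LINT x|lebesgue_on \<Omega>. v2 x * frechet_derivative \<phi> (at x) b)"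
      using i(1)[OF l(1)] i(1)[OF l(2)] by simp
    also have "\<dots> = - (c * (LINT x|lebesgue_on \<Omega>. (w1 x \<bullet> b) * \<phi> x) + d * (LINT x|lebesgue_on \<Omega>. (w2 x \<bullet> b) * \<phi> x))"
      using assms(2,3) \<phi> b by (simp add: has_weak_gradient_def)
    also have "c * (LINT x|lebesgue_on \<Omega>. (w1 x \<bullet> b) * \<phi> x) + d * (LINT x|lebesgue_on \<Omega>. (w2 x \<bullet> b) * \<phi> x) =
      (LINT x|lebesgue_on \<Omega>. c * ((w1 x \<bullet> b) * \<phi> x) + d * ((w2 x \<bullet> b) * \<phi> x))"
      using i(2)[OF l(3)] i(2)[OF l(4)] by simp
    also have "\<dots> = (LINT x|lebesgue_on \<Omega>. ((c *\<^sub>R w1 x + d *\<^sub>R w2 x) \<bullet> b) * \<phi> x)"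
      by (simp add: algebra_simps)
    finally show ?thesis .
  qed
  then show ?thesis
    using locally_integrable_lincomb[OF l(1,2), of c d] locally_integrable_lincomb[OF l(3,4), of c d]
    by (simp add: has_weak_gradient_def)
qed

text \<open>Completeness of Lebesgue measure transfers measurability between a.e. equal functions,
  so none has to be assumed. If both fail to be measurable, both integrals are 0 by convention. This
  suits \<open>wgrad\<close>, a choice about which nothing is known beyond a.e. equality.\<close>

lemma lebesgue_on_cong_AE:
  fixes f g :: "'a::euclidean_space \<Rightarrow> 'b::euclidean_space"
  assumes \<Omega>: "\<Omega> \<in> sets lebesgue" and ae: "AE x in lebesgue_on \<Omega>. f x = g x"
  shows "f \<in> borel_measurable (lebesgue_on \<Omega>) \<longleftrightarrow> g \<in> borel_measurable (lebesgue_on \<Omega>)"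
    and "integrable (lebesgue_on \<Omega>) f \<longleftrightarrow> integrable (lebesgue_on \<Omega>) g"
    and "integral\<^sup>L (lebesgue_on \<Omega>) f = integral\<^sup>L (lebesgue_on \<Omega>) g"
proof -
  have ae': "AE x in lebesgue. (if x \<in> \<Omega> then f x else 0) = (if x \<in> \<Omega> then g x else 0)"
    using ae \<Omega> by (auto simp: AE_restrict_space_iff)
  then have ae'': "AE x in lebesgue. (if x \<in> \<Omega> then g x else 0) = (if x \<in> \<Omega> then f x else 0)"
    by eventually_elim simp
  show meas: "f \<in> borel_measurable (lebesgue_on \<Omega>) \<longleftrightarrow> g \<in> borel_measurable (lebesgue_on \<Omega>)"
    using borel_measurable_AE[OF _ ae'] borel_measurable_AE[OF _ ae'']
    unfolding borel_measurable_if[OF \<Omega>] by blast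
  have "integrable (lebesgue_on \<Omega>) f = integrable (lebesgue_on \<Omega>) g \<and>
      integral\<^sup>L (lebesgue_on \<Omega>) f = integral\<^sup>L (lebesgue_on \<Omega>) g"
  proof (cases "f \<in> borel_measurable (lebesgue_on \<Omega>)")
    case True
    with meas show ?thesis
      using integral_cong_AE[OF True _ ae] integrable_cong_AE[OF True _ ae] by blast
  next
    case False
    then have "\<not> integrable (lebesgue_on \<Omega>) f" "\<not> integrable (lebesgue_on \<Omega>) g"
      using meas borel_measurable_integrable by blast+
    then show ?thesis by (simp add: not_integrable_integral_eq)
  qed
  then show "integrable (lebesgue_on \<Omega>) f \<longleftrightarrow> integrable (lebesgue_on \<Omega>) g"
    "integral\<^sup>L (lebesgue_on \<Omega>) f = integral\<^sup>L (lebesgue_on \<Omega>) g" by auto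
qed

lemma has_weak_gradient_cong_AE:
  assumes "open \<Omega>" "AE x in lebesgue_on \<Omega>. v1 x = v2 x" "has_weak_gradient \<Omega> v1 w"
  shows "has_weak_gradient \<Omega> v2 w"
proof -
  have \<Omega>: "\<Omega> \<in> sets lebesgue" using assms(1) by (simp add: borel_open lmeasurable_open)
  have l: "locally_integrable \<Omega> v1" using assms(3) by (simp add: has_weak_gradient_def)
  have ae: "AE x in lebesgue. x \<in> \<Omega> \<longrightarrow> v1 x = v2 x"
    using assms(2) \<Omega> by (simp add: AE_restrict_space_iff)
  have "integrable lebesgue (\<lambda>x. indicator S x *\<^sub>R v2 x)" if "compact S" "S \<subseteq> \<Omega>" for S
  proof -
    have i: "integrable lebesgue (\<lambda>x. indicator S x *\<^sub>R v1 x)"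
      using l that by (auto simp: locally_integrable_def set_integrable_def)
    have a: "AE x in lebesgue. indicator S x *\<^sub>R v1 x = indicator S x *\<^sub>R v2 x"
      using ae by eventually_elim (use that in \<open>auto simp: indicator_def\<close>)
    show ?thesis
      using borel_measurable_AE[OF borel_measurable_integrable[OF i] a]
      by (rule integrable_cong_AE_imp[OF i]) (use a in \<open>eventually_elim, simp\<close>)
  qed
  then have "locally_integrable \<Omega> v2" by (auto simp: locally_integrable_def set_integrable_def)
  moreover have "(LINT x|lebesgue_on \<Omega>. v2 x * frechet_derivative \<phi> (at x) b) =
      (LINT x|lebesgue_on \<Omega>. v1 x * frechet_derivative \<phi> (at x) b)" for \<phi> b
    by (rule lebesgue_on_cong_AE(3)[OF \<Omega>]) (use assms(2) in \<open>eventually_elim, simp\<close>)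
  ultimately show ?thesis using assms(3) by (simp add: has_weak_gradient_def)
qed

text \<open>Functions that agree a.e. have the same set of weak gradients, so the choice operator
  returns literally the same function; the equality is not merely a.e.\<close>

lemma wgrad_cong_AE:
  assumes "open \<Omega>" "AE x in lebesgue_on \<Omega>. v1 x = v2 x"
  shows "wgrad \<Omega> v1 = wgrad \<Omega> v2"
proof -
  have "AE x in lebesgue_on \<Omega>. v2 x = v1 x" using assms(2) by eventually_elim simp
  then have "has_weak_gradient \<Omega> v1 = has_weak_gradient \<Omega> v2"
    using has_weak_gradient_cong_AE[OF assms(1)] assms(2) by blast
  then show ?thesis by (simp add: wgrad_def)
qed

text \<open>By translation invariance every difference quotient of \<zeta> in direction
  \<open>b\<close> has integral 0. Dominated convergence carries this over to the directional
  derivative.\<close>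

lemma integral_gradient_eq_0:
  fixes \<zeta> :: "'a::euclidean_space \<Rightarrow> real"
  assumes D: "\<And>x. (\<zeta> has_derivative (\<lambda>h. g x \<bullet> h)) (at x)" and g: "continuous_on UNIV g"
    and A: "bounded A" "\<And>x. x \<notin> A \<Longrightarrow> \<zeta> x = 0" "\<And>x. x \<notin> A \<Longrightarrow> g x = 0"
  shows "integrable lborel (\<lambda>x. g x \<bullet> b)" "(LINT x|lborel. g x \<bullet> b) = 0"
proof -
  have c: "continuous_on UNIV \<zeta>"
    using D by (auto intro!: has_derivative_continuous simp: continuous_on_eq_continuous_at)
  show "integrable lborel (\<lambda>x. g x \<bullet> b)"
    by (rule integrable_continuous_bounded_support[OF _ A(1)]) (use A(3) g in \<open>auto intro: continuous_intros\<close>)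
  have i: "integrable lborel \<zeta>"
    by (rule integrable_continuous_bounded_support[OF c A(1,2)])
  have "compact (g ` closure A)"
    using A(1) g by (intro compact_continuous_image) (auto intro: continuous_on_subset)
  from compact_imp_bounded[OF this] obtain B0 where "\<And>x. x \<in> closure A \<Longrightarrow> norm (g x) \<le> B0"
    unfolding bounded_iff by blast
  then have B: "norm (g x) \<le> max B0 0" for x
    using A(3)[of x] closure_subset[of A] by (cases "x \<in> A") (auto simp: le_max_iff_disj)
  define B where "B = max B0 0"
  obtain R where R: "\<And>x. x \<in> A \<Longrightarrow> norm x \<le> R" using A(1) unfolding bounded_iff by blast
  let ?h = "\<lambda>m::nat. inverse (real (Suc m))"
  let ?q = "\<lambda>m x. (\<zeta> (x + ?h m *\<^sub>R b) - \<zeta> x) / ?h m"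
  have sh: "integrable lborel (\<lambda>x. \<zeta> (x + z))" "(LINT x|lborel. \<zeta> (x + z)) = (LINT x|lborel. \<zeta> x)" for z
  proof -
    have m: "\<zeta> \<in> borel_measurable borel" using i by auto
    have eq: "distr lborel borel (\<lambda>x. x + z) = lborel"
      using lborel_distr_plus[of z] by (simp add: add.commute[of z] cong: distr_cong)
    have "integrable (distr lborel borel (\<lambda>x. x + z)) \<zeta>" unfolding eq by (rule i)
    then show "integrable lborel (\<lambda>x. \<zeta> (x + z))" by (subst (asm) integrable_distr_eq) (use m in auto)
    show "(LINT x|lborel. \<zeta> (x + z)) = (LINT x|lborel. \<zeta> x)"
      by (subst eq[symmetric]) (rule integral_distr[symmetric]; use m in simp)
  qed
  have z: "(LINT x|lborel. ?q m x) = 0" for m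
    using i sh by simp
  have "(\<lambda>m. LINT x|lborel. ?q m x) \<longlonglongrightarrow> (LINT x|lborel. g x \<bullet> b)"
  \<comment> \<open>The increments are at most 1 times \<open>b\<close>, so all quotients vanish
    outside the ball of radius \<open>R + norm b\<close>; inside, the mean value inequality bounds
    them by \<open>B * norm b\<close>.\<close>
  proof (rule integral_dominated_convergence[where w = "\<lambda>x. indicator (cball 0 (R + norm b)) x * (B * norm b)"])
    show "(\<lambda>x. g x \<bullet> b) \<in> borel_measurable lborel"
      using g by (auto intro!: borel_measurable_continuous_onI continuous_intros)
    show "?q m \<in> borel_measurable lborel" for m
      using c by (auto intro!: borel_measurable_continuous_onI continuous_intros continuous_on_compose2[OF c])
    show "integrable lborel (\<lambda>x. indicator (cball 0 (R + norm b)) x * (B * norm b))"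
      by (intro integrable_mult_left integrable_real_indicator emeasure_compact_finite) auto
    show "AE x in lborel. (\<lambda>m. ?q m x) \<longlonglongrightarrow> g x \<bullet> b"
    proof (rule AE_I2)
      fix x
      have "(\<zeta> has_derivative (\<lambda>h. g x \<bullet> h)) (at (x + 0 *\<^sub>R b))" using D[of x] by simp
      moreover have "((\<lambda>t. x + t *\<^sub>R b) has_derivative (\<lambda>t. t *\<^sub>R b)) (at 0)"
        by (auto intro!: derivative_eq_intros)
      ultimately have "((\<lambda>t. \<zeta> (x + t *\<^sub>R b)) has_derivative (\<lambda>t. g x \<bullet> (t *\<^sub>R b))) (at 0)"
        using has_derivative_compose[of "\<lambda>t. x + t *\<^sub>R b" _ 0 UNIV \<zeta>] by blast
      then have "((\<lambda>t. \<zeta> (x + t *\<^sub>R b)) has_field_derivative g x \<bullet> b) (at 0)"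
        by (simp add: has_field_derivative_def mult_commute_abs)
      then have "((\<lambda>t. (\<zeta> (x + t *\<^sub>R b) - \<zeta> x) / t) \<longlongrightarrow> g x \<bullet> b) (at 0)"
        by (simp add: has_field_derivative_iff)
      moreover have "filterlim ?h (at 0) sequentially"
        by (intro filterlim_atI LIMSEQ_inverse_real_of_nat) auto
      ultimately show "(\<lambda>m. ?q m x) \<longlonglongrightarrow> g x \<bullet> b"
        by (rule filterlim_compose)
    qed
    show "AE x in lborel. norm (?q m x) \<le> indicator (cball 0 (R + norm b)) x * (B * norm b)" for m
    proof (rule AE_I2)
      fix x
      have h: "0 < ?h m" "?h m \<le> 1" by (auto simp: field_simps)
      define t where "t = ?h m"
      show "norm (?q m x) \<le> indicator (cball 0 (R + norm b)) x * (B * norm b)"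
      proof (cases "x \<in> cball 0 (R + norm b)")
        case True
        have on: "onorm (\<lambda>h. g y \<bullet> h) \<le> B" for y
        proof (rule onorm_le)
          fix h
          have "norm (g y \<bullet> h) \<le> norm (g y) * norm h" by (simp add: Cauchy_Schwarz_ineq2)
          also have "\<dots> \<le> B * norm h" unfolding B_def by (rule mult_right_mono[OF B]) simp
          finally show "norm (g y \<bullet> h) \<le> B * norm h" .
        qed
        have "\<bar>\<zeta> (x + ?h m *\<^sub>R b) - \<zeta> x\<bar> \<le> B * norm ((x + ?h m *\<^sub>R b) - x)"
          using differentiable_bound[OF convex_UNIV D on, of "x + ?h m *\<^sub>R b" x] by simp
        then have "\<bar>\<zeta> (x + t *\<^sub>R b) - \<zeta> x\<bar> \<le> B * norm b * t" "t > 0"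
          using h unfolding t_def by (simp_all del: of_nat_Suc add: mult.assoc mult.commute[of "norm b"])
        then have "norm ((\<zeta> (x + t *\<^sub>R b) - \<zeta> x) / t) \<le> B * norm b"
          by (simp add: abs_divide pos_divide_le_eq)
        then show ?thesis using True unfolding t_def by simp
      next
        case False
        have "R < norm x" using False norm_ge_zero[of b] unfolding mem_cball_0 by linarith
        then have "\<not> norm x \<le> R" by simp
        then have "x \<notin> A" using R by blast
        moreover have "x + ?h m *\<^sub>R b \<notin> A"
        proof
          assume "x + ?h m *\<^sub>R b \<in> A"
          then have "norm (x + ?h m *\<^sub>R b) \<le> R" by (rule R)
          moreover have "norm x \<le> norm (x + ?h m *\<^sub>R b) + norm (?h m *\<^sub>R b)"
            by (metis add_diff_cancel norm_triangle_ineq4)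
          moreover have "norm (?h m *\<^sub>R b) \<le> norm b"
            using h mult_right_mono[of "?h m" 1 "norm b"] by simp
          ultimately show False using False by simp
        qed
        ultimately show ?thesis using False A(2) by simp
      qed
    qed
  qed
  then show "(LINT x|lborel. g x \<bullet> b) = 0" using LIMSEQ_unique[OF _ tendsto_const] z by simp
qed

text \<open>Integration by parts: the product with a test function has compact support, so the
  integral of its derivative vanishes.\<close>

lemma smooth_has_weak_gradient:
  assumes "open \<Omega>" "smooth \<phi>"
  shows "has_weak_gradient \<Omega> \<phi> (grad \<phi>)"
proof -
  have \<Omega>: "\<Omega> \<in> sets lebesgue" using assms(1) by (simp add: borel_open lmeasurable_open)
  have l: "locally_integrable \<Omega> \<phi>" "locally_integrable \<Omega> (grad \<phi>)"
    using assms(2) by (auto intro!: locally_integrable_continuous smooth_continuous_on smooth_grad_continuous_on)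
  have "(LINT x|lebesgue_on \<Omega>. \<phi> x * frechet_derivative \<psi> (at x) b) =
        - (LINT x|lebesgue_on \<Omega>. (grad \<phi> x \<bullet> b) * \<psi> x)"
    if \<psi>: "\<psi> \<in> test_functions \<Omega>" and b: "b \<in> Basis" for \<psi> b
  proof -
    obtain K where T: "smooth \<psi>" "compact K" "K \<subseteq> \<Omega>" "\<And>x. x \<notin> K \<Longrightarrow> \<psi> x = 0" "\<And>x. x \<notin> K \<Longrightarrow> grad \<psi> x = 0"
      by (rule test_functionsE[OF \<psi>]) (rule that; simp)
    note i = test_integrable[OF \<psi> assms(1) b]
    let ?g = "\<lambda>x. \<phi> x *\<^sub>R grad \<psi> x + \<psi> x *\<^sub>R grad \<phi> x"
    have D: "((\<lambda>x. \<phi> x * \<psi> x) has_derivative (\<lambda>h. ?g x \<bullet> h)) (at x)" for x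
      using has_derivative_mult[OF smooth_has_derivative[OF assms(2)] smooth_has_derivative[OF T(1)], of x]
      by (simp add: inner_add_left mult.commute)
    have cg: "continuous_on UNIV ?g"
      by (intro continuous_intros smooth_continuous_on smooth_grad_continuous_on assms(2) T(1))
    have "(LINT x|lborel. ?g x \<bullet> b) = 0"
      by (rule integral_gradient_eq_0(2)[OF D cg compact_imp_bounded[OF T(2)]]) (use T(4,5) in simp_all)
    then have "(LINT x|lebesgue. ?g x \<bullet> b) = 0"
      using cg by (subst integral_completion) (auto intro!: borel_measurable_continuous_onI continuous_intros)
    moreover have "?g x \<bullet> b = 0" if "x \<notin> \<Omega>" for x
    proof -
      have "x \<notin> K" using that T(3) by blast
      then show ?thesis using T(4,5) by simp
    qed
    ultimately have "(LINT x|lebesgue_on \<Omega>. ?g x \<bullet> b) = 0"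
      using lebesgue_on_supported(2)[OF \<Omega>, of "\<lambda>x. ?g x \<bullet> b"] by simp
    also have "(LINT x|lebesgue_on \<Omega>. ?g x \<bullet> b) =
        (LINT x|lebesgue_on \<Omega>. \<phi> x * frechet_derivative \<psi> (at x) b + (grad \<phi> x \<bullet> b) * \<psi> x)"
      by (simp add: inner_add_left smooth_frechet[OF T(1)] mult.commute)
    also have "\<dots> = (LINT x|lebesgue_on \<Omega>. \<phi> x * frechet_derivative \<psi> (at x) b) +
         (LINT x|lebesgue_on \<Omega>. (grad \<phi> x \<bullet> b) * \<psi> x)"
      using i(1)[OF l(1)] i(2)[OF l(2)] by simp
    finally show ?thesis by simp
  qed
  with l show ?thesis by (simp add: has_weak_gradient_def)
qed

text \<open>Open boxes are stable under intersection and generate the Borel sets, so the vanishing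
  of the set integrals spreads from boxes to all Borel sets, which determines a density.\<close>

lemma AE_eq_0_if_box_integrals_0:
  fixes h :: "'a::euclidean_space \<Rightarrow> real"
  assumes h: "integrable lborel h" and z: "\<And>c d. (LINT x:box c d|lborel. h x) = 0"
  shows "AE x in lborel. h x = 0"
proof (rule density_unique_real[OF h, of "\<lambda>_. 0"])
  fix A :: "'a set" assume "A \<in> sets lborel"
  then have A: "A \<in> sigma_sets UNIV (range (\<lambda>(a, b). box a b))"
    by (simp add: borel_eq_box)
  have sig: "B \<in> sets lborel" if "B \<in> sigma_sets UNIV (range (\<lambda>(a, b). box a b))" for B :: "'a set"
    using that by (simp add: borel_eq_box)
  have si: "set_integrable lborel B h" if "B \<in> sets lborel" for B
    using h that unfolding set_integrable_def by (rule integrable_mult_indicator[rotated])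
  \<comment> \<open>Exhausting the space by boxes shows that the total integral vanishes; passing to
    complements in the induction on sets depends on it.\<close>
  have "(\<lambda>m. LINT x:box (- (real m *\<^sub>R One)) (real m *\<^sub>R One)|lborel. h x) \<longlonglongrightarrow> (LINT x|lborel. h x)"
    unfolding set_lebesgue_integral_def
  proof (rule integral_dominated_convergence[where w = "\<lambda>x. norm (h x)"])
    show "AE x in lborel. (\<lambda>m. indicat_real (box (- (real m *\<^sub>R One)) (real m *\<^sub>R One)) x *\<^sub>R h x) \<longlonglongrightarrow> h x"
    proof (rule AE_I2, rule tendsto_eventually)
      fix x :: 'a
      obtain m where m: "x \<in> box (- (real m *\<^sub>R One)) (real m *\<^sub>R One)"
        using UN_box_eq_UNIV by blast
      have "x \<in> box (- (real k *\<^sub>R One)) (real k *\<^sub>R One)" if "k \<ge> m" for k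
        using m that by (force simp: mem_box)
      then show "\<forall>\<^sub>F m in sequentially. indicat_real (box (- (real m *\<^sub>R One)) (real m *\<^sub>R One)) x *\<^sub>R h x = h x"
        unfolding eventually_sequentially by (intro exI[of _ m]) auto
    qed
  qed (use h in \<open>auto simp: indicator_def\<close>)
  then have tot: "(LINT x|lborel. h x) = 0" using LIMSEQ_unique[OF _ tendsto_const] z by simp
  have "(LINT x:A|lborel. h x) = 0"
  proof (rule sigma_sets_induct_disjoint[OF _ _ A])
    show "Int_stable (range (\<lambda>(a, b). box a b) :: 'a set set)"
      by (auto simp: Int_stable_def box_Int_box)
  next
    fix B :: "'a set" assume B: "B \<in> sigma_sets UNIV (range (\<lambda>(a, b). box a b))" "(LINT x:B|lborel. h x) = 0"
    have "(LINT x:UNIV|lborel. h x) = (LINT x:B|lborel. h x) + (LINT x:UNIV - B|lborel. h x)"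
      using set_integral_Un[of B "UNIV - B" lborel h] si sig[OF B(1)] by (simp add: Un_Diff_cancel)
    then show "(LINT x:UNIV - B|lborel. h x) = 0"
      using B(2) tot by (simp add: set_lebesgue_integral_def)
  next
    fix B :: "nat \<Rightarrow> 'a set"
    assume B: "disjoint_family B" "range B \<subseteq> sigma_sets UNIV (range (\<lambda>(a, b). box a b))"
      "\<And>i. (LINT x:B i|lborel. h x) = 0"
    have m: "B i \<in> sets lborel" for i using B(2) sig by blast
    have "(LINT x:(\<Union>i. B i)|lborel. h x) = (\<Sum>i. (LINT x:(B i)|lborel. h x))"
      by (rule lebesgue_integral_countable_add[OF m]) (use B(1) si m in \<open>auto simp: disjoint_family_on_def\<close>)
    then show "(LINT x:(\<Union>i. B i)|lborel. h x) = 0" using B(3) by simp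
  qed (use z in \<open>auto simp: set_lebesgue_integral_def\<close>)
  then show "(LINT x:A|lborel. h x) = (LINT x:A|lborel. 0)" by (simp add: set_lebesgue_integral_def)
qed simp

text \<open>The fundamental lemma of the calculus of variations. Bumps approximate indicators of
  boxes compactly contained in the domain; this settles each such box, and countably many closed
  boxes cover the domain.\<close>

lemma AE_eq_0_if_test_integrals_0:
  fixes h :: "'a::euclidean_space \<Rightarrow> real"
  assumes "open \<Omega>" and h: "locally_integrable \<Omega> h"
    and z: "\<And>\<phi>. \<phi> \<in> test_functions \<Omega> \<Longrightarrow> (LINT x|lebesgue_on \<Omega>. h x * \<phi> x) = 0"
  shows "AE x in lebesgue_on \<Omega>. h x = 0"
proof -
  have \<Omega>: "\<Omega> \<in> sets lebesgue" using assms(1) by (simp add: borel_open lmeasurable_open)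
  have ih: "integrable lebesgue (\<lambda>x. indicator (cbox c d) x * h x)" if "cbox c d \<subseteq> \<Omega>" for c d
    using h that by (simp add: locally_integrable_def set_integrable_def)
  have ih': "integrable lebesgue (\<lambda>x. indicator (box c d) x * h x)" if "cbox c d \<subseteq> \<Omega>" for c d
  proof -
    have "integrable lebesgue (\<lambda>x. indicator (box c d) x *\<^sub>R (indicator (cbox c d) x * h x))"
      by (intro integrable_mult_indicator ih that) auto
    moreover have "(\<lambda>x. indicator (box c d) x *\<^sub>R (indicator (cbox c d) x * h x)) = (\<lambda>x. indicator (box c d) x * h x)"
      using box_subset_cbox by (fastforce simp: fun_eq_iff indicator_def)
    ultimately show ?thesis by simp
  qed
  have boxes: "(LINT x|lebesgue. indicator (box c d) x * h x) = 0" if cd: "cbox c d \<subseteq> \<Omega>" for c d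
  proof -
    let ?B = "\<lambda>m. bump c d (real (Suc m))"
    have out: "?B m x = 0" if "x \<notin> cbox c d" for m x
      using that bump_eq_0_iff[of "real (Suc m)" c d x] box_subset_cbox[of c d] by auto
    have T: "?B m \<in> test_functions \<Omega>" for m
      by (rule test_functionsI[OF smooth_bump compact_cbox cd out])
    have zm: "(LINT x|lebesgue. h x * ?B m x) = 0" for m
    proof -
      have "h x * ?B m x = 0" if "x \<notin> \<Omega>" for x using out cd that by auto
      then show ?thesis using z[OF T[of m]] lebesgue_on_supported(2)[OF \<Omega>, of "\<lambda>x. h x * ?B m x"] by simp
    qed
    have "(\<lambda>m. LINT x|lebesgue. h x * ?B m x) \<longlonglongrightarrow> (LINT x|lebesgue. indicator (box c d) x * h x)"
    proof (rule integral_dominated_convergence[where w = "\<lambda>x. norm (indicator (cbox c d) x * h x)"])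
      show "(\<lambda>x. indicator (box c d) x * h x) \<in> borel_measurable lebesgue"
        using ih'[OF cd] by auto
      show "(\<lambda>x. h x * ?B m x) \<in> borel_measurable lebesgue" for m
      proof -
        have "?B m \<in> borel_measurable lebesgue"
          by (intro measurable_completion) (simp add: borel_measurable_continuous_onI smooth_continuous_on smooth_bump)
        then have "(\<lambda>x. (indicator (cbox c d) x * h x) * ?B m x) \<in> borel_measurable lebesgue"
          using ih[OF cd] by auto
        moreover have "(\<lambda>x. (indicator (cbox c d) x * h x) * ?B m x) = (\<lambda>x. h x * ?B m x)"
          using out by (auto simp: fun_eq_iff indicator_def)
        ultimately show ?thesis by simp
      qed
      show "integrable lebesgue (\<lambda>x. norm (indicator (cbox c d) x * h x))" using ih[OF cd] by auto
      show "AE x in lebesgue. (\<lambda>m. h x * ?B m x) \<longlonglongrightarrow> indicator (box c d) x * h x"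
        by (intro AE_I2, subst mult.commute) (intro tendsto_intros bump_tendsto_indicator)
      show "AE x in lebesgue. norm (h x * ?B m x) \<le> norm (indicator (cbox c d) x * h x)" for m
      proof (rule AE_I2)
        fix x
        have "\<bar>h x\<bar> * \<bar>?B m x\<bar> \<le> \<bar>h x\<bar> * 1"
          by (intro mult_left_mono) (auto simp: bump_nonneg bump_le_1)
        then show "norm (h x * ?B m x) \<le> norm (indicator (cbox c d) x * h x)"
          using out[of x m] by (cases "x \<in> cbox c d") (auto simp: abs_mult)
      qed
    qed
    then show ?thesis using LIMSEQ_unique[OF _ tendsto_const] zm by simp
  qed
  have local: "AE x in lebesgue. x \<in> cbox c d \<longrightarrow> h x = 0" if cd: "cbox c d \<subseteq> \<Omega>" for c d
  proof -
    let ?f = "\<lambda>x. indicator (box c d) x * h x"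
    \<comment> \<open>The box criterion concerns Borel measure, whereas \<open>h\<close> is only
      Lebesgue measurable; hence the passage to a Borel representative.\<close>
    obtain f' where f': "f' \<in> borel_measurable lborel" "AE x in lborel. ?f x = f' x"
      using completion_ex_borel_measurable_real[OF borel_measurable_integrable[OF ih'[OF cd]]] by blast
    have ae: "AE x in lebesgue. ?f x = f' x" using f'(2) by (rule AE_completion)
    have "integrable lebesgue f'"
      using integrable_cong_AE[OF borel_measurable_integrable[OF ih'[OF cd]] measurable_completion[OF f'(1)] ae] ih'[OF cd]
      by simp
    then have i: "integrable lborel f'" using integrable_completion f'(1) by blast
    have "AE x in lborel. f' x = 0"
    proof (rule AE_eq_0_if_box_integrals_0[OF i])
      fix p q :: 'a
      obtain r s where rs: "box p q \<inter> box c d = box r s" using box_Int_box[of p q c d] by blast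
      have "(LINT x:box p q|lborel. f' x) = (LINT x|lebesgue. indicator (box p q) x * f' x)"
        using f'(1) by (simp add: set_lebesgue_integral_def integral_completion)
      also have "\<dots> = (LINT x|lebesgue. indicator (box p q) x * ?f x)"
      proof (rule integral_cong_AE)
        show "(\<lambda>x. indicator (box p q) x * f' x) \<in> borel_measurable lebesgue"
          by (intro borel_measurable_times borel_measurable_indicator measurable_completion[OF f'(1)]) auto
        show "(\<lambda>x. indicator (box p q) x * ?f x) \<in> borel_measurable lebesgue"
          by (intro borel_measurable_times[OF _ borel_measurable_integrable[OF ih'[OF cd]]] borel_measurable_indicator) auto
        show "AE x in lebesgue. indicator (box p q) x * f' x = indicator (box p q) x * ?f x"
          using ae by eventually_elim simp
      qed
      also have "\<dots> = (LINT x|lebesgue. indicator (box r s) x * h x)"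
        by (simp add: rs[symmetric] indicator_inter_arith mult.assoc)
      also have "\<dots> = 0"
      proof (cases "box r s = {}")
        case False
        have "cbox r s = closure (box r s)" using False by (simp add: closure_box)
        also have "\<dots> \<subseteq> cbox c d"
          using rs box_subset_cbox by (intro closure_minimal) auto
        finally show ?thesis using boxes cd by auto
      qed simp
      finally show "(LINT x:box p q|lborel. f' x) = 0" .
    qed
    then have "AE x in lebesgue. f' x = 0" by (rule AE_completion)
    \<comment> \<open>Bumps approximate open boxes, but the covering uses closed ones; the faces in
      between are null sets.\<close>
    moreover have "AE x in lebesgue. x \<notin> cbox c d - box c d"
      using negligible_frontier_interval[of c d] by (simp only: negligible_iff_null_sets AE_not_in)
    ultimately show ?thesis using ae
      by eventually_elim (auto simp: indicator_def)
  qed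
  show ?thesis
  proof (rule open_countable_Union_open_cbox[OF assms(1)])
    fix D :: "'a set set"
    assume D: "countable D" "D \<subseteq> Pow \<Omega>" and cb: "\<And>X. X \<in> D \<Longrightarrow> \<exists>a b. X = cbox a b" and un: "\<Union>D = \<Omega>"
    have "\<forall>X\<in>D. AE x in lebesgue. x \<in> X \<longrightarrow> h x = 0"
    proof
      fix X assume X: "X \<in> D"
      obtain c d where "X = cbox c d" using cb[OF X] by blast
      moreover have "X \<subseteq> \<Omega>" using X D(2) by blast
      ultimately show "AE x in lebesgue. x \<in> X \<longrightarrow> h x = 0" using local by simp
    qed
    then have "AE x in lebesgue. \<forall>X\<in>D. x \<in> X \<longrightarrow> h x = 0"
      by (simp only: AE_ball_countable[OF D(1)])
    then have "AE x in lebesgue. x \<in> \<Omega> \<longrightarrow> h x = 0"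
      by eventually_elim (use un in blast)
    then show ?thesis using \<Omega> by (simp add: AE_restrict_space_iff)
  qed
qed

lemma weak_gradient_unique:
  assumes "open \<Omega>" "has_weak_gradient \<Omega> v w1" "has_weak_gradient \<Omega> v w2"
  shows "AE x in lebesgue_on \<Omega>. w1 x = w2 x"
proof -
  have l: "locally_integrable \<Omega> w1" "locally_integrable \<Omega> w2"
    using assms by (auto simp: has_weak_gradient_def)
  have "AE x in lebesgue_on \<Omega>. (w1 x - w2 x) \<bullet> b = 0" if b: "b \<in> Basis" for b
  proof (rule AE_eq_0_if_test_integrals_0[OF assms(1)])
    show "locally_integrable \<Omega> (\<lambda>x. (w1 x - w2 x) \<bullet> b)"
      using locally_integrable_inner[OF locally_integrable_lincomb[OF l, of 1 "-1"], of b] by simp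
    fix \<phi> assume \<phi>: "\<phi> \<in> test_functions \<Omega>"
    note i = test_integrable(2)[OF \<phi> assms(1) b]
    have "(LINT x|lebesgue_on \<Omega>. (w1 x - w2 x) \<bullet> b * \<phi> x) =
      (LINT x|lebesgue_on \<Omega>. (w1 x \<bullet> b) * \<phi> x) - (LINT x|lebesgue_on \<Omega>. (w2 x \<bullet> b) * \<phi> x)"
      using i[OF l(1)] i[OF l(2)] by (simp add: inner_diff_left left_diff_distrib)
    also have "\<dots> = 0" using assms(2,3) \<phi> b by (auto simp: has_weak_gradient_def)
    finally show "(LINT x|lebesgue_on \<Omega>. (w1 x - w2 x) \<bullet> b * \<phi> x) = 0" .
  qed
  then have "AE x in lebesgue_on \<Omega>. \<forall>b\<in>Basis. (w1 x - w2 x) \<bullet> b = 0"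
    by (simp only: AE_finite_all[OF finite_Basis]) blast
  then show ?thesis
  proof eventually_elim
    case (elim x)
    then have "w1 x - w2 x = 0" by (simp only: euclidean_all_zero_iff)
    then show ?case by simp
  qed
qed

lemma wgrad_unique:
  assumes "open \<Omega>" "has_weak_gradient \<Omega> v w"
  shows "AE x in lebesgue_on \<Omega>. wgrad \<Omega> v x = w x"
  using weak_gradient_unique[OF assms(1) _ assms(2)] assms(2) unfolding wgrad_def by (metis someI)

lemma has_weak_gradient_wgrad: "has_weak_gradient \<Omega> v w \<Longrightarrow> has_weak_gradient \<Omega> v (wgrad \<Omega> v)"
  unfolding wgrad_def by (rule someI[of "has_weak_gradient \<Omega> v"])

lemma wgrad_lincomb:
  assumes "open \<Omega>" "has_weak_gradient \<Omega> v1 w1" "has_weak_gradient \<Omega> v2 w2"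
  shows "AE x in lebesgue_on \<Omega>. wgrad \<Omega> (\<lambda>x. c * v1 x + d * v2 x) x = c *\<^sub>R wgrad \<Omega> v1 x + d *\<^sub>R wgrad \<Omega> v2 x"
  by (intro wgrad_unique has_weak_gradient_lincomb assms has_weak_gradient_wgrad[OF assms(2)]
       has_weak_gradient_wgrad[OF assms(3)])

subsection \<open>Approximation of Lipschitz functions\<close>

lemma continuous_measurable_lebesgue_on:
  fixes f :: "'a::euclidean_space \<Rightarrow> 'b::euclidean_space"
  assumes "continuous_on UNIV f" shows "f \<in> borel_measurable (lebesgue_on \<Omega>)"
  using assms by (intro measurable_restrict_space1 measurable_completion) (simp add: borel_measurable_continuous_onI)

lemma finite_measure_lebesgue_on_open:
  assumes "open \<Omega>" "bounded \<Omega>" shows "finite_measure (lebesgue_on \<Omega>)"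
proof
  have "\<Omega> \<in> lmeasurable" using assms lmeasurable_open by blast
  then show "emeasure (lebesgue_on \<Omega>) (space (lebesgue_on \<Omega>)) \<noteq> \<infinity>"
    by (simp add: emeasure_restrict_space fmeasurableD fmeasurableD2 del: emeasure_completion)
qed

lemma integrable_bounded_on:
  fixes f :: "'a::euclidean_space \<Rightarrow> 'b::euclidean_space"
  assumes "open \<Omega>" "bounded \<Omega>" "f \<in> borel_measurable (lebesgue_on \<Omega>)"
    and "AE x in lebesgue_on \<Omega>. norm (f x) \<le> B"
  shows "integrable (lebesgue_on \<Omega>) f"
  using finite_measure.integrable_const_bound[OF finite_measure_lebesgue_on_open[OF assms(1,2)] assms(4,3)] .

lemma integrable_imp_locally_integrable:
  fixes f :: "'a::euclidean_space \<Rightarrow> 'b::euclidean_space"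
  assumes "open \<Omega>" "integrable (lebesgue_on \<Omega>) f" shows "locally_integrable \<Omega> f"
  unfolding locally_integrable_def set_integrable_def
proof (intro allI impI)
  have \<Omega>: "\<Omega> \<in> sets lebesgue" using assms(1) by (simp add: borel_open lmeasurable_open)
  fix S :: "'a set" assume S: "compact S \<and> S \<subseteq> \<Omega>"
  have "integrable lebesgue (\<lambda>x. indicator \<Omega> x *\<^sub>R f x)"
    using assms(2) \<Omega> by (simp add: integrable_restrict_space)
  then have "integrable lebesgue (\<lambda>x. indicator S x *\<^sub>R (indicator \<Omega> x *\<^sub>R f x))"
    by (rule integrable_mult_indicator[rotated]) (use S in \<open>simp add: compact_imp_closed\<close>)
  moreover have "(\<lambda>x. indicator S x *\<^sub>R (indicator \<Omega> x *\<^sub>R f x)) = (\<lambda>x. indicator S x *\<^sub>R f x)"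
    using S by (auto simp: fun_eq_iff indicator_def)
  ultimately show "integrable lebesgue (\<lambda>x. indicator S x *\<^sub>R f x)" by simp
qed

text \<open>By monotone convergence the sum of the norms of the increments is integrable, hence
  finite a.e., and there the telescoping series converges absolutely.\<close>

lemma AE_convergent_if_summable_L1:
  fixes f :: "nat \<Rightarrow> 'a \<Rightarrow> 'b::{banach, second_countable_topology}"
  assumes i: "\<And>n. integrable M (f n)"
    and s: "summable (\<lambda>n. LINT x|M. norm (f (Suc n) x - f n x))"
  shows "AE x in M. convergent (\<lambda>n. f n x)"
proof -
  let ?d = "\<lambda>n x. norm (f (Suc n) x - f n x)"
  have id: "integrable M (?d n)" for n using i by auto
  have "(\<integral>\<^sup>+x. (\<Sum>n. ennreal (?d n x)) \<partial>M) = (\<Sum>n. \<integral>\<^sup>+x. ennreal (?d n x) \<partial>M)"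
    using id by (intro nn_integral_suminf) auto
  also have "\<dots> = (\<Sum>n. ennreal (LINT x|M. ?d n x))"
    using id by (intro suminf_cong nn_integral_eq_integral) auto
  also have "\<dots> \<noteq> \<infinity>"
    using s by (subst suminf_ennreal2) auto
  finally have "AE x in M. (\<Sum>n. ennreal (?d n x)) \<noteq> \<infinity>"
    using id by (intro nn_integral_noteq_infinite) auto
  then show ?thesis
  proof eventually_elim
    case (elim x)
    have "summable (\<lambda>n. ?d n x)" using elim by (intro summable_suminf_not_top) auto
    then have "summable (\<lambda>n. f (Suc n) x - f n x)" by (rule summable_norm_cancel)
    then have "convergent (\<lambda>n. \<Sum>k<n. f (Suc k) x - f k x)" by (simp add: summable_iff_convergent)
    then have "convergent (\<lambda>n. (f n x - f 0 x) + f 0 x)"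
      by (intro convergent_add convergent_const) (simp only: sum_lessThan_telescope[of "\<lambda>n. f n x"])
    then show ?case by simp
  qed
qed

text \<open>
  Instead of extracting weak limits, one takes nearly energy-minimal elements of a decreasing
  sequence of midpoint-convex classes; by the parallelogram law their gradients converge strongly.
\<close>

lemma near_minimizers_converge:
  fixes C :: "nat \<Rightarrow> ('a::euclidean_space \<Rightarrow> real) set"
  assumes \<Omega>: "open \<Omega>" "bounded \<Omega>"
    and dec: "\<And>m n. m \<le> n \<Longrightarrow> C n \<subseteq> C m" and ne: "\<And>n. C n \<noteq> {}"
    and sm: "\<And>n \<phi>. \<phi> \<in> C n \<Longrightarrow> smooth \<phi>"
    and mid: "\<And>n \<phi> \<psi>. \<phi> \<in> C n \<Longrightarrow> \<psi> \<in> C n \<Longrightarrow> (\<lambda>x. 1/2 * \<phi> x + 1/2 * \<psi> x) \<in> C n"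
    and gr: "\<And>n \<phi> x. \<phi> \<in> C n \<Longrightarrow> x \<in> \<Omega> \<Longrightarrow> norm (grad \<phi> x) \<le> L"
    and cl: "\<And>n \<phi> x. \<phi> \<in> C n \<Longrightarrow> x \<in> \<Omega> \<Longrightarrow> \<bar>\<phi> x - v x\<bar> \<le> 1 / real (Suc n)"
    and L: "L \<ge> 0"
  obtains \<phi> w where "\<And>n. \<phi> n \<in> C n" "w \<in> borel_measurable (lebesgue_on \<Omega>)" "\<And>x. norm (w x) \<le> L"
    "AE x in lebesgue_on \<Omega>. (\<lambda>n. grad (\<phi> n) x) \<longlonglongrightarrow> w x" "has_weak_gradient \<Omega> v w"
proof -
  let ?E = "lebesgue_on \<Omega>"
  interpret finite_measure ?E by (rule finite_measure_lebesgue_on_open[OF \<Omega>])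
  have sets\<Omega>: "\<Omega> \<in> sets lebesgue" using \<Omega>(1) by (simp add: borel_open lmeasurable_open)
  have inE: "AE x in ?E. x \<in> \<Omega>" using sets\<Omega> by (simp add: AE_restrict_space_iff)
  have mg: "grad \<phi> \<in> borel_measurable ?E" if "smooth \<phi>" for \<phi> :: "'a \<Rightarrow> real"
    by (intro continuous_measurable_lebesgue_on smooth_grad_continuous_on that)
  have ms: "\<phi> \<in> borel_measurable ?E" if "smooth \<phi>" for \<phi> :: "'a \<Rightarrow> real"
    by (intro continuous_measurable_lebesgue_on smooth_continuous_on that)
  have gb: "AE x in ?E. norm (grad \<phi> x) \<le> L" if "\<phi> \<in> C n" for \<phi> n
    using inE by eventually_elim (rule gr[OF that])
  have ig: "integrable ?E (grad \<phi>)" if "\<phi> \<in> C n" for \<phi> n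
    by (rule integrable_bounded_on[OF \<Omega> mg[OF sm[OF that]] gb[OF that]])
  have isq: "integrable ?E (\<lambda>x. (norm (grad \<phi> x))\<^sup>2)" if "\<phi> \<in> C n" for \<phi> n
  proof (rule integrable_bounded_on[OF \<Omega>])
    show "(\<lambda>x. (norm (grad \<phi> x))\<^sup>2) \<in> borel_measurable ?E" using mg[OF sm[OF that]] by measurable
    show "AE x in ?E. norm ((norm (grad \<phi> x))\<^sup>2) \<le> L\<^sup>2"
      using gb[OF that] by eventually_elim (simp add: power_mono)
  qed
  define J where "J \<phi> = (LINT x|?E. (norm (grad \<phi> x))\<^sup>2)" for \<phi> :: "'a \<Rightarrow> real"
  \<comment> \<open>The classes shrink, so their infimal Dirichlet energies increase; the gradient
    bound keeps them bounded, and they converge to some \<open>l\<close>.\<close>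
  define I where "I n = Inf (J ` C n)" for n
  have J0: "0 \<le> J \<phi>" for \<phi> by (simp add: J_def)
  have bdd: "bdd_below (J ` C n)" for n using J0 by (intro bdd_belowI[of _ 0]) auto
  have IJ: "I n \<le> J \<phi>" if "\<phi> \<in> C n" for n \<phi>
    unfolding I_def using that bdd by (intro cINF_lower) auto
  have J_le: "J \<phi> \<le> measure ?E (space ?E) * L\<^sup>2" if "\<phi> \<in> C n" for \<phi> n
  proof -
    have "J \<phi> \<le> (LINT x|?E. L\<^sup>2)" unfolding J_def
    proof (rule integral_mono_AE[OF isq[OF that]])
      show "AE x in ?E. (norm (grad \<phi> x))\<^sup>2 \<le> L\<^sup>2"
        using gb[OF that] by eventually_elim (simp add: power_mono)
    qed simp
    then show ?thesis by simp
  qed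
  have "incseq I"
    unfolding I_def incseq_def using dec ne bdd by (intro allI impI cInf_superset_mono image_mono) auto
  moreover have "I n \<le> measure ?E (space ?E) * L\<^sup>2" for n
    using ne[of n] IJ[of _ n] J_le[of _ n] by (meson ex_in_conv order_trans)
  ultimately obtain l where l: "I \<longlonglongrightarrow> l" "\<And>n. I n \<le> l"
    using incseq_convergent by metis
  \<comment> \<open>The class index \<open>N\<close> is taken so large that its infimum is within
    \<open>(1/4)^k\<close> of the limit; the element is then within \<open>(1/4)^k\<close> of being
    minimal in that class. The geometric rate makes the later series summable without passing to a
    subsequence again.\<close>
  have "\<exists>\<phi> N. N \<ge> k \<and> \<phi> \<in> C N \<and> J \<phi> \<le> l + (1/4)^k \<and> l - (1/4)^k \<le> I N" for k
  proof -
    have "\<forall>\<^sub>F n in sequentially. l - (1/4)^k < I n" using l(1) by (rule order_tendstoD) simp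
    then obtain N where N: "N \<ge> k" "l - (1/4)^k < I N"
      unfolding eventually_sequentially by (metis nle_le)
    have "Inf (J ` C N) < I N + (1/4)^k" unfolding I_def by simp
    then obtain \<phi> where "\<phi> \<in> C N" "J \<phi> < I N + (1/4)^k"
      using cInf_less_iff[OF _ bdd[of N]] ne[of N] by auto
    then show ?thesis using N l(2)[of N] by (intro exI[of _ \<phi>] exI[of _ N]) auto
  qed
  then obtain \<phi> N where N: "\<And>k. N k \<ge> k" "\<And>k. \<phi> k \<in> C (N k)" "\<And>k. J (\<phi> k) \<le> l + (1/4)^k"
    "\<And>k. l - (1/4)^k \<le> I (N k)" by metis
  have \<phi>C: "\<phi> k \<in> C k" for k using N(1,2) dec by blast
  have sq: "(LINT x|?E. (norm (grad (\<phi> (Suc k)) x - grad (\<phi> k) x))\<^sup>2) \<le> 8 * (1/4)^k" for k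
  proof -
    let ?a = "\<phi> (Suc k)" and ?b = "\<phi> k"
    let ?m = "\<lambda>x. 1/2 * ?a x + 1/2 * ?b x"
    \<comment> \<open>Nothing orders the two indices, so the midpoint is placed in the larger of the
      two classes. Its energy is at least \<open>l - (1/4)^k\<close>, and the parallelogram identity
      leaves (2 + 2 + 4) times \<open>(1/4)^k\<close>.\<close>
    let ?n = "min (N (Suc k)) (N k)"
    have C: "?a \<in> C ?n" "?b \<in> C ?n" using N(2)[of "Suc k"] N(2)[of k] dec[of ?n] by (meson min.cobounded1 min.cobounded2 subsetD)+
    have m: "?m \<in> C ?n" by (rule mid[OF C])
    have "(1/4::real)^Suc k \<le> (1/4)^k" by (intro power_decreasing) auto
    then have "l - (1/4)^k \<le> I (N (Suc k))" using N(4)[of "Suc k"] by linarith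
    then have "l - (1/4)^k \<le> I ?n" using N(4)[of k] by (auto simp: min_def)
    also have "\<dots> \<le> J ?m" by (rule IJ[OF m])
    finally have Jm: "l - (1/4)^k \<le> J ?m" .
    have par: "(norm (p - q))\<^sup>2 = 2 * (norm p)\<^sup>2 + 2 * (norm q)\<^sup>2 - 4 * (norm ((1/2) *\<^sub>R p + (1/2) *\<^sub>R q))\<^sup>2" for p q :: 'a
      unfolding power2_norm_eq_inner by (simp add: inner_diff_left inner_diff_right inner_add_left inner_add_right inner_commute)
    have "(LINT x|?E. (norm (grad ?a x - grad ?b x))\<^sup>2) =
        (LINT x|?E. 2 * (norm (grad ?a x))\<^sup>2 + 2 * (norm (grad ?b x))\<^sup>2 - 4 * (norm (grad ?m x))\<^sup>2)"
      by (simp only: par grad_lincomb[OF sm[OF C(1)] sm[OF C(2)]])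
    also have "\<dots> = 2 * J ?a + 2 * J ?b - 4 * J ?m"
      unfolding J_def using isq[OF C(1)] isq[OF C(2)] isq[OF m] by simp
    also have "\<dots> \<le> 8 * (1/4)^k" using Jm N(3)[of k] N(3)[of "Suc k"] \<open>(1/4::real)^Suc k \<le> (1/4)^k\<close> by linarith
    finally show ?thesis .
  qed
  have "summable (\<lambda>k. LINT x|?E. norm (grad (\<phi> (Suc k)) x - grad (\<phi> k) x))"
  proof (rule summable_comparison_test)
    let ?m = "measure ?E (space ?E)"
    show "summable (\<lambda>k. (?m + 8) * (1/2::real)^k)" by (intro summable_mult summable_geometric) simp
    show "\<exists>M. \<forall>k\<ge>M. norm (LINT x|?E. norm (grad (\<phi> (Suc k)) x - grad (\<phi> k) x)) \<le> (?m + 8) * (1/2)^k"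
    proof (intro exI allI impI)
      fix k :: nat
      let ?d = "\<lambda>x. norm (grad (\<phi> (Suc k)) x - grad (\<phi> k) x)"
      \<comment> \<open>An elementary substitute for the Cauchy-Schwarz inequality on a finite
        measure space: it converts the mean square bound of order 4^(-k) into an L1 bound of order
        2^(-k).\<close>
      have am: "t \<le> (1/2)^k + 2^k * t\<^sup>2" if "t \<ge> 0" for t :: real
      proof (cases "t \<le> (1/2)^k")
        case False
        then have "1 \<le> 2^k * t" by (simp add: field_simps power_divide)
        then have "t \<le> 2^k * t * t" using that mult_right_mono[of 1 "2^k * t" t] by simp
        then show ?thesis by (simp add: power2_eq_square mult.assoc add_increasing)
      qed (simp add: add_increasing2)
      have md: "?d \<in> borel_measurable ?E" using mg[OF sm[OF \<phi>C[of k]]] mg[OF sm[OF \<phi>C[of "Suc k"]]] by measurable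
      have db: "AE x in ?E. norm (?d x) \<le> 2 * L"
        using gb[OF \<phi>C[of k]] gb[OF \<phi>C[of "Suc k"]]
        by eventually_elim (smt (verit) norm_triangle_ineq4 real_norm_def norm_ge_zero abs_of_nonneg)
      have id: "integrable ?E ?d" by (rule integrable_bounded_on[OF \<Omega> md db])
      have id2: "integrable ?E (\<lambda>x. (?d x)\<^sup>2)"
      proof (rule integrable_bounded_on[OF \<Omega>])
        show "(\<lambda>x. (?d x)\<^sup>2) \<in> borel_measurable ?E" using md by measurable
        show "AE x in ?E. norm ((?d x)\<^sup>2) \<le> (2 * L)\<^sup>2"
          using db by eventually_elim (use power_mono[of _ "2 * L" 2] in simp)
      qed
      have "(LINT x|?E. ?d x) \<le> (LINT x|?E. (1/2)^k + 2^k * (?d x)\<^sup>2)"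
        using id id2 am by (intro integral_mono) auto
      also have "\<dots> = (1/2)^k * ?m + 2^k * (LINT x|?E. (?d x)\<^sup>2)" using id2 by simp
      also have "\<dots> \<le> (1/2)^k * ?m + 2^k * (8 * (1/4)^k)"
        using sq[of k] by (intro add_left_mono mult_left_mono) auto
      also have "2^k * (8 * (1/4)^k) = (8 * (1/2)^k :: real)"
        by (simp add: power_mult_distrib[symmetric] mult.left_commute[of "2^k"])
      finally show "norm (LINT x|?E. ?d x) \<le> (?m + 8) * (1/2)^k" by (simp add: algebra_simps)
    qed
  qed
  then have conv: "AE x in ?E. convergent (\<lambda>k. grad (\<phi> k) x)"
    by (intro AE_convergent_if_summable_L1 ig[OF \<phi>C])
  \<comment> \<open>The value 0 on the exceptional set makes the bound by \<open>L\<close> hold at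
    every point.\<close>
  define w where "w x = (if x \<in> \<Omega> \<and> convergent (\<lambda>k. grad (\<phi> k) x) then lim (\<lambda>k. grad (\<phi> k) x) else 0)" for x
  have lim: "AE x in ?E. (\<lambda>k. grad (\<phi> k) x) \<longlonglongrightarrow> w x"
    using conv inE by eventually_elim (simp add: w_def convergent_LIMSEQ_iff)
  have mw: "w \<in> borel_measurable ?E"
  proof -
    have "(\<lambda>x. lim (\<lambda>k. grad (\<phi> k) x)) \<in> borel_measurable ?E"
      by (intro borel_measurable_lim_metric mg sm[OF \<phi>C])
    moreover have ae: "AE x in ?E. w x = lim (\<lambda>k. grad (\<phi> k) x)"
      using conv inE by eventually_elim (simp add: w_def)
    ultimately show ?thesis by (simp only: lebesgue_on_cong_AE(1)[OF sets\<Omega> ae])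
  qed
  have wL: "norm (w x) \<le> L" for x
  proof (cases "x \<in> \<Omega> \<and> convergent (\<lambda>k. grad (\<phi> k) x)")
    case True
    then have "(\<lambda>k. grad (\<phi> k) x) \<longlonglongrightarrow> w x" by (simp add: w_def convergent_LIMSEQ_iff)
    from tendsto_norm[OF this] show ?thesis
      by (rule LIMSEQ_le_const2) (use gr[OF \<phi>C] True in blast)
  qed (use L in \<open>auto simp: w_def\<close>)
  have vlim: "(\<lambda>k. \<phi> k x) \<longlonglongrightarrow> v x" if "x \<in> \<Omega>" for x
  proof (rule LIMSEQ_I)
    fix r :: real assume "r > 0"
    then obtain n where n: "inverse (real (Suc n)) < r" using reals_Archimedean by blast
    have "norm (\<phi> k x - v x) < r" if "k \<ge> n" for k
    proof -
      have "norm (\<phi> k x - v x) \<le> 1 / real (Suc k)" using cl[OF \<phi>C \<open>x \<in> \<Omega>\<close>] by simp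
      also have "\<dots> \<le> inverse (real (Suc n))" using that by (simp add: divide_simps)
      finally show ?thesis using n by simp
    qed
    then show "\<exists>n. \<forall>k\<ge>n. norm (\<phi> k x - v x) < r" by blast
  qed
  have vAE: "AE x in ?E. (\<lambda>k. \<phi> k x) \<longlonglongrightarrow> v x" using inE by eventually_elim (rule vlim)
  \<comment> \<open>Measurability of \<open>v\<close> is not among the assumptions; it is inherited
    from the smooth functions converging to \<open>v\<close> on the domain.\<close>
  have mv: "v \<in> borel_measurable ?E"
  proof -
    have "(\<lambda>x. lim (\<lambda>k. \<phi> k x)) \<in> borel_measurable ?E"
      by (intro borel_measurable_lim_metric ms sm[OF \<phi>C])
    moreover have ae: "AE x in ?E. v x = lim (\<lambda>k. \<phi> k x)"
      using inE by eventually_elim (simp add: limI[OF vlim])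
    ultimately show ?thesis by (simp only: lebesgue_on_cong_AE(1)[OF sets\<Omega> ae])
  qed
  have "compact (\<phi> 0 ` closure \<Omega>)"
    using \<Omega>(2) by (intro compact_continuous_image smooth_continuous_on sm[OF \<phi>C]) auto
  from compact_imp_bounded[OF this] obtain B where B: "\<And>x. x \<in> closure \<Omega> \<Longrightarrow> \<bar>\<phi> 0 x\<bar> \<le> B"
    unfolding bounded_iff by auto
  have vB: "\<bar>v x\<bar> \<le> B + 1" if "x \<in> \<Omega>" for x
    using cl[OF \<phi>C[of 0] that] B[of x] that closure_subset[of \<Omega>] by fastforce
  have iv: "integrable ?E v"
  proof (rule integrable_bounded_on[OF \<Omega> mv])
    show "AE x in ?E. norm (v x) \<le> B + 1" using inE by eventually_elim (simp add: vB)
  qed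
  have iw: "integrable ?E w" by (rule integrable_bounded_on[OF \<Omega> mw]) (use wL in auto)
  have lv: "locally_integrable \<Omega> v" and lw: "locally_integrable \<Omega> w"
    using integrable_imp_locally_integrable[OF \<Omega>(1)] iv iw by auto
  have lc: "locally_integrable \<Omega> (\<lambda>_. c::real)" for c by (intro locally_integrable_continuous) auto
  have "(LINT x|?E. v x * frechet_derivative \<psi> (at x) b) = - (LINT x|?E. (w x \<bullet> b) * \<psi> x)"
    if \<psi>: "\<psi> \<in> test_functions \<Omega>" and b: "b \<in> Basis" for \<psi> b
  proof -
    have s\<psi>: "smooth \<psi>" using \<psi> by (simp add: test_functions_def)
    have ic: "integrable ?E (\<lambda>x. c * frechet_derivative \<psi> (at x) b)" for c
      using test_integrable(1)[OF \<psi> \<Omega>(1) b lc] .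
    have "integrable ?E (\<lambda>x. (b \<bullet> b) * \<psi> x)"
      by (rule test_integrable(2)[OF \<psi> \<Omega>(1) b locally_integrable_continuous]) simp
    then have i\<psi>: "integrable ?E \<psi>" using b by simp
    have 1: "(\<lambda>k. LINT x|?E. \<phi> k x * frechet_derivative \<psi> (at x) b) \<longlonglongrightarrow> (LINT x|?E. v x * frechet_derivative \<psi> (at x) b)"
    proof (rule integral_dominated_convergence[where w = "\<lambda>x. norm ((B + 2) * frechet_derivative \<psi> (at x) b)"])
      show "integrable ?E (\<lambda>x. norm ((B + 2) * frechet_derivative \<psi> (at x) b))" using ic by (rule integrable_norm)
      show "AE x in ?E. (\<lambda>k. \<phi> k x * frechet_derivative \<psi> (at x) b) \<longlonglongrightarrow> v x * frechet_derivative \<psi> (at x) b"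
        using vAE by eventually_elim (intro tendsto_intros)
      show "(\<lambda>x. v x * frechet_derivative \<psi> (at x) b) \<in> borel_measurable ?E"
        using test_integrable(1)[OF \<psi> \<Omega>(1) b lv] by auto
      show "(\<lambda>x. \<phi> k x * frechet_derivative \<psi> (at x) b) \<in> borel_measurable ?E" for k
        by (intro borel_measurable_times ms sm[OF \<phi>C] smooth_partial s\<psi> b)
      show "AE x in ?E. norm (\<phi> k x * frechet_derivative \<psi> (at x) b) \<le> norm ((B + 2) * frechet_derivative \<psi> (at x) b)" for k
        using inE
      proof eventually_elim
        case (elim x)
        have "1 / real (Suc k) \<le> 1" by simp
        then have "\<bar>\<phi> k x\<bar> \<le> B + 2" using cl[OF \<phi>C[of k] elim] vB[OF elim] by linarith
        then show ?case by (simp add: abs_mult mult_right_mono)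
      qed
    qed
    have 2: "(\<lambda>k. LINT x|?E. (grad (\<phi> k) x \<bullet> b) * \<psi> x) \<longlonglongrightarrow> (LINT x|?E. (w x \<bullet> b) * \<psi> x)"
    proof (rule integral_dominated_convergence[where w = "\<lambda>x. L * norm (\<psi> x)"])
      show "integrable ?E (\<lambda>x. L * norm (\<psi> x))" using i\<psi> by simp
      show "AE x in ?E. (\<lambda>k. (grad (\<phi> k) x \<bullet> b) * \<psi> x) \<longlonglongrightarrow> (w x \<bullet> b) * \<psi> x"
        using lim by eventually_elim (intro tendsto_intros)
      show "(\<lambda>x. (w x \<bullet> b) * \<psi> x) \<in> borel_measurable ?E"
        using test_integrable(2)[OF \<psi> \<Omega>(1) b lw] by auto
      show "(\<lambda>x. (grad (\<phi> k) x \<bullet> b) * \<psi> x) \<in> borel_measurable ?E" for k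
        by (intro borel_measurable_times borel_measurable_inner borel_measurable_const ms[OF s\<psi>] mg sm[OF \<phi>C])
      show "AE x in ?E. norm ((grad (\<phi> k) x \<bullet> b) * \<psi> x) \<le> L * norm (\<psi> x)" for k
        using gb[OF \<phi>C[of k]]
      proof eventually_elim
        case (elim x)
        have "\<bar>grad (\<phi> k) x \<bullet> b\<bar> \<le> L" using Basis_le_norm[OF b, of "grad (\<phi> k) x"] elim by linarith
        then show ?case by (simp add: abs_mult mult_right_mono)
      qed
    qed
    have "(LINT x|?E. \<phi> k x * frechet_derivative \<psi> (at x) b) = - (LINT x|?E. (grad (\<phi> k) x \<bullet> b) * \<psi> x)" for k
      using smooth_has_weak_gradient[OF \<Omega>(1) sm[OF \<phi>C[of k]]] \<psi> b by (simp add: has_weak_gradient_def)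
    then have "(\<lambda>k. LINT x|?E. \<phi> k x * frechet_derivative \<psi> (at x) b) \<longlonglongrightarrow> - (LINT x|?E. (w x \<bullet> b) * \<psi> x)"
      using tendsto_minus[OF 2] by simp
    with 1 show ?thesis by (rule LIMSEQ_unique)
  qed
  then have "has_weak_gradient \<Omega> v w" using lv lw by (simp add: has_weak_gradient_def)
  with \<phi>C mw wL lim show thesis by (rule that)
qed

text \<open>The shrinking classes consist of the elements of \<open>T\<close> that are uniformly
  close to \<open>v\<close> and obey the gradient bound; both constraints survive midpoints. The
  lemma is applied with \<open>T\<close> the smooth functions and with \<open>T\<close> the test
  functions.\<close>

lemma approx_by_midpoint_convex_class:
  fixes v :: "'a::euclidean_space \<Rightarrow> real"
  assumes \<Omega>: "open \<Omega>" "bounded \<Omega>" and L: "L \<ge> 0"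
    and sm: "\<And>\<phi>. \<phi> \<in> T \<Longrightarrow> smooth \<phi>"
    and mid: "\<And>\<phi> \<psi>. \<phi> \<in> T \<Longrightarrow> \<psi> \<in> T \<Longrightarrow> (\<lambda>x. 1/2 * \<phi> x + 1/2 * \<psi> x) \<in> T"
    and ex: "\<And>\<epsilon>. \<epsilon> > 0 \<Longrightarrow> \<exists>\<phi>\<in>T. (\<forall>x\<in>\<Omega>. \<bar>\<phi> x - v x\<bar> \<le> \<epsilon>) \<and> (\<forall>x\<in>\<Omega>. norm (grad \<phi> x) \<le> L)"
  obtains \<phi> w where "\<And>n. \<phi> n \<in> T" "\<And>n x. x \<in> \<Omega> \<Longrightarrow> \<bar>\<phi> n x - v x\<bar> \<le> 1 / real (Suc n)"
    "\<And>n x. x \<in> \<Omega> \<Longrightarrow> norm (grad (\<phi> n) x) \<le> L"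
    "w \<in> borel_measurable (lebesgue_on \<Omega>)" "\<And>x. norm (w x) \<le> L"
    "AE x in lebesgue_on \<Omega>. (\<lambda>n. grad (\<phi> n) x) \<longlonglongrightarrow> w x" "has_weak_gradient \<Omega> v w"
proof -
  define C where "C n = {\<phi> \<in> T. (\<forall>x\<in>\<Omega>. \<bar>\<phi> x - v x\<bar> \<le> 1 / real (Suc n)) \<and>
      (\<forall>x\<in>\<Omega>. norm (grad \<phi> x) \<le> L)}" for n
  have dec: "C n \<subseteq> C m" if "m \<le> n" for m n
  proof -
    have "1 / real (Suc n) \<le> 1 / real (Suc m)" using that by (simp add: divide_simps)
    then show ?thesis unfolding C_def by force
  qed
  have ne: "C n \<noteq> {}" for n
  proof -
    have "1 / real (Suc n) > 0" by simp
    from ex[OF this] show ?thesis unfolding C_def by blast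
  qed
  have midC: "(\<lambda>x. 1/2 * \<phi> x + 1/2 * \<psi> x) \<in> C n" if "\<phi> \<in> C n" "\<psi> \<in> C n" for n \<phi> \<psi>
  proof -
    have t: "\<phi> \<in> T" "\<psi> \<in> T" using that by (auto simp: C_def)
    have "\<bar>1/2 * \<phi> x + 1/2 * \<psi> x - v x\<bar> \<le> 1 / real (Suc n)" if "x \<in> \<Omega>" for x
    proof -
      have "\<bar>\<phi> x - v x\<bar> \<le> 1 / real (Suc n)" "\<bar>\<psi> x - v x\<bar> \<le> 1 / real (Suc n)"
        using \<open>\<phi> \<in> C n\<close> \<open>\<psi> \<in> C n\<close> that by (auto simp: C_def)
      then show ?thesis by argo
    qed
    moreover have "norm ((1/2) *\<^sub>R grad \<phi> x + (1/2) *\<^sub>R grad \<psi> x) \<le> L" if "x \<in> \<Omega>" for x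
      using \<open>\<phi> \<in> C n\<close> \<open>\<psi> \<in> C n\<close> that norm_triangle_ineq[of "(1/2) *\<^sub>R grad \<phi> x" "(1/2) *\<^sub>R grad \<psi> x"]
      unfolding C_def by force
    ultimately show ?thesis
      unfolding C_def mem_Collect_eq grad_lincomb[OF sm[OF t(1)] sm[OF t(2)]] using mid[OF t] by blast
  qed
  have smC: "smooth \<phi>" if "\<phi> \<in> C n" for \<phi> n using that sm by (auto simp: C_def)
  have gr: "norm (grad \<phi> x) \<le> L" if "\<phi> \<in> C n" "x \<in> \<Omega>" for \<phi> n x using that by (auto simp: C_def)
  have cl: "\<bar>\<phi> x - v x\<bar> \<le> 1 / real (Suc n)" if "\<phi> \<in> C n" "x \<in> \<Omega>" for \<phi> n x using that by (auto simp: C_def)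
  show thesis
  proof (rule near_minimizers_converge[where C = C and v = v and L = L and \<Omega> = \<Omega>])
    show "C n \<subseteq> C m" if "m \<le> n" for m n using that by (rule dec)
    show "C n \<noteq> {}" for n by (rule ne)
    show "smooth \<phi>" if "\<phi> \<in> C n" for n \<phi> using that by (rule smC)
    show "(\<lambda>x. 1/2 * \<phi> x + 1/2 * \<psi> x) \<in> C n" if "\<phi> \<in> C n" "\<psi> \<in> C n" for n \<phi> \<psi>
      using that by (rule midC)
    show "norm (grad \<phi> x) \<le> L" if "\<phi> \<in> C n" "x \<in> \<Omega>" for n \<phi> x using that by (rule gr)
    show "\<bar>\<phi> x - v x\<bar> \<le> 1 / real (Suc n)" if "\<phi> \<in> C n" "x \<in> \<Omega>" for n \<phi> x using that by (rule cl)
    fix \<phi> w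
    assume C: "\<And>n. \<phi> n \<in> C n" and w: "w \<in> borel_measurable (lebesgue_on \<Omega>)" "\<And>x. norm (w x) \<le> L"
      "AE x in lebesgue_on \<Omega>. (\<lambda>n. grad (\<phi> n) x) \<longlonglongrightarrow> w x" "has_weak_gradient \<Omega> v w"
    have "\<phi> n \<in> T" for n using C by (simp add: C_def)
    then show thesis using cl[OF C] gr[OF C] w by (rule that)
  qed (rule \<Omega> L)+
qed

text \<open>McShane's extension, the lower envelope of the cones of slope \<open>L\<close> with
  vertices on the graph. The empty set is treated apart because the infimum over it is
  meaningless.\<close>

lemma lipschitz_extension:
  fixes v :: "'a::metric_space \<Rightarrow> real"
  assumes v: "L-lipschitz_on A v"
  obtains v' where "L-lipschitz_on UNIV v'" "\<And>x. x \<in> A \<Longrightarrow> v' x = v x"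
proof (cases "A = {}")
  case True
  have "L-lipschitz_on UNIV (\<lambda>_. 0::real)" using v lipschitz_on_nonneg by (intro lipschitz_onI) auto
  then show ?thesis using that True by blast
next
  case False
  then obtain a where a: "a \<in> A" by blast
  have L: "L \<ge> 0" using v lipschitz_on_nonneg by blast
  have vl: "v y \<le> v z + L * dist y z" if "y \<in> A" "z \<in> A" for y z
    using lipschitz_onD[OF v that] by (simp add: dist_real_def)
  define v' where "v' x = (INF y\<in>A. v y + L * dist x y)" for x
  have bdd: "bdd_below ((\<lambda>y. v y + L * dist x y) ` A)" for x
  proof (rule bdd_belowI2[where m = "v a - L * dist a x"])
    fix y assume "y \<in> A"
    have "L * dist a y \<le> L * (dist a x + dist x y)" using L by (intro mult_left_mono dist_triangle)
    then show "v a - L * dist a x \<le> v y + L * dist x y" using vl[OF a \<open>y \<in> A\<close>] by (simp add: distrib_left)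
  qed
  show ?thesis
  proof
    have le: "v' x \<le> v' z + L * dist x z" for x z
    proof -
      have "v' x - L * dist x z \<le> v y + L * dist z y" if y: "y \<in> A" for y
      proof -
        have "v' x \<le> v y + L * dist x y" unfolding v'_def using y bdd by (rule cINF_lower[rotated])
        also have "\<dots> \<le> v y + L * (dist x z + dist z y)" using L by (intro add_left_mono mult_left_mono dist_triangle)
        finally show ?thesis by (simp add: distrib_left)
      qed
      then have "v' x - L * dist x z \<le> v' z" unfolding v'_def[of z] using False by (intro cINF_greatest) auto
      then show ?thesis by simp
    qed
    show "L-lipschitz_on UNIV v'"
    proof (rule lipschitz_onI[OF _ L])
      fix x z show "dist (v' x) (v' z) \<le> L * dist x z"
        using le[of x z] le[of z x] by (simp add: dist_real_def dist_commute abs_le_iff)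
    qed
    fix x assume x: "x \<in> A"
    show "v' x = v x"
    proof (rule antisym)
      show "v' x \<le> v x" unfolding v'_def using cINF_lower[OF bdd x, of x] by simp
      show "v x \<le> v' x" unfolding v'_def using vl[OF x] False by (intro cINF_greatest) auto
    qed
  qed
qed

text \<open>The class of smooth functions contains elements at every precision, namely
  mollifications of a McShane extension, which keep the constant \<open>L\<close>.\<close>

lemma lipschitz_has_weak_gradient:
  fixes v :: "'a::euclidean_space \<Rightarrow> real"
  assumes \<Omega>: "open \<Omega>" "bounded \<Omega>" and v: "L-lipschitz_on \<Omega> v"
  obtains w where "w \<in> borel_measurable (lebesgue_on \<Omega>)" "\<And>x. norm (w x) \<le> L" "has_weak_gradient \<Omega> v w"
proof -
  have L: "L \<ge> 0" using v lipschitz_on_nonneg by blast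
  obtain v' where v': "L-lipschitz_on UNIV v'" "\<And>x. x \<in> \<Omega> \<Longrightarrow> v' x = v x"
    using lipschitz_extension[OF v] by blast
  show thesis
  proof (rule approx_by_midpoint_convex_class[where T = "Collect smooth" and v = v and L = L and \<Omega> = \<Omega>])
    show "(\<lambda>x. 1/2 * \<phi> x + 1/2 * \<psi> x) \<in> Collect smooth"
      if "\<phi> \<in> Collect smooth" "\<psi> \<in> Collect smooth" for \<phi> \<psi> :: "'a \<Rightarrow> real"
      using smooth_lincomb[of \<phi> \<psi>] that by blast
    fix \<epsilon> :: real assume "\<epsilon> > 0"
    then obtain \<phi> where \<phi>: "smooth \<phi>" "\<And>x. x \<in> \<Omega> \<Longrightarrow> \<bar>\<phi> x - v' x\<bar> \<le> \<epsilon>" "L-lipschitz_on \<Omega> \<phi>"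
      using mollify_lipschitz[OF v'(1) \<Omega>(2), of \<epsilon>] by metis
    then have "\<forall>x\<in>\<Omega>. norm (grad \<phi> x) \<le> L" using lipschitz_grad_le[OF _ _ \<Omega>(1)] by blast
    then show "\<exists>\<phi>\<in>Collect smooth. (\<forall>x\<in>\<Omega>. \<bar>\<phi> x - v x\<bar> \<le> \<epsilon>) \<and> (\<forall>x\<in>\<Omega>. norm (grad \<phi> x) \<le> L)"
      using \<phi> v'(2) by (intro bexI[of _ \<phi>]) auto
  qed (use \<Omega> L that in blast)+
qed

text \<open>The approximants are compactly supported in the domain and their gradients converge a.e.
  under a uniform bound. This carries both membership in \<open>W1_0\<close> and the Poincare
  inequality over to Lipschitz functions.\<close>

lemma lipschitz_test_approx:
  fixes v :: "'a::euclidean_space \<Rightarrow> real"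
  assumes \<Omega>: "open \<Omega>" "bounded \<Omega>" and v: "L-lipschitz_on UNIV v" "\<And>x. x \<notin> \<Omega> \<Longrightarrow> v x = 0"
  obtains \<phi> w where "\<And>n. \<phi> n \<in> test_functions \<Omega>" "\<And>n x. x \<in> \<Omega> \<Longrightarrow> \<bar>\<phi> n x - v x\<bar> \<le> 1 / real (Suc n)"
    "\<And>n x. x \<in> \<Omega> \<Longrightarrow> norm (grad (\<phi> n) x) \<le> L"
    "w \<in> borel_measurable (lebesgue_on \<Omega>)" "\<And>x. norm (w x) \<le> L"
    "AE x in lebesgue_on \<Omega>. (\<lambda>n. grad (\<phi> n) x) \<longlonglongrightarrow> w x" "has_weak_gradient \<Omega> v w"
proof -
  have L: "L \<ge> 0" using v lipschitz_on_nonneg by blast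
  have ex: "\<exists>\<phi>\<in>test_functions \<Omega>. (\<forall>x\<in>\<Omega>. \<bar>\<phi> x - v x\<bar> \<le> \<eta>) \<and> (\<forall>x\<in>\<Omega>. norm (grad \<phi> x) \<le> L)"
    if "\<eta> > 0" for \<eta>
  proof -
    define \<epsilon> where "\<epsilon> = \<eta> / 2"
    have \<epsilon>: "\<epsilon> > 0" "\<epsilon> + \<epsilon> = \<eta>" using that by (auto simp: \<epsilon>_def)
    \<comment> \<open>Soft thresholding makes the support compact without increasing the Lipschitz constant.\<close>
    define v' where "v' x = v x - max (- \<epsilon>) (min \<epsilon> (v x))" for x
    have v'v: "\<bar>v' x - v x\<bar> \<le> \<epsilon>" for x using \<epsilon>(1) by (auto simp: v'_def)
    have "\<bar>v' x - v' y\<bar> \<le> \<bar>v x - v y\<bar>" for x y using \<epsilon>(1) by (auto simp: v'_def max_def min_def)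
    then have v'L: "L-lipschitz_on UNIV v'"
      using lipschitz_onD[OF v(1)] L by (intro lipschitz_onI) (fastforce simp: dist_real_def intro: order_trans)+
    \<comment> \<open>This set contains all points where the thresholded function is nonzero. It is
      compact in the domain, so mollifying at a scale of at most half its distance \<open>d\<close>
      to the complement keeps the support inside.\<close>
    define A where "A = {x. \<epsilon> \<le> \<bar>v x\<bar>}"
    have A: "A \<subseteq> \<Omega>" using v(2) \<epsilon>(1) unfolding A_def by fastforce
    have "continuous_on UNIV v" by (rule lipschitz_on_continuous_on[OF v(1)])
    then have "closed A" unfolding A_def by (intro closed_Collect_le continuous_intros)
    then have cA: "compact A" using A \<Omega>(2) bounded_subset compact_eq_bounded_closed by blast
    obtain d where d: "d > 0" "\<And>x y. x \<in> A \<Longrightarrow> y \<in> - \<Omega> \<Longrightarrow> d \<le> dist x y"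
    proof -
      have "A \<inter> - \<Omega> = {}" using A by blast
      then show thesis
        using separate_compact_closed[OF cA, of "- \<Omega>"] \<Omega>(1) that by (auto simp: closed_Compl)
    qed
    let ?\<delta> = "min \<epsilon> (d / 2)"
    have "?\<delta> > 0" using \<epsilon>(1) d(1) by simp
    then obtain \<phi> where \<phi>: "smooth \<phi>" "\<And>x. x \<in> \<Omega> \<Longrightarrow> \<bar>\<phi> x - v' x\<bar> \<le> ?\<delta>" "L-lipschitz_on \<Omega> \<phi>"
       "\<And>x. \<phi> x \<noteq> 0 \<Longrightarrow> \<exists>y. dist x y \<le> ?\<delta> \<and> v' y \<noteq> 0"
      using mollify_lipschitz[OF v'L \<Omega>(2)] by metis
    let ?K = "{x + y | x y. x \<in> A \<and> y \<in> cball 0 (d / 2)}"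
    have "\<phi> \<in> test_functions \<Omega>"
    proof (rule test_functionsI[OF \<phi>(1)])
      show "compact ?K" using compact_sums[OF cA compact_cball] .
      show "?K \<subseteq> \<Omega>"
      proof clarify
        fix x y :: 'a assume "x \<in> A" "y \<in> cball 0 (d / 2)"
        then have "dist x (x + y) < d" using d(1) by (simp add: dist_norm)
        then show "x + y \<in> \<Omega>" using d(2)[OF \<open>x \<in> A\<close>, of "x + y"] by fastforce
      qed
      fix x assume x: "x \<notin> ?K"
      show "\<phi> x = 0"
      proof (rule ccontr)
        assume "\<phi> x \<noteq> 0"
        then obtain y where y: "dist x y \<le> ?\<delta>" "v' y \<noteq> 0" using \<phi>(4) by blast
        have "y \<in> A" using y(2) by (auto simp: A_def v'_def max_def min_def split: if_splits)
        moreover have "x - y \<in> cball 0 (d / 2)" using y(1) by (simp add: dist_norm norm_minus_commute)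
        moreover have "x = y + (x - y)" by simp
        ultimately show False using x by blast
      qed
    qed
    moreover have "\<bar>\<phi> x - v x\<bar> \<le> \<eta>" if "x \<in> \<Omega>" for x
      using \<phi>(2)[OF that] v'v[of x] \<epsilon>(2) by linarith
    ultimately show ?thesis using lipschitz_grad_le[OF \<phi>(1,3) \<Omega>(1)] by blast
  qed
  show thesis
  proof (rule approx_by_midpoint_convex_class[where T = "test_functions \<Omega>" and v = v and L = L and \<Omega> = \<Omega>])
    show "(\<lambda>x. 1/2 * \<phi> x + 1/2 * \<psi> x) \<in> test_functions \<Omega>"
      if "\<phi> \<in> test_functions \<Omega>" "\<psi> \<in> test_functions \<Omega>" for \<phi> \<psi> :: "'a \<Rightarrow> real"
      by (rule test_functions_lincomb[OF that])
    show "smooth \<phi>" if "\<phi> \<in> test_functions \<Omega>" for \<phi> :: "'a \<Rightarrow> real" using that by (simp add: test_functions_def)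
  qed (fact \<Omega> L ex that)+
qed

subsection \<open>Translations\<close>

lemma nn_integral_lborel_translate:
  fixes f :: "'a::euclidean_space \<Rightarrow> ennreal"
  assumes [measurable]: "f \<in> borel_measurable borel"
  shows "(\<integral>\<^sup>+x. f (x + c) \<partial>lborel) = (\<integral>\<^sup>+x. f x \<partial>lborel)"
proof -
  have "(\<integral>\<^sup>+x. f x \<partial>lborel) = (\<integral>\<^sup>+x. f x \<partial>distr lborel borel ((+) c))"
    by (simp only: lborel_distr_plus)
  also have "\<dots> = (\<integral>\<^sup>+x. f (c + x) \<partial>lborel)" by (rule nn_integral_distr) auto
  finally show ?thesis by (simp add: add.commute)
qed

text \<open>Truncation at level \<open>M\<close> is built into \<open>ennreal\<close>, which sends negative numbers to 0.\<close>

lemma translation_inequality: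
  fixes \<phi> :: "'a::euclidean_space \<Rightarrow> real"
  assumes \<phi>: "smooth \<phi>" and M: "M \<ge> 0"
  shows "(\<integral>\<^sup>+x. ennreal (\<bar>\<phi> (x + h) - \<phi> x\<bar> - M * norm h) \<partial>lborel)
    \<le> ennreal (norm h) * (\<integral>\<^sup>+x. ennreal (norm (grad \<phi> x) - M) \<partial>lborel)"
proof -
  let ?q = "\<lambda>x. max 0 (norm (grad \<phi> x) - M)"
  have cg: "continuous_on A (grad \<phi>)" for A by (rule smooth_grad_continuous_on[OF \<phi>])
  have q[measurable]: "?q \<in> borel_measurable borel"
    by (intro borel_measurable_continuous_onI continuous_intros cg)
  have eq: "ennreal (norm (grad \<phi> x) - M) = ennreal (?q x)" for x
    by (cases "norm (grad \<phi> x) \<le> M") (auto simp: max_def ennreal_neg)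
  \<comment> \<open>The increment is the integral of the derivative along the segment from
    \<open>x\<close> to \<open>x + h\<close>. Splitting the norm of the gradient into at most
    \<open>M\<close> plus its excess over \<open>M\<close> leaves only the excess on the
    right.\<close>
  have pt: "ennreal (\<bar>\<phi> (x + h) - \<phi> x\<bar> - M * norm h) \<le>
      (\<integral>\<^sup>+t. ennreal (norm h) * (indicator {0..1::real} t * ennreal (?q (x + t *\<^sub>R h))) \<partial>lborel)" for x
  proof -
    have cqt: "continuous_on {0..1} (\<lambda>t. ?q (x + t *\<^sub>R h))"
      by (intro continuous_intros continuous_on_compose2[OF cg[of UNIV]]) auto
    have "((\<lambda>t. grad \<phi> (x + t *\<^sub>R h) \<bullet> h) has_integral \<phi> (x + 1 *\<^sub>R h) - \<phi> (x + 0 *\<^sub>R h)) {0..1}"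
    proof (rule fundamental_theorem_of_calculus)
      fix t :: real
      have "((\<lambda>t. \<phi> (x + t *\<^sub>R h)) has_derivative (\<lambda>s. grad \<phi> (x + t *\<^sub>R h) \<bullet> (s *\<^sub>R h))) (at t within {0..1})"
        by (rule has_derivative_compose[OF _ smooth_has_derivative[OF \<phi>]]) (auto intro!: derivative_eq_intros)
      then show "((\<lambda>t. \<phi> (x + t *\<^sub>R h)) has_vector_derivative grad \<phi> (x + t *\<^sub>R h) \<bullet> h) (at t within {0..1})"
        by (simp add: has_vector_derivative_def)
    qed simp
    then have i: "integral {0..1} (\<lambda>t. grad \<phi> (x + t *\<^sub>R h) \<bullet> h) = \<phi> (x + h) - \<phi> x"
        "(\<lambda>t. grad \<phi> (x + t *\<^sub>R h) \<bullet> h) integrable_on {0..1}"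
      by (auto simp: integral_unique integrable_on_def)
    have iq: "(\<lambda>t. ?q (x + t *\<^sub>R h)) integrable_on {0..1}" using cqt by (rule integrable_continuous_real)
    have "norm (integral {0..1} (\<lambda>t. grad \<phi> (x + t *\<^sub>R h) \<bullet> h)) \<le>
        integral {0..1} (\<lambda>t. M * norm h + norm h * ?q (x + t *\<^sub>R h))"
    proof (rule integral_norm_bound_integral[OF i(2)])
      show "(\<lambda>t. M * norm h + norm h * ?q (x + t *\<^sub>R h)) integrable_on {0..1}"
        using iq by (intro integrable_add integrable_on_mult_right) auto
      fix t :: real
      have "\<bar>grad \<phi> (x + t *\<^sub>R h) \<bullet> h\<bar> \<le> norm (grad \<phi> (x + t *\<^sub>R h)) * norm h" by (rule Cauchy_Schwarz_ineq2)
      also have "\<dots> \<le> (M + ?q (x + t *\<^sub>R h)) * norm h" by (intro mult_right_mono) auto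
      finally show "norm (grad \<phi> (x + t *\<^sub>R h) \<bullet> h) \<le> M * norm h + norm h * ?q (x + t *\<^sub>R h)"
        by (simp add: algebra_simps)
    qed
    also have "\<dots> = M * norm h + norm h * integral {0..1} (\<lambda>t. ?q (x + t *\<^sub>R h))"
      using iq by (subst integral_add) (auto intro: integrable_on_mult_right)
    finally have "\<bar>\<phi> (x + h) - \<phi> x\<bar> - M * norm h \<le> norm h * integral {0..1} (\<lambda>t. ?q (x + t *\<^sub>R h))"
      unfolding i(1) by simp
    then have "ennreal (\<bar>\<phi> (x + h) - \<phi> x\<bar> - M * norm h) \<le>
        ennreal (norm h) * ennreal (integral {0..1} (\<lambda>t. ?q (x + t *\<^sub>R h)))"
      by (simp add: ennreal_mult'[symmetric] ennreal_leI)
    also have "ennreal (integral {0..1} (\<lambda>t. ?q (x + t *\<^sub>R h))) =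
        (\<integral>\<^sup>+t. indicator {0..1::real} t * ennreal (?q (x + t *\<^sub>R h)) \<partial>lborel)"
      using nn_integral_has_integral_lebesgue'[OF _ integrable_integral[OF iq]]
      by (simp add: nn_integral_completion mult.commute)
    also have "ennreal (norm h) * \<dots> =
      (\<integral>\<^sup>+t. ennreal (norm h) * (indicator {0..1::real} t * ennreal (?q (x + t *\<^sub>R h))) \<partial>lborel)"
      by (rule nn_integral_cmult[symmetric]) measurable
    finally show ?thesis .
  qed
  have "(\<integral>\<^sup>+x. ennreal (\<bar>\<phi> (x + h) - \<phi> x\<bar> - M * norm h) \<partial>lborel) \<le>
    (\<integral>\<^sup>+x. \<integral>\<^sup>+t. ennreal (norm h) * (indicator {0..1::real} t * ennreal (?q (x + t *\<^sub>R h))) \<partial>lborel \<partial>lborel)"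
    by (intro nn_integral_mono pt)
  \<comment> \<open>After exchanging the integrals, each shift by \<open>t *\<^sub>R h\<close>
    leaves the inner integral unchanged, and the interval of parameters has length 1.\<close>
  also have "\<dots> =
    (\<integral>\<^sup>+t. \<integral>\<^sup>+x. ennreal (norm h) * (indicator {0..1::real} t * ennreal (?q (x + t *\<^sub>R h))) \<partial>lborel \<partial>lborel)"
    by (rule lborel_pair.Fubini'[symmetric]) measurable
  also have "\<dots> = (\<integral>\<^sup>+t. (ennreal (norm h) * indicator {0..1::real} t) * (\<integral>\<^sup>+x. ennreal (?q (x + t *\<^sub>R h)) \<partial>lborel) \<partial>lborel)"
    by (intro nn_integral_cong) (subst nn_integral_cmult[symmetric]; simp add: mult.assoc)
  also have "\<dots> = (\<integral>\<^sup>+t. (ennreal (norm h) * indicator {0..1::real} t) * (\<integral>\<^sup>+x. ennreal (?q x) \<partial>lborel) \<partial>lborel)"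
    by (subst nn_integral_lborel_translate) auto
  also have "\<dots> = (\<integral>\<^sup>+t. (ennreal (norm h) * (\<integral>\<^sup>+x. ennreal (?q x) \<partial>lborel)) * indicator {0..1::real} t \<partial>lborel)"
    by (intro nn_integral_cong) (simp add: mult_ac)
  also have "\<dots> = ennreal (norm h) * (\<integral>\<^sup>+x. ennreal (?q x) \<partial>lborel)"
    by (subst nn_integral_cmult_indicator) auto
  finally show ?thesis unfolding eq .
qed

lemma nn_integral_lebesgue_on_supported:
  assumes "\<Omega> \<in> sets lebesgue" "f \<in> borel_measurable borel" "\<And>x. x \<notin> \<Omega> \<Longrightarrow> f x = 0"
  shows "(\<integral>\<^sup>+x. f x \<partial>lborel) = (\<integral>\<^sup>+x. f x \<partial>lebesgue_on \<Omega>)"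
proof -
  have "(\<integral>\<^sup>+x. f x \<partial>lborel) = (\<integral>\<^sup>+x. f x \<partial>lebesgue)" by (simp add: nn_integral_completion)
  also have "\<dots> = (\<integral>\<^sup>+x. f x * indicator \<Omega> x \<partial>lebesgue)"
    using assms(3) by (intro nn_integral_cong) (auto simp: indicator_def)
  also have "\<dots> = (\<integral>\<^sup>+x. f x \<partial>lebesgue_on \<Omega>)"
    using assms(1) by (simp add: nn_integral_restrict_space)
  finally show ?thesis .
qed

text \<open>Translate by a vector longer than the diameter of the domain.\<close>

lemma poincare_test_functions:
  fixes \<phi> :: "'a::euclidean_space \<Rightarrow> real"
  assumes \<Omega>: "open \<Omega>" "\<And>x. x \<in> \<Omega> \<Longrightarrow> norm x \<le> R" and R: "R > 0" and \<phi>: "\<phi> \<in> test_functions \<Omega>"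
  shows "(LINT x|lebesgue_on \<Omega>. \<bar>\<phi> x\<bar>) \<le> 3 * R * (LINT x|lebesgue_on \<Omega>. norm (grad \<phi> x))"
proof -
  have b\<Omega>: "bounded \<Omega>" using \<Omega>(2) bounded_iff by blast
  have s\<Omega>: "\<Omega> \<in> sets lebesgue" using \<Omega>(1) by (simp add: borel_open lmeasurable_open)
  obtain K where K: "smooth \<phi>" "compact K" "K \<subseteq> \<Omega>" "\<And>x. x \<notin> K \<Longrightarrow> \<phi> x = 0" "\<And>x. x \<notin> K \<Longrightarrow> grad \<phi> x = 0"
    by (rule test_functionsE[OF \<phi>]) (rule that; simp)
  have off: "\<phi> x = 0" "grad \<phi> x = 0" if "x \<notin> \<Omega>" for x using K that by auto
  have c\<phi>: "continuous_on UNIV \<phi>" and cg: "continuous_on UNIV (grad \<phi>)"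
    by (rule smooth_continuous_on[OF K(1)], rule smooth_grad_continuous_on[OF K(1)])
  have m\<phi>: "(\<lambda>x. ennreal \<bar>\<phi> x\<bar>) \<in> borel_measurable borel" "(\<lambda>x. ennreal (norm (grad \<phi> x))) \<in> borel_measurable borel"
    using borel_measurable_continuous_onI[OF c\<phi>] borel_measurable_continuous_onI[OF cg] by measurable
  have int: "integrable lborel (\<lambda>x. \<bar>\<phi> x\<bar>)" "integrable lborel (\<lambda>x. norm (grad \<phi> x))"
    using off by (auto intro!: integrable_continuous_bounded_support[OF _ b\<Omega>] continuous_intros c\<phi> cg)
  have intE: "integrable (lebesgue_on \<Omega>) (\<lambda>x. \<bar>\<phi> x\<bar>)" "integrable (lebesgue_on \<Omega>) (\<lambda>x. norm (grad \<phi> x))"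
    using off int borel_measurable_continuous_onI[OF c\<phi>] borel_measurable_continuous_onI[OF cg]
    by (auto simp: lebesgue_on_supported(1)[OF s\<Omega>] integrable_completion)
  obtain b :: 'a where b: "norm b = 1" using vector_choose_size[of 1] by auto
  \<comment> \<open>Length 2R would only give norm at least R for the shifted point, which does not
    exclude the domain; with 3R its norm is at least 2R.\<close>
  let ?h = "(3 * R) *\<^sub>R b"
  have h: "norm ?h = 3 * R" using b R by simp
  have "(\<integral>\<^sup>+x. ennreal \<bar>\<phi> x\<bar> \<partial>lborel) \<le> (\<integral>\<^sup>+x. ennreal (\<bar>\<phi> (x + ?h) - \<phi> x\<bar> - 0 * norm ?h) \<partial>lborel)"
  proof (intro nn_integral_mono ennreal_leI)
    fix x
    show "\<bar>\<phi> x\<bar> \<le> \<bar>\<phi> (x + ?h) - \<phi> x\<bar> - 0 * norm ?h"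
    proof (cases "x \<in> \<Omega>")
      case True
      have "norm ?h \<le> norm (x + ?h) + norm x" by (metis add_diff_cancel_left' norm_triangle_ineq4)
      then have "\<not> norm (x + ?h) \<le> R" using \<Omega>(2)[OF True] h R by linarith
      then have "\<phi> (x + ?h) = 0" using off(1) \<Omega>(2) by blast
      then show ?thesis by simp
    qed (use off in simp)
  qed
  also have "\<dots> \<le> ennreal (norm ?h) * (\<integral>\<^sup>+x. ennreal (norm (grad \<phi> x) - 0) \<partial>lborel)"
    by (rule translation_inequality[OF K(1)]) simp
  finally have "(\<integral>\<^sup>+x. ennreal \<bar>\<phi> x\<bar> \<partial>lebesgue_on \<Omega>) \<le> ennreal (3 * R) * (\<integral>\<^sup>+x. ennreal (norm (grad \<phi> x)) \<partial>lebesgue_on \<Omega>)"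
    unfolding h using off by (simp add: nn_integral_lebesgue_on_supported[OF s\<Omega> m\<phi>(1)] nn_integral_lebesgue_on_supported[OF s\<Omega> m\<phi>(2)])
  then show ?thesis
    using R by (simp add: nn_integral_eq_integral[OF intE(1)] nn_integral_eq_integral[OF intE(2)] ennreal_mult'[symmetric])
qed

text \<open>Both sides pass to the limit along the test function approximation: the values converge
  uniformly on the domain, the gradients a.e. under the bound \<open>L\<close>.\<close>

lemma poincare_lipschitz:
  fixes v :: "'a::euclidean_space \<Rightarrow> real"
  assumes \<Omega>: "open \<Omega>" "\<And>x. x \<in> \<Omega> \<Longrightarrow> norm x \<le> R" and R: "R > 0"
    and v: "L-lipschitz_on UNIV v" "\<And>x. x \<notin> \<Omega> \<Longrightarrow> v x = 0"
  shows "(LINT x|lebesgue_on \<Omega>. \<bar>v x\<bar>) \<le> 3 * R * (LINT x|lebesgue_on \<Omega>. norm (wgrad \<Omega> v x))"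
proof -
  let ?E = "lebesgue_on \<Omega>"
  have b\<Omega>: "bounded \<Omega>" using \<Omega>(2) bounded_iff by blast
  have s\<Omega>: "\<Omega> \<in> sets lebesgue" using \<Omega>(1) by (simp add: borel_open lmeasurable_open)
  have inE: "AE x in ?E. x \<in> \<Omega>" using s\<Omega> by (simp add: AE_restrict_space_iff)
  show ?thesis
  proof (rule lipschitz_test_approx[OF \<Omega>(1) b\<Omega> v(1)])
    show "v x = 0" if "x \<notin> \<Omega>" for x using that by (rule v(2))
    fix \<phi> w assume \<phi>: "\<And>n. \<phi> n \<in> test_functions \<Omega>" "\<And>n x. x \<in> \<Omega> \<Longrightarrow> \<bar>\<phi> n x - v x\<bar> \<le> 1 / real (Suc n)"
      "\<And>n x. x \<in> \<Omega> \<Longrightarrow> norm (grad (\<phi> n) x) \<le> L"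
      and w: "w \<in> borel_measurable ?E" "\<And>x. norm (w x) \<le> L"
      "AE x in ?E. (\<lambda>n. grad (\<phi> n) x) \<longlonglongrightarrow> w x" "has_weak_gradient \<Omega> v w"
    have sm: "smooth (\<phi> n)" for n using \<phi>(1) by (simp add: test_functions_def)
    have cv: "continuous_on UNIV v" by (rule lipschitz_on_continuous_on[OF v(1)])
    have iv: "integrable ?E (\<lambda>x. \<bar>v x\<bar>)"
    proof -
      have "integrable lborel (\<lambda>x. \<bar>v x\<bar>)"
        using v(2) by (intro integrable_continuous_bounded_support[OF _ b\<Omega>] continuous_intros cv) auto
      then have "integrable lebesgue (\<lambda>x. \<bar>v x\<bar>)"
        using integrable_completion borel_measurable_integrable by blast
      then show ?thesis using v(2) by (subst lebesgue_on_supported(1)[OF s\<Omega>]) auto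
    qed
    interpret finite_measure ?E by (rule finite_measure_lebesgue_on_open[OF \<Omega>(1) b\<Omega>])
    have "(\<lambda>n. LINT x|?E. \<bar>\<phi> n x\<bar>) \<longlonglongrightarrow> (LINT x|?E. \<bar>v x\<bar>)"
    proof (rule integral_dominated_convergence[where w = "\<lambda>x. \<bar>v x\<bar> + 1"])
      show "integrable ?E (\<lambda>x. \<bar>v x\<bar> + 1)" using iv by simp
      show "(\<lambda>x. \<bar>v x\<bar>) \<in> borel_measurable ?E" using iv by auto
      show "(\<lambda>x. \<bar>\<phi> n x\<bar>) \<in> borel_measurable ?E" for n
        by (intro continuous_measurable_lebesgue_on continuous_intros smooth_continuous_on sm)
      show "AE x in ?E. (\<lambda>n. \<bar>\<phi> n x\<bar>) \<longlonglongrightarrow> \<bar>v x\<bar>" using inE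
      proof eventually_elim
        case (elim x)
        have "(\<lambda>n. \<phi> n x - v x) \<longlonglongrightarrow> 0"
        proof (rule tendsto_rabs_zero_cancel, rule tendsto_sandwich[OF _ _ tendsto_const])
          show "(\<lambda>n. 1 / real (Suc n)) \<longlonglongrightarrow> 0" using LIMSEQ_inverse_real_of_nat by (simp add: inverse_eq_divide)
        qed (use \<phi>(2)[OF elim] in auto)
        then show ?case by (intro tendsto_rabs) (simp add: LIM_zero_iff)
      qed
      show "AE x in ?E. norm \<bar>\<phi> n x\<bar> \<le> \<bar>v x\<bar> + 1" for n using inE
      proof eventually_elim
        case (elim x)
        have "1 / real (Suc n) \<le> 1" by simp
        then show ?case using \<phi>(2)[OF elim, of n] unfolding real_norm_def by linarith
      qed
    qed
    moreover have "(\<lambda>n. LINT x|?E. norm (grad (\<phi> n) x)) \<longlonglongrightarrow> (LINT x|?E. norm (w x))"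
    proof (rule integral_dominated_convergence[where w = "\<lambda>x. L"])
      show "(\<lambda>x. norm (w x)) \<in> borel_measurable ?E" using w(1) by measurable
      show "(\<lambda>x. norm (grad (\<phi> n) x)) \<in> borel_measurable ?E" for n
        by (intro continuous_measurable_lebesgue_on continuous_intros smooth_grad_continuous_on sm)
      show "AE x in ?E. (\<lambda>n. norm (grad (\<phi> n) x)) \<longlonglongrightarrow> norm (w x)"
        using w(3) by eventually_elim (rule tendsto_norm)
      show "AE x in ?E. norm (norm (grad (\<phi> n) x)) \<le> L" for n using inE by eventually_elim (simp add: \<phi>(3))
    qed simp
    ultimately have "(LINT x|?E. \<bar>v x\<bar>) \<le> 3 * R * (LINT x|?E. norm (w x))"
      by (intro tendsto_le[OF _ tendsto_mult_left]) (use poincare_test_functions[OF \<Omega> R \<phi>(1)] in auto)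
    also have "(LINT x|?E. norm (w x)) = (LINT x|?E. norm (wgrad \<Omega> v x))"
      by (rule lebesgue_on_cong_AE(3)[OF s\<Omega>]) (use wgrad_unique[OF \<Omega>(1) w(4)] in \<open>eventually_elim, simp\<close>)
    finally show ?thesis .
  qed
qed

subsection \<open>Sobolev functions with bounded gradient\<close>

lemma power_add_le_2_power: "(s + t) ^ n \<le> 2 ^ n * (s ^ n + t ^ n)" if "s \<ge> 0" "t \<ge> 0" for s t :: real
proof -
  have "(s + t) ^ n \<le> (2 * max s t) ^ n" using that by (intro power_mono) auto
  also have "\<dots> = 2 ^ n * max s t ^ n" by (rule power_mult_distrib)
  also have "max s t ^ n \<le> s ^ n + t ^ n" using that by (auto simp: max_def)
  finally show ?thesis by simp
qed

lemma Lp_space_diff: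
  fixes f g :: "'a::euclidean_space \<Rightarrow> 'b::euclidean_space"
  assumes f: "f \<in> Lp_space \<Omega> n" and g: "g \<in> Lp_space \<Omega> n"
  shows "(\<lambda>x. f x - g x) \<in> Lp_space \<Omega> n"
proof -
  have m[measurable]: "f \<in> borel_measurable (lebesgue_on \<Omega>)" "g \<in> borel_measurable (lebesgue_on \<Omega>)"
    using f g by (auto simp: Lp_space_def)
  have i: "integrable (lebesgue_on \<Omega>) (\<lambda>x. norm (f x) ^ n)" "integrable (lebesgue_on \<Omega>) (\<lambda>x. norm (g x) ^ n)"
    using f g by (auto simp: Lp_space_def)
  have "integrable (lebesgue_on \<Omega>) (\<lambda>x. norm (f x - g x) ^ n)"
  proof (rule Bochner_Integration.integrable_bound)
    show "integrable (lebesgue_on \<Omega>) (\<lambda>x. 2 ^ n * (norm (f x) ^ n + norm (g x) ^ n))" using i by simp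
    show "AE x in lebesgue_on \<Omega>. norm (norm (f x - g x) ^ n) \<le> norm (2 ^ n * (norm (f x) ^ n + norm (g x) ^ n))"
    proof (rule AE_I2)
      fix x
      have "norm (f x - g x) ^ n \<le> (norm (f x) + norm (g x)) ^ n"
        by (intro power_mono norm_triangle_ineq4) simp
      also have "\<dots> \<le> 2 ^ n * (norm (f x) ^ n + norm (g x) ^ n)" by (rule power_add_le_2_power) auto
      finally show "norm (norm (f x - g x) ^ n) \<le> norm (2 ^ n * (norm (f x) ^ n + norm (g x) ^ n))" by simp
    qed
  qed measurable
  with m show ?thesis by (auto simp: Lp_space_def)
qed

lemma bounded_in_Lp_space:
  fixes f :: "'a::euclidean_space \<Rightarrow> 'b::euclidean_space"
  assumes "open \<Omega>" "bounded \<Omega>" and m[measurable]: "f \<in> borel_measurable (lebesgue_on \<Omega>)"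
    and b: "AE x in lebesgue_on \<Omega>. norm (f x) \<le> B"
  shows "f \<in> Lp_space \<Omega> n"
proof -
  have "integrable (lebesgue_on \<Omega>) (\<lambda>x. norm (f x) ^ n)"
  proof (rule integrable_bounded_on[OF assms(1,2)])
    show "AE x in lebesgue_on \<Omega>. norm (norm (f x) ^ n) \<le> B ^ n"
      using b by eventually_elim (simp add: power_mono)
  qed measurable
  with m show ?thesis by (auto simp: Lp_space_def)
qed

text \<open>The pointwise inequality t \<le> \<epsilon> + t^n / \<epsilon>^(n-1) takes the place of
  the Hoelder inequality on a finite measure space.\<close>

lemma Lp_tendsto_imp_L1_tendsto:
  fixes f :: "nat \<Rightarrow> 'a::euclidean_space \<Rightarrow> real"
  assumes \<Omega>: "open \<Omega>" "bounded \<Omega>" and n: "n \<ge> 1"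
    and m[measurable]: "\<And>k. f k \<in> borel_measurable (lebesgue_on \<Omega>)" and nn: "\<And>k x. f k x \<ge> 0"
    and i: "\<And>k. integrable (lebesgue_on \<Omega>) (\<lambda>x. f k x ^ n)"
    and lim: "(\<lambda>k. LINT x|lebesgue_on \<Omega>. f k x ^ n) \<longlonglongrightarrow> 0"
  shows "integrable (lebesgue_on \<Omega>) (f k)" "(\<lambda>k. LINT x|lebesgue_on \<Omega>. f k x) \<longlonglongrightarrow> 0"
proof -
  let ?E = "lebesgue_on \<Omega>"
  interpret finite_measure ?E by (rule finite_measure_lebesgue_on_open[OF \<Omega>])
  have le: "t \<le> \<epsilon> + t ^ n / \<epsilon> ^ (n - 1)" if "t \<ge> 0" "\<epsilon> > 0" for t \<epsilon> :: real
  proof (cases "t \<le> \<epsilon>")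
    case False
    then have "\<epsilon> ^ (n - 1) \<le> t ^ (n - 1)" using that by (intro power_mono) auto
    then have "t * \<epsilon> ^ (n - 1) \<le> t * t ^ (n - 1)" using that by (intro mult_left_mono) auto
    also have "\<dots> = t ^ n" using n by (cases n) auto
    finally have "t \<le> t ^ n / \<epsilon> ^ (n - 1)" using that by (simp add: pos_le_divide_eq)
    then show ?thesis using that by simp
  qed (use that in \<open>simp add: add_increasing2\<close>)
  show int: "integrable ?E (f k)" for k
  proof (rule Bochner_Integration.integrable_bound)
    show "integrable ?E (\<lambda>x. 1 + f k x ^ n)" using i by simp
    show "AE x in ?E. norm (f k x) \<le> norm (1 + f k x ^ n)"
    proof (rule AE_I2)
      fix x show "norm (f k x) \<le> norm (1 + f k x ^ n)" using le[of "f k x" 1] nn[of k x] by simp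
    qed
  qed measurable
  let ?m = "measure ?E (space ?E)"
  show "(\<lambda>k. LINT x|?E. f k x) \<longlonglongrightarrow> 0"
  proof (rule LIMSEQ_I)
    fix r :: real assume r: "r > 0"
    \<comment> \<open>Chosen so that the constant part contributes \<epsilon> times the measure and
      the power part at most one further \<epsilon>, together less than \<open>r\<close>.\<close>
    define \<epsilon> where "\<epsilon> = r / (2 * (?m + 1))"
    have \<epsilon>: "\<epsilon> > 0" "\<epsilon> * ?m + \<epsilon> < r"
    proof -
      have "2 * (?m + 1) > 0" by (intro mult_pos_pos add_nonneg_pos measure_nonneg) auto
      then have "2 * (?m + 1) \<noteq> 0" by linarith
      then have "\<epsilon> * (2 * (?m + 1)) = r" unfolding \<epsilon>_def by (rule nonzero_eq_divide_eq[THEN iffD1, OF _ refl])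
      moreover show "\<epsilon> > 0" unfolding \<epsilon>_def using r \<open>2 * (?m + 1) > 0\<close> by (rule divide_pos_pos)
      ultimately show "\<epsilon> * ?m + \<epsilon> < r" using r by (simp add: algebra_simps)
    qed
    from LIMSEQ_D[OF lim, of "\<epsilon> ^ n"] \<epsilon>(1) obtain k0 where
      k0: "\<And>k. k \<ge> k0 \<Longrightarrow> \<bar>LINT x|?E. f k x ^ n\<bar> < \<epsilon> ^ n" by auto
    have "norm ((LINT x|?E. f k x) - 0) < r" if "k \<ge> k0" for k
    proof -
      have "(LINT x|?E. f k x) \<le> (LINT x|?E. \<epsilon> + f k x ^ n / \<epsilon> ^ (n - 1))"
        using int i le nn \<epsilon>(1) by (intro integral_mono) auto
      also have "\<dots> = \<epsilon> * ?m + (LINT x|?E. f k x ^ n) / \<epsilon> ^ (n - 1)" using i by simp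
      also have "\<dots> \<le> \<epsilon> * ?m + \<epsilon> ^ n / \<epsilon> ^ (n - 1)"
        using k0[OF that] \<epsilon>(1) by (intro add_left_mono divide_right_mono) auto
      also have "\<epsilon> ^ n / \<epsilon> ^ (n - 1) = \<epsilon>" using n \<epsilon>(1) by (cases n) auto
      finally show ?thesis using \<epsilon>(2) nn by (simp add: Bochner_Integration.integral_nonneg)
    qed
    then show "\<exists>k0. \<forall>k\<ge>k0. norm ((LINT x|?E. f k x) - 0) < r" by blast
  qed
qed

text \<open>Unfolds the Sobolev norm into its two power integrals and weakens both to L1, the
  setting in which the translation inequality is stated.\<close>

lemma W1_0_L1_approx:
  fixes v :: "'a::euclidean_space \<Rightarrow> real"
  assumes \<Omega>: "open \<Omega>" "bounded \<Omega>" and n: "n \<ge> 1" and v: "v \<in> W1_0 \<Omega> n"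
  shows "\<exists>\<phi>. (\<forall>k. \<phi> k \<in> test_functions \<Omega>) \<and>
    (\<forall>k. integrable (lebesgue_on \<Omega>) (\<lambda>x. \<bar>\<phi> k x - v x\<bar>)) \<and>
    (\<forall>k. integrable (lebesgue_on \<Omega>) (\<lambda>x. norm (grad (\<phi> k) x - wgrad \<Omega> v x))) \<and>
    (\<lambda>k. LINT x|lebesgue_on \<Omega>. \<bar>\<phi> k x - v x\<bar>) \<longlonglongrightarrow> 0 \<and>
    (\<lambda>k. LINT x|lebesgue_on \<Omega>. norm (grad (\<phi> k) x - wgrad \<Omega> v x)) \<longlonglongrightarrow> 0"
proof -
  let ?E = "lebesgue_on \<Omega>"
  have s\<Omega>: "\<Omega> \<in> sets lebesgue" using \<Omega>(1) by (simp add: borel_open lmeasurable_open)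
  have inE: "AE x in ?E. x \<in> \<Omega>" using s\<Omega> by (simp add: AE_restrict_space_iff)
  obtain \<phi> where \<phi>: "\<And>k. \<phi> k \<in> test_functions \<Omega>"
      and lim: "(\<lambda>k. W1_norm \<Omega> n (\<lambda>x. \<phi> k x - v x)) \<longlonglongrightarrow> 0"
    using v unfolding W1_0_def by blast
  obtain w where hw: "has_weak_gradient \<Omega> v w" using v unfolding W1_0_def W1_def by blast
  have vL: "v \<in> Lp_space \<Omega> n" "wgrad \<Omega> v \<in> Lp_space \<Omega> n" using v unfolding W1_0_def W1_def by auto
  have sm: "smooth (\<phi> k)" for k using \<phi> by (simp add: test_functions_def)
  have cont_Lp: "f \<in> Lp_space \<Omega> n" if "continuous_on UNIV f" for f :: "'a \<Rightarrow> 'c::euclidean_space"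
  proof -
    have "compact (f ` closure \<Omega>)"
      using \<Omega>(2) that by (intro compact_continuous_image) (auto intro: continuous_on_subset)
    from compact_imp_bounded[OF this] obtain B where B: "\<And>x. x \<in> closure \<Omega> \<Longrightarrow> norm (f x) \<le> B"
      unfolding bounded_iff by blast
    have "AE x in ?E. norm (f x) \<le> B" using inE by eventually_elim (use B closure_subset in blast)
    then show ?thesis by (rule bounded_in_Lp_space[OF \<Omega> continuous_measurable_lebesgue_on[OF that]])
  qed
  have d1: "(\<lambda>x. \<phi> k x - v x) \<in> Lp_space \<Omega> n" for k
    by (intro Lp_space_diff vL cont_Lp smooth_continuous_on sm)
  have d2: "(\<lambda>x. grad (\<phi> k) x - wgrad \<Omega> v x) \<in> Lp_space \<Omega> n" for k
    by (intro Lp_space_diff vL cont_Lp smooth_grad_continuous_on sm)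
  have g: "AE x in ?E. wgrad \<Omega> (\<lambda>x. \<phi> k x - v x) x = grad (\<phi> k) x - wgrad \<Omega> v x" for k
  proof -
    have "has_weak_gradient \<Omega> (\<lambda>x. 1 * \<phi> k x + (-1) * v x) (\<lambda>x. 1 *\<^sub>R grad (\<phi> k) x + (-1) *\<^sub>R wgrad \<Omega> v x)"
      by (rule has_weak_gradient_lincomb[OF \<Omega>(1) smooth_has_weak_gradient[OF \<Omega>(1) sm] has_weak_gradient_wgrad[OF hw]])
    then show ?thesis using wgrad_unique[OF \<Omega>(1)] by simp
  qed
  let ?A = "\<lambda>k. LINT x|?E. \<bar>\<phi> k x - v x\<bar> ^ n" and ?B = "\<lambda>k. LINT x|?E. norm (grad (\<phi> k) x - wgrad \<Omega> v x) ^ n"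
  have "(LINT x|?E. norm (wgrad \<Omega> (\<lambda>x. \<phi> k x - v x) x) ^ n) = ?B k" for k
    by (rule lebesgue_on_cong_AE(3)[OF s\<Omega>]) (use g[of k] in \<open>eventually_elim, simp\<close>)
  then have W: "W1_norm \<Omega> n (\<lambda>x. \<phi> k x - v x) = root n (?A k + ?B k)" for k by (simp add: W1_norm_def)
  have nn: "?A k \<ge> 0" "?B k \<ge> 0" for k by (simp_all add: Bochner_Integration.integral_nonneg)
  have "(\<lambda>k. (root n (?A k + ?B k)) ^ n) \<longlonglongrightarrow> 0 ^ n" using lim unfolding W by (intro tendsto_power)
  then have AB: "(\<lambda>k. ?A k + ?B k) \<longlonglongrightarrow> 0" using n nn by (simp add: zero_power)
  have A: "?A \<longlonglongrightarrow> 0"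
    by (rule tendsto_sandwich[OF _ _ tendsto_const AB]) (use nn in auto)
  have B: "?B \<longlonglongrightarrow> 0"
    by (rule tendsto_sandwich[OF _ _ tendsto_const AB]) (use nn in auto)
  have m1: "(\<lambda>x. \<bar>\<phi> k x - v x\<bar>) \<in> borel_measurable ?E" "integrable ?E (\<lambda>x. \<bar>\<phi> k x - v x\<bar> ^ n)" for k
    using d1[of k] by (auto simp: Lp_space_def)
  have m2: "(\<lambda>x. norm (grad (\<phi> k) x - wgrad \<Omega> v x)) \<in> borel_measurable ?E"
    "integrable ?E (\<lambda>x. norm (grad (\<phi> k) x - wgrad \<Omega> v x) ^ n)" for k
    using d2[of k] by (auto simp: Lp_space_def)
  note l1 = Lp_tendsto_imp_L1_tendsto[OF \<Omega> n m1(1) abs_ge_zero m1(2) A]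
  note l2 = Lp_tendsto_imp_L1_tendsto[OF \<Omega> n m2(1) norm_ge_zero m2(2) B]
  show ?thesis
    by (intro exI[of _ \<phi>] conjI allI \<phi> l1 l2)
qed

text \<open>Fubini turns an estimate for every shift and a.e. point into one for a.e. point
  \<open>x\<close> and a.e. \<open>y\<close>. Any two good points share a partner \<open>y\<close>
  as close to the first as desired, so the Lipschitz estimate holds between all good points.
  McShane's extension then fills in the null set.\<close>

lemma AE_pairs_lipschitz_imp_lipschitz:
  fixes v :: "'a::euclidean_space \<Rightarrow> real"
  assumes [measurable]: "v \<in> borel_measurable borel" and M: "M \<ge> 0"
    and ae: "\<And>h. (\<integral>\<^sup>+x. ennreal (\<bar>v (x + h) - v x\<bar> - M * norm h) \<partial>lborel) = 0"
  obtains V where "M-lipschitz_on UNIV V" "AE x in lborel. V x = v x"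
proof -
  have "(\<integral>\<^sup>+h. \<integral>\<^sup>+x. ennreal (\<bar>v (x + h) - v x\<bar> - M * norm h) \<partial>lborel \<partial>lborel) = 0"
    by (simp add: ae)
  then have "(\<integral>\<^sup>+x. \<integral>\<^sup>+h. ennreal (\<bar>v (x + h) - v x\<bar> - M * norm h) \<partial>lborel \<partial>lborel) = 0"
    by (subst (asm) lborel_pair.Fubini') measurable
  then have "AE x in lborel. (\<integral>\<^sup>+h. ennreal (\<bar>v (x + h) - v x\<bar> - M * norm h) \<partial>lborel) = 0"
    by (subst (asm) nn_integral_0_iff_AE) measurable
  moreover have "(\<integral>\<^sup>+h. ennreal (\<bar>v (x + h) - v x\<bar> - M * norm h) \<partial>lborel) =
      (\<integral>\<^sup>+y. ennreal (\<bar>v y - v x\<bar> - M * norm (y - x)) \<partial>lborel)" for x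
    using nn_integral_lborel_translate[of "\<lambda>y. ennreal (\<bar>v y - v x\<bar> - M * norm (y - x))" x]
    by (simp add: add.commute)
  ultimately have "AE x in lborel. (\<integral>\<^sup>+y. ennreal (\<bar>v y - v x\<bar> - M * norm (y - x)) \<partial>lborel) = 0" by simp
  then have A: "AE x in lborel. AE y in lborel. \<bar>v y - v x\<bar> \<le> M * norm (y - x)"
    by eventually_elim (subst (asm) nn_integral_0_iff_AE; simp add: ennreal_eq_0_iff)
  let ?A = "{x. AE y in lborel. \<bar>v y - v x\<bar> \<le> M * norm (y - x)}"
  have "M-lipschitz_on ?A v"
  proof (rule lipschitz_onI[OF _ M])
    fix x z assume "x \<in> ?A" "z \<in> ?A"
    then have xz: "AE y in lborel. \<bar>v y - v x\<bar> \<le> M * norm (y - x) \<and> \<bar>v y - v z\<bar> \<le> M * norm (y - z)"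
      by (auto intro: AE_conjI)
    have "\<bar>v x - v z\<bar> \<le> M * norm (x - z) + \<epsilon>" if "\<epsilon> > 0" for \<epsilon>
    proof -
      \<comment> \<open>The detour through \<open>y\<close> costs at most twice
        \<open>M * norm (y - x)\<close>, which this radius keeps below \<epsilon>.\<close>
      define r where "r = \<epsilon> / (2 * M + 1)"
      have r: "r > 0" "2 * M * r \<le> \<epsilon>" using that M by (auto simp: r_def field_simps)
      have "\<exists>y\<in>ball x r. \<bar>v y - v x\<bar> \<le> M * norm (y - x) \<and> \<bar>v y - v z\<bar> \<le> M * norm (y - z)"
      proof (rule ccontr)
        assume n: "\<not> ?thesis"
        from xz have "AE y in lborel. y \<notin> ball x r" by eventually_elim (use n in blast)
        then have "ball x r \<in> null_sets lborel" by (subst (asm) AE_iff_null_sets[symmetric]) auto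
        then have "negligible (ball x r)" using negligible_iff_null_sets null_sets_completionI by blast
        then show False using open_not_negligible[of "ball x r"] r(1) by auto
      qed
      then obtain y where y: "norm (y - x) < r" "\<bar>v y - v x\<bar> \<le> M * norm (y - x)" "\<bar>v y - v z\<bar> \<le> M * norm (y - z)"
        by (auto simp: dist_norm norm_minus_commute)
      have "norm (y - z) \<le> norm (y - x) + norm (x - z)" by (metis diff_add_cancel add_diff_eq norm_triangle_ineq)
      then have "M * norm (y - z) \<le> M * norm (y - x) + M * norm (x - z)"
        using mult_left_mono[OF _ M] by (simp only: distrib_left[symmetric])
      moreover have "M * norm (y - x) \<le> M * r" using y(1) M by (intro mult_left_mono) auto
      ultimately show ?thesis using y r(2) by linarith
    qed
    then have "\<bar>v x - v z\<bar> \<le> M * norm (x - z)" by (rule field_le_epsilon)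
    then show "dist (v x) (v z) \<le> M * dist x z" by (simp add: dist_real_def dist_norm)
  qed
  then obtain V where V: "M-lipschitz_on UNIV V" "\<And>x. x \<in> ?A \<Longrightarrow> V x = v x" by (rule lipschitz_extension) blast
  have "AE x in lborel. V x = v x" using A by eventually_elim (use V(2) in blast)
  with V(1) show thesis by (rule that)
qed

text \<open>For test functions converging to \<open>v\<close>, the part of an increment exceeding
  \<open>M * norm h\<close> is controlled in L1 by the part of the gradient exceeding
  \<open>M\<close>, which vanishes in the limit. The limit function, extended by zero, therefore has
  no excess for any shift \<open>h\<close>.\<close>

lemma W1_0_lipschitz_representative:
  fixes v :: "'a::euclidean_space \<Rightarrow> real"
  assumes \<Omega>: "open \<Omega>" "bounded \<Omega>" and n: "n \<ge> 1" and v: "v \<in> W1_0 \<Omega> n" and M: "M \<ge> 0"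
    and bd: "AE x in lebesgue_on \<Omega>. norm (wgrad \<Omega> v x) \<le> M"
  obtains V where "M-lipschitz_on UNIV V" "AE x in lebesgue. V x = (if x \<in> \<Omega> then v x else 0)"
proof -
  let ?E = "lebesgue_on \<Omega>"
  let ?v = "\<lambda>x. if x \<in> \<Omega> then v x else 0"
  have s\<Omega>: "\<Omega> \<in> sets lebesgue" using \<Omega>(1) by (simp add: borel_open lmeasurable_open)
  have inE: "AE x in ?E. x \<in> \<Omega>" using s\<Omega> by (simp add: AE_restrict_space_iff)
  obtain \<phi> where \<phi>: "\<And>k. \<phi> k \<in> test_functions \<Omega>"
    and i1: "\<And>k. integrable ?E (\<lambda>x. \<bar>\<phi> k x - v x\<bar>)"
    and i2: "\<And>k. integrable ?E (\<lambda>x. norm (grad (\<phi> k) x - wgrad \<Omega> v x))"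
    and l1: "(\<lambda>k. LINT x|?E. \<bar>\<phi> k x - v x\<bar>) \<longlonglongrightarrow> 0"
    and l2: "(\<lambda>k. LINT x|?E. norm (grad (\<phi> k) x - wgrad \<Omega> v x)) \<longlonglongrightarrow> 0"
    using W1_0_L1_approx[OF \<Omega> n v] by (elim exE conjE) (rule that; simp)
  have "v \<in> borel_measurable ?E" using v by (auto simp: W1_0_def W1_def Lp_space_def)
  then have "?v \<in> borel_measurable lebesgue" by (simp only: borel_measurable_if[OF s\<Omega>])
  \<comment> \<open>A Borel representative is taken because the function
    \<open>v1 (x + h) - v1 x\<close> must be jointly measurable for Fubini.\<close>
  then obtain v1 where v1[measurable]: "v1 \<in> borel_measurable borel" and v1e: "AE x in lborel. ?v x = v1 x"
    using completion_ex_borel_measurable_real[of ?v lborel] by auto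
  have v1e': "AE x in lebesgue. ?v x = v1 x" using v1e by (rule AE_completion)
  have zero: "(\<integral>\<^sup>+x. ennreal (\<bar>v1 (x + h) - v1 x\<bar> - M * norm h) \<partial>lborel) = 0" for h
  proof -
    let ?I = "\<integral>\<^sup>+x. ennreal (\<bar>v1 (x + h) - v1 x\<bar> - M * norm h) \<partial>lborel"
    have "?I \<le> ennreal (2 * (LINT x|?E. \<bar>\<phi> k x - v x\<bar>) + norm h * (LINT x|?E. norm (grad (\<phi> k) x - wgrad \<Omega> v x)))" for k
    proof -
      obtain K where K: "smooth (\<phi> k)" "compact K" "K \<subseteq> \<Omega>" "\<And>x. x \<notin> K \<Longrightarrow> \<phi> k x = 0" "\<And>x. x \<notin> K \<Longrightarrow> grad (\<phi> k) x = 0"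
        by (rule test_functionsE[OF \<phi>[of k]]) (rule that; simp)
      have off: "\<phi> k x = 0" "grad (\<phi> k) x = 0" if "x \<notin> \<Omega>" for x using K that by auto
      have m[measurable]: "\<phi> k \<in> borel_measurable borel" "grad (\<phi> k) \<in> borel_measurable borel"
        by (intro borel_measurable_continuous_onI smooth_continuous_on smooth_grad_continuous_on K(1))+
      let ?d = "\<lambda>x. ennreal \<bar>\<phi> k x - v1 x\<bar>"
      have dE: "(\<integral>\<^sup>+x. ?d x \<partial>lborel) = ennreal (LINT x|?E. \<bar>\<phi> k x - v x\<bar>)"
      proof -
        have "(\<integral>\<^sup>+x. ?d x \<partial>lborel) = (\<integral>\<^sup>+x. ?d x \<partial>lebesgue)" by (simp add: nn_integral_completion)
        also have "\<dots> = (\<integral>\<^sup>+x. ennreal \<bar>\<phi> k x - v x\<bar> * indicator \<Omega> x \<partial>lebesgue)"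
          using v1e' by (intro nn_integral_cong_AE, eventually_elim) (use off in \<open>auto simp: indicator_def split: if_splits\<close>)
        also have "\<dots> = (\<integral>\<^sup>+x. ennreal \<bar>\<phi> k x - v x\<bar> \<partial>?E)"
          using s\<Omega> by (simp add: nn_integral_restrict_space)
        also have "\<dots> = ennreal (LINT x|?E. \<bar>\<phi> k x - v x\<bar>)" by (rule nn_integral_eq_integral[OF i1]) auto
        finally show ?thesis .
      qed
      \<comment> \<open>As the weak gradient of \<open>v\<close> has norm at most \<open>M\<close>,
        the excess of the approximating gradient is at most its distance to that gradient.\<close>
      have gE: "(\<integral>\<^sup>+x. ennreal (norm (grad (\<phi> k) x) - M) \<partial>lborel) \<le> ennreal (LINT x|?E. norm (grad (\<phi> k) x - wgrad \<Omega> v x))"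
      proof -
        have "(\<integral>\<^sup>+x. ennreal (norm (grad (\<phi> k) x) - M) \<partial>lborel) = (\<integral>\<^sup>+x. ennreal (norm (grad (\<phi> k) x) - M) \<partial>?E)"
          by (rule nn_integral_lebesgue_on_supported[OF s\<Omega>]) (use off M in \<open>auto simp: ennreal_neg\<close>)
        also have "\<dots> \<le> (\<integral>\<^sup>+x. ennreal (norm (grad (\<phi> k) x - wgrad \<Omega> v x)) \<partial>?E)"
        proof (rule nn_integral_mono_AE)
          show "AE x in ?E. ennreal (norm (grad (\<phi> k) x) - M) \<le> ennreal (norm (grad (\<phi> k) x - wgrad \<Omega> v x))"
            using bd
          proof eventually_elim
            case (elim x)
            have "norm (grad (\<phi> k) x) \<le> norm (grad (\<phi> k) x - wgrad \<Omega> v x) + norm (wgrad \<Omega> v x)"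
              by (metis diff_add_cancel norm_triangle_ineq)
            then show ?case using elim by (intro ennreal_leI) linarith
          qed
        qed
        also have "\<dots> = ennreal (LINT x|?E. norm (grad (\<phi> k) x - wgrad \<Omega> v x))"
          by (rule nn_integral_eq_integral[OF i2]) auto
        finally show ?thesis .
      qed
      have "?I \<le> (\<integral>\<^sup>+x. (?d (x + h) + ?d x) + ennreal (\<bar>\<phi> k (x + h) - \<phi> k x\<bar> - M * norm h) \<partial>lborel)"
      proof (rule nn_integral_mono)
        fix x
        have "ennreal (\<bar>v1 (x + h) - v1 x\<bar> - M * norm h) \<le>
          ennreal ((\<bar>\<phi> k (x + h) - v1 (x + h)\<bar> + \<bar>\<phi> k x - v1 x\<bar>) + max 0 (\<bar>\<phi> k (x + h) - \<phi> k x\<bar> - M * norm h))"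
          by (rule ennreal_leI) linarith
        also have "\<dots> = (?d (x + h) + ?d x) + ennreal (max 0 (\<bar>\<phi> k (x + h) - \<phi> k x\<bar> - M * norm h))"
          by (simp add: ennreal_plus)
        also have "ennreal (max 0 (\<bar>\<phi> k (x + h) - \<phi> k x\<bar> - M * norm h)) = ennreal (\<bar>\<phi> k (x + h) - \<phi> k x\<bar> - M * norm h)"
          by (simp add: ennreal_max_0)
        finally show "ennreal (\<bar>v1 (x + h) - v1 x\<bar> - M * norm h) \<le>
          (?d (x + h) + ?d x) + ennreal (\<bar>\<phi> k (x + h) - \<phi> k x\<bar> - M * norm h)" .
      qed
      also have "\<dots> = ((\<integral>\<^sup>+x. ?d (x + h) \<partial>lborel) + (\<integral>\<^sup>+x. ?d x \<partial>lborel)) +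
         (\<integral>\<^sup>+x. ennreal (\<bar>\<phi> k (x + h) - \<phi> k x\<bar> - M * norm h) \<partial>lborel)"
        by (simp add: nn_integral_add)
      also have "(\<integral>\<^sup>+x. ?d (x + h) \<partial>lborel) = (\<integral>\<^sup>+x. ?d x \<partial>lborel)"
        by (rule nn_integral_lborel_translate) measurable
      also have "((\<integral>\<^sup>+x. ?d x \<partial>lborel) + (\<integral>\<^sup>+x. ?d x \<partial>lborel)) +
         (\<integral>\<^sup>+x. ennreal (\<bar>\<phi> k (x + h) - \<phi> k x\<bar> - M * norm h) \<partial>lborel) \<le>
        (ennreal (LINT x|?E. \<bar>\<phi> k x - v x\<bar>) + ennreal (LINT x|?E. \<bar>\<phi> k x - v x\<bar>)) +
          ennreal (norm h) * ennreal (LINT x|?E. norm (grad (\<phi> k) x - wgrad \<Omega> v x))"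
        unfolding dE using translation_inequality[OF K(1) M, of h] gE
        by (intro add_left_mono) (meson mult_left_mono order_trans zero_le)
      also have "\<dots> = ennreal (2 * (LINT x|?E. \<bar>\<phi> k x - v x\<bar>) + norm h * (LINT x|?E. norm (grad (\<phi> k) x - wgrad \<Omega> v x)))"
        by (simp add: ennreal_plus[symmetric] ennreal_mult[symmetric] Bochner_Integration.integral_nonneg del: ennreal_plus)
      finally show ?thesis .
    qed
    moreover have "(\<lambda>k. ennreal (2 * (LINT x|?E. \<bar>\<phi> k x - v x\<bar>) + norm h * (LINT x|?E. norm (grad (\<phi> k) x - wgrad \<Omega> v x))))
        \<longlonglongrightarrow> ennreal (2 * 0 + norm h * 0)"
      by (intro tendsto_ennrealI tendsto_intros l1 l2)
    ultimately have "?I \<le> ennreal (2 * 0 + norm h * 0)" by (intro LIMSEQ_le_const) auto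
    then show ?thesis by simp
  qed
  obtain V where V: "M-lipschitz_on UNIV V" "AE x in lborel. V x = v1 x"
    using AE_pairs_lipschitz_imp_lipschitz[OF v1 M zero] by blast
  have "AE x in lebesgue. V x = ?v x" using AE_completion[OF V(2)] v1e' by eventually_elim simp
  with V(1) show thesis by (rule that)
qed

subsection \<open>Boundary values\<close>

text \<open>If \<open>V\<close> were nonzero at a point off the domain, it would be nonzero nearby,
  and near such a point there is an open set outside the domain, of positive measure. At frontier
  points it is the region below the Lipschitz graph. For a domain with a slit the conclusion fails
  on the slit.\<close>

lemma zero_off_domain:
  fixes V :: "'a::euclidean_space \<Rightarrow> real"
  assumes \<Omega>: "open \<Omega>" "lipschitz_boundary \<Omega>" and V: "continuous_on UNIV V"
    and ae: "AE x in lebesgue. x \<notin> \<Omega> \<longrightarrow> V x = 0" and x0: "x0 \<notin> \<Omega>"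
  shows "V x0 = 0"
proof (rule ccontr)
  assume nz: "V x0 \<noteq> 0"
  have op: "open {x. V x \<noteq> 0}" using V by (intro open_Collect_neq continuous_intros) auto
  have no: "O' = {}" if "open O'" "O' \<subseteq> {x. V x \<noteq> 0}" "O' \<inter> \<Omega> = {}" for O'
  proof (rule ccontr)
    assume "O' \<noteq> {}"
    have "AE x in lebesgue. x \<notin> O'" using ae by eventually_elim (use that in blast)
    then have "O' \<in> null_sets lebesgue"
      using that(1) by (subst AE_iff_null_sets) auto
    then have "negligible O'" by (simp add: negligible_iff_null_sets)
    then show False using open_not_negligible[OF that(1) \<open>O' \<noteq> {}\<close>] by simp
  qed
  show False
  proof (cases "x0 \<in> closure \<Omega>")
    case False
    have "{x. V x \<noteq> 0} \<inter> - closure \<Omega> = {}"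
    proof (rule no)
      show "open ({x. V x \<noteq> 0} \<inter> - closure \<Omega>)" by (intro open_Int op open_Compl closed_closure)
      show "{x. V x \<noteq> 0} \<inter> - closure \<Omega> \<inter> \<Omega> = {}" using closure_subset[of \<Omega>] by blast
    qed blast
    then show False using nz False by blast
  next
    case True
    then have "x0 \<in> frontier \<Omega>" using x0 \<Omega>(1) by (simp add: frontier_def interior_open)
    then obtain r e \<gamma> L where r: "r > 0" and e: "norm e = 1" and \<gamma>: "L-lipschitz_on {y. y \<bullet> e = 0} \<gamma>"
      and gr: "\<And>x. x \<in> ball x0 r \<Longrightarrow> x \<in> \<Omega> \<longleftrightarrow> \<gamma> (x - (x \<bullet> e) *\<^sub>R e) < x \<bullet> e"
      using \<Omega>(2) unfolding lipschitz_boundary_def by blast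
    have ee: "e \<bullet> e = 1" using e by (simp add: norm_eq_1)
    let ?pr = "\<lambda>x. x - (x \<bullet> e) *\<^sub>R e"
    have "continuous_on UNIV (\<lambda>x. \<gamma> (?pr x))"
      by (rule continuous_on_compose2[OF lipschitz_on_continuous_on[OF \<gamma>]])
         (auto intro!: continuous_intros simp: inner_diff_left ee)
    then have "open {x. \<gamma> (?pr x) > x \<bullet> e}" by (intro open_Collect_less continuous_intros)
    then have "open ({x. V x \<noteq> 0} \<inter> ball x0 r \<inter> {x. \<gamma> (?pr x) > x \<bullet> e})"
      by (intro open_Int op open_ball)
    then have "{x. V x \<noteq> 0} \<inter> ball x0 r \<inter> {x. \<gamma> (?pr x) > x \<bullet> e} = {}"
    proof (rule no)
      show "{x. V x \<noteq> 0} \<inter> ball x0 r \<inter> {x. \<gamma> (?pr x) > x \<bullet> e} \<inter> \<Omega> = {}"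
        using gr by (force dest: less_asym)
    qed blast
    moreover have "\<exists>s>0. x0 - s *\<^sub>R e \<in> {x. V x \<noteq> 0} \<inter> ball x0 r"
    proof -
      have "open ({x. V x \<noteq> 0} \<inter> ball x0 r)" using op by auto
      moreover have "x0 \<in> {x. V x \<noteq> 0} \<inter> ball x0 r" using nz r by simp
      ultimately obtain \<delta> where \<delta>: "\<delta> > 0" "ball x0 \<delta> \<subseteq> {x. V x \<noteq> 0} \<inter> ball x0 r"
        using open_contains_ball by meson
      have "x0 - (\<delta> / 2) *\<^sub>R e \<in> ball x0 \<delta>" using \<delta>(1) e by (simp add: dist_norm)
      then have "x0 - (\<delta> / 2) *\<^sub>R e \<in> {x. V x \<noteq> 0} \<inter> ball x0 r" using \<delta>(2) by blast
      moreover have "\<delta> / 2 > 0" using \<delta>(1) by simp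
      ultimately show ?thesis by blast
    qed
    then obtain s where s: "s > 0" "x0 - s *\<^sub>R e \<in> {x. V x \<noteq> 0} \<inter> ball x0 r" by blast
    \<comment> \<open>Moving against \<open>e\<close> does not change the projection, so the point
      drops strictly below the graph.\<close>
    moreover have "x0 - s *\<^sub>R e \<in> {x. \<gamma> (?pr x) > x \<bullet> e}"
    proof -
      have ge: "\<gamma> (?pr x0) \<ge> x0 \<bullet> e" using gr[of x0] x0 r by simp
      have pr: "?pr (x0 - s *\<^sub>R e) = ?pr x0" by (simp add: inner_diff_left ee algebra_simps)
      have "(x0 - s *\<^sub>R e) \<bullet> e = x0 \<bullet> e - s" by (simp add: inner_diff_left ee)
      then show ?thesis using ge s(1) unfolding mem_Collect_eq pr by linarith
    qed
    ultimately show False by blast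
  qed
qed

text \<open>A segment from a point of the domain to a point outside meets the frontier, where
  \<open>v\<close> vanishes, at a distance no larger than its length. Hence the constant does not
  grow, whatever the shape of the domain.\<close>

lemma lipschitz_extend_by_zero:
  fixes v :: "'a::euclidean_space \<Rightarrow> real"
  assumes v: "L-lipschitz_on (closure \<Omega>) v" "\<And>x. x \<in> frontier \<Omega> \<Longrightarrow> v x = 0"
  shows "L-lipschitz_on UNIV (\<lambda>x. if x \<in> \<Omega> then v x else 0)"
proof -
  have L: "L \<ge> 0" using v lipschitz_on_nonneg by blast
  have cross: "\<bar>v x\<bar> \<le> L * dist x y" if "x \<in> \<Omega>" "y \<notin> \<Omega>" for x y
  proof -
    have "closed_segment x y \<inter> frontier \<Omega> \<noteq> {}"
      using that by (intro connected_Int_frontier) auto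
    then obtain z where z: "z \<in> closed_segment x y" "z \<in> frontier \<Omega>" by blast
    have "\<bar>v x - v z\<bar> \<le> L * dist x z"
      using lipschitz_onD[OF v(1), of x z] z(2) that(1) closure_subset[of \<Omega>]
      by (auto simp: frontier_def dist_real_def)
    also have "\<dots> \<le> L * dist x y"
      using L dist_in_closed_segment(1)[OF z(1)] dist_in_closed_segment[OF z(1)]
      by (intro mult_left_mono) (auto simp: dist_commute)
    finally show ?thesis using v(2)[OF z(2)] by simp
  qed
  show ?thesis
  proof (rule lipschitz_onI[OF _ L])
    fix x y
    show "dist (if x \<in> \<Omega> then v x else 0) (if y \<in> \<Omega> then v y else 0) \<le> L * dist x y"
      using cross[of x y] cross[of y x] lipschitz_onD[OF v(1), of x y] closure_subset[of \<Omega>] L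
      by (auto simp: dist_real_def dist_commute)
  qed
qed

subsection \<open>Lipschitz functions as Sobolev functions\<close>

lemma lipschitz_wgrad:
  fixes v :: "'a::euclidean_space \<Rightarrow> real"
  assumes \<Omega>: "open \<Omega>" "bounded \<Omega>" and v: "L-lipschitz_on \<Omega> v"
  shows "has_weak_gradient \<Omega> v (wgrad \<Omega> v)" "wgrad \<Omega> v \<in> borel_measurable (lebesgue_on \<Omega>)"
    "AE x in lebesgue_on \<Omega>. norm (wgrad \<Omega> v x) \<le> L"
proof -
  have s\<Omega>: "\<Omega> \<in> sets lebesgue" using \<Omega>(1) by (simp add: borel_open lmeasurable_open)
  obtain w where w: "w \<in> borel_measurable (lebesgue_on \<Omega>)" "\<And>x. norm (w x) \<le> L" "has_weak_gradient \<Omega> v w"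
    using lipschitz_has_weak_gradient[OF \<Omega> v] by blast
  have ae: "AE x in lebesgue_on \<Omega>. wgrad \<Omega> v x = w x" by (rule wgrad_unique[OF \<Omega>(1) w(3)])
  show "has_weak_gradient \<Omega> v (wgrad \<Omega> v)" using w(3) by (rule has_weak_gradient_wgrad)
  show "wgrad \<Omega> v \<in> borel_measurable (lebesgue_on \<Omega>)" using w(1) lebesgue_on_cong_AE(1)[OF s\<Omega> ae] by simp
  show "AE x in lebesgue_on \<Omega>. norm (wgrad \<Omega> v x) \<le> L" using ae by eventually_elim (simp add: w(2))
qed

lemma lipschitz_measurable_bounded:
  fixes v :: "'a::euclidean_space \<Rightarrow> real"
  assumes \<Omega>: "open \<Omega>" "bounded \<Omega>" and v: "L-lipschitz_on \<Omega> v"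
  obtains B where "v \<in> borel_measurable (lebesgue_on \<Omega>)" "\<And>x. x \<in> \<Omega> \<Longrightarrow> \<bar>v x\<bar> \<le> B"
proof -
  have s\<Omega>: "\<Omega> \<in> sets lebesgue" using \<Omega>(1) by (simp add: borel_open lmeasurable_open)
  have inE: "AE x in lebesgue_on \<Omega>. x \<in> \<Omega>" using s\<Omega> by (simp add: AE_restrict_space_iff)
  obtain v' where v': "L-lipschitz_on UNIV v'" "\<And>x. x \<in> \<Omega> \<Longrightarrow> v' x = v x"
    by (rule lipschitz_extension[OF v]) blast
  have c: "continuous_on UNIV v'" by (rule lipschitz_on_continuous_on[OF v'(1)])
  have "compact (v' ` closure \<Omega>)"
    using \<Omega>(2) by (intro compact_continuous_image continuous_on_subset[OF c]) auto
  from compact_imp_bounded[OF this] obtain B where B: "\<And>x. x \<in> closure \<Omega> \<Longrightarrow> \<bar>v' x\<bar> \<le> B"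
    unfolding bounded_iff by auto
  have "AE x in lebesgue_on \<Omega>. v x = v' x" using inE by eventually_elim (simp add: v'(2))
  then have "v \<in> borel_measurable (lebesgue_on \<Omega>)"
    using lebesgue_on_cong_AE(1)[OF s\<Omega>] continuous_measurable_lebesgue_on[OF c] by blast
  moreover have "\<bar>v x\<bar> \<le> B" if "x \<in> \<Omega>" for x using B[of x] v'(2)[OF that] that closure_subset[of \<Omega>] by auto
  ultimately show thesis by (rule that)
qed

lemma integrable_times_lipschitz:
  fixes v :: "'a::euclidean_space \<Rightarrow> real"
  assumes \<Omega>: "open \<Omega>" "bounded \<Omega>" and f: "integrable (lebesgue_on \<Omega>) f" and v: "L-lipschitz_on \<Omega> v"
  shows "integrable (lebesgue_on \<Omega>) (\<lambda>x. f x * v x)"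
proof (rule lipschitz_measurable_bounded[OF \<Omega> v])
  fix B assume B: "v \<in> borel_measurable (lebesgue_on \<Omega>)" "\<And>x. x \<in> \<Omega> \<Longrightarrow> \<bar>v x\<bar> \<le> B"
  have s\<Omega>: "\<Omega> \<in> sets lebesgue" using \<Omega>(1) by (simp add: borel_open lmeasurable_open)
  have inE: "AE x in lebesgue_on \<Omega>. x \<in> \<Omega>" using s\<Omega> by (simp add: AE_restrict_space_iff)
  show ?thesis
  proof (rule Bochner_Integration.integrable_bound)
    show "integrable (lebesgue_on \<Omega>) (\<lambda>x. f x * B)" using f by simp
    show "(\<lambda>x. f x * v x) \<in> borel_measurable (lebesgue_on \<Omega>)" using f B(1) by measurable
    show "AE x in lebesgue_on \<Omega>. norm (f x * v x) \<le> norm (f x * B)" using inE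
    proof eventually_elim
      case (elim x)
      have "\<bar>v x\<bar> \<le> \<bar>B\<bar>" using B(2)[OF elim] by linarith
      then show ?case by (simp add: abs_mult mult_left_mono)
    qed
  qed
qed

lemma lipschitz_in_W1:
  fixes v :: "'a::euclidean_space \<Rightarrow> real"
  assumes \<Omega>: "open \<Omega>" "bounded \<Omega>" and v: "L-lipschitz_on \<Omega> v"
  shows "v \<in> W1 \<Omega> n"
proof -
  have s\<Omega>: "\<Omega> \<in> sets lebesgue" using \<Omega>(1) by (simp add: borel_open lmeasurable_open)
  have inE: "AE x in lebesgue_on \<Omega>. x \<in> \<Omega>" using s\<Omega> by (simp add: AE_restrict_space_iff)
  obtain B where B: "v \<in> borel_measurable (lebesgue_on \<Omega>)" "\<And>x. x \<in> \<Omega> \<Longrightarrow> \<bar>v x\<bar> \<le> B"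
    by (rule lipschitz_measurable_bounded[OF \<Omega> v]) blast
  have "AE x in lebesgue_on \<Omega>. norm (v x) \<le> B" using inE by eventually_elim (simp add: B(2))
  then have "v \<in> Lp_space \<Omega> n" by (rule bounded_in_Lp_space[OF \<Omega> B(1)])
  moreover have "wgrad \<Omega> v \<in> Lp_space \<Omega> n"
    by (rule bounded_in_Lp_space[OF \<Omega> lipschitz_wgrad(2,3)[OF \<Omega> v]])
  ultimately show ?thesis using lipschitz_wgrad(1)[OF \<Omega> v] by (auto simp: W1_def)
qed

text \<open>One approximating sequence serves every exponent: values and gradients converge a.e.
  under constant bounds on a set of finite measure. The function \<open>v\<close> is compared with
  \<open>V\<close> on the domain only, since values elsewhere carry no meaning.\<close>

lemma lipschitz_in_W1_0:
  fixes v :: "'a::euclidean_space \<Rightarrow> real"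
  assumes \<Omega>: "open \<Omega>" "bounded \<Omega>" and n: "n \<ge> 1"
    and V: "L-lipschitz_on UNIV V" "\<And>x. x \<notin> \<Omega> \<Longrightarrow> V x = 0" and eq: "\<And>x. x \<in> \<Omega> \<Longrightarrow> v x = V x"
  shows "v \<in> W1_0 \<Omega> n"
proof (rule lipschitz_test_approx[OF \<Omega> V(1)])
  show "V x = 0" if "x \<notin> \<Omega>" for x using that by (rule V(2))
  let ?E = "lebesgue_on \<Omega>"
  fix \<phi> w assume \<phi>: "\<And>n. \<phi> n \<in> test_functions \<Omega>" "\<And>n x. x \<in> \<Omega> \<Longrightarrow> \<bar>\<phi> n x - V x\<bar> \<le> 1 / real (Suc n)"
    "\<And>n x. x \<in> \<Omega> \<Longrightarrow> norm (grad (\<phi> n) x) \<le> L"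
    and w: "w \<in> borel_measurable ?E" "\<And>x. norm (w x) \<le> L"
    "AE x in ?E. (\<lambda>n. grad (\<phi> n) x) \<longlonglongrightarrow> w x" "has_weak_gradient \<Omega> V w"
  have s\<Omega>: "\<Omega> \<in> sets lebesgue" using \<Omega>(1) by (simp add: borel_open lmeasurable_open)
  have inE: "AE x in ?E. x \<in> \<Omega>" using s\<Omega> by (simp add: AE_restrict_space_iff)
  interpret finite_measure ?E by (rule finite_measure_lebesgue_on_open[OF \<Omega>])
  have sm: "smooth (\<phi> k)" for k using \<phi>(1) by (simp add: test_functions_def)
  have vV: "AE x in ?E. V x = v x" using inE by eventually_elim (simp add: eq)
  have hw: "has_weak_gradient \<Omega> v w" by (rule has_weak_gradient_cong_AE[OF \<Omega>(1) vV w(4)])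
  have lv: "L-lipschitz_on \<Omega> v"
    using lipschitz_on_subset[OF V(1), of \<Omega>] eq by (auto simp: lipschitz_on_def)
  have v1: "v \<in> W1 \<Omega> n" by (rule lipschitz_in_W1[OF \<Omega> lv])
  then have mv: "v \<in> borel_measurable ?E" by (auto simp: W1_def Lp_space_def)
  have g: "AE x in ?E. wgrad \<Omega> (\<lambda>x. \<phi> k x - v x) x = grad (\<phi> k) x - w x" for k
  proof -
    have "has_weak_gradient \<Omega> (\<lambda>x. 1 * \<phi> k x + (-1) * v x) (\<lambda>x. 1 *\<^sub>R grad (\<phi> k) x + (-1) *\<^sub>R w x)"
      by (rule has_weak_gradient_lincomb[OF \<Omega>(1) smooth_has_weak_gradient[OF \<Omega>(1) sm] hw])
    then show ?thesis using wgrad_unique[OF \<Omega>(1)] by simp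
  qed
  have "(\<lambda>k. LINT x|?E. \<bar>\<phi> k x - v x\<bar> ^ n) \<longlonglongrightarrow> (LINT x|?E. 0)"
  proof (rule integral_dominated_convergence[where w = "\<lambda>x. 1"])
    show "(\<lambda>x. \<bar>\<phi> k x - v x\<bar> ^ n) \<in> borel_measurable ?E" for k
      using mv continuous_measurable_lebesgue_on[OF smooth_continuous_on[OF sm[of k]], of \<Omega>] by measurable
    show "AE x in ?E. (\<lambda>k. \<bar>\<phi> k x - v x\<bar> ^ n) \<longlonglongrightarrow> 0" using inE
    proof eventually_elim
      case (elim x)
      have "(\<lambda>k. \<bar>\<phi> k x - v x\<bar>) \<longlonglongrightarrow> 0"
      proof (rule tendsto_sandwich[OF _ _ tendsto_const])
        show "(\<lambda>n. 1 / real (Suc n)) \<longlonglongrightarrow> 0" using LIMSEQ_inverse_real_of_nat by (simp add: inverse_eq_divide)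
      qed (use \<phi>(2)[OF elim] eq[OF elim] in auto)
      from tendsto_power[OF this, of n] show ?case using n by (simp add: zero_power)
    qed
    show "AE x in ?E. norm (\<bar>\<phi> k x - v x\<bar> ^ n) \<le> 1" for k using inE
    proof eventually_elim
      case (elim x)
      have "1 / real (Suc k) \<le> 1" by simp
      then have "\<bar>\<phi> k x - v x\<bar> \<le> 1" using \<phi>(2)[OF elim, of k] eq[OF elim] by linarith
      then show ?case by (simp add: power_le_one)
    qed
  qed auto
  then have A: "(\<lambda>k. LINT x|?E. \<bar>\<phi> k x - v x\<bar> ^ n) \<longlonglongrightarrow> 0" by simp
  have "(\<lambda>k. LINT x|?E. norm (grad (\<phi> k) x - w x) ^ n) \<longlonglongrightarrow> (LINT x|?E. 0)"
  proof (rule integral_dominated_convergence[where w = "\<lambda>x. (L + L) ^ n"])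
    show "(\<lambda>x. norm (grad (\<phi> k) x - w x) ^ n) \<in> borel_measurable ?E" for k
      using w(1) continuous_measurable_lebesgue_on[OF smooth_grad_continuous_on[OF sm[of k]], of \<Omega>] by measurable
    show "AE x in ?E. (\<lambda>k. norm (grad (\<phi> k) x - w x) ^ n) \<longlonglongrightarrow> 0" using w(3)
    proof eventually_elim
      case (elim x)
      have "(\<lambda>k. norm (grad (\<phi> k) x - w x)) \<longlonglongrightarrow> 0" using elim by (simp add: tendsto_norm_zero LIM_zero)
      from tendsto_power[OF this, of n] show ?case using n by (simp add: zero_power)
    qed
    show "AE x in ?E. norm (norm (grad (\<phi> k) x - w x) ^ n) \<le> (L + L) ^ n" for k using inE
    proof eventually_elim
      case (elim x)
      have "norm (grad (\<phi> k) x - w x) \<le> L + L"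
        using norm_triangle_ineq4[of "grad (\<phi> k) x" "w x"] \<phi>(3)[OF elim, of k] w(2)[of x] by linarith
      then have "norm (grad (\<phi> k) x - w x) ^ n \<le> (L + L) ^ n" by (intro power_mono) auto
      then show ?case by simp
    qed
  qed auto
  then have B: "(\<lambda>k. LINT x|?E. norm (grad (\<phi> k) x - w x) ^ n) \<longlonglongrightarrow> 0" by simp
  have "(LINT x|?E. norm (wgrad \<Omega> (\<lambda>x. \<phi> k x - v x) x) ^ n) = (LINT x|?E. norm (grad (\<phi> k) x - w x) ^ n)" for k
    by (rule lebesgue_on_cong_AE(3)[OF s\<Omega>]) (use g[of k] in \<open>eventually_elim, simp\<close>)
  then have "(\<lambda>k. W1_norm \<Omega> n (\<lambda>x. \<phi> k x - v x)) \<longlonglongrightarrow> root n (0 + 0)"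
    unfolding W1_norm_def by (simp only:) (intro tendsto_intros A B)
  then have "(\<lambda>k. W1_norm \<Omega> n (\<lambda>x. \<phi> k x - v x)) \<longlonglongrightarrow> 0" by simp
  then show ?thesis using v1 \<phi>(1) unfolding W1_0_def by blast
qed

subsection \<open>The energy as a power series of moments\<close>

text \<open>The induction step has the exact remainder p s^(p-1) (t - s)^2, so convexity of the
  power is obtained without calculus.\<close>

lemma power_tangent:
  fixes s t :: real
  assumes "s \<ge> 0" "t \<ge> 0"
  shows "s ^ p + real p * s ^ (p - 1) * (t - s) \<le> t ^ p"
proof (induction p)
  case (Suc p)
  show ?case
  proof (cases p)
    case (Suc q)
    have "t ^ Suc p - s ^ Suc p - real (Suc p) * s ^ p * (t - s) =
        t * (t ^ p - s ^ p - real p * s ^ q * (t - s)) + real p * s ^ q * (t - s)\<^sup>2"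
      unfolding Suc by (simp add: power2_eq_square algebra_simps)
    moreover have "t * (t ^ p - s ^ p - real p * s ^ q * (t - s)) \<ge> 0"
      using Suc.IH assms Suc by (intro mult_nonneg_nonneg) auto
    moreover have "real p * s ^ q * (t - s)\<^sup>2 \<ge> 0" using assms by (intro mult_nonneg_nonneg) auto
    ultimately show ?thesis by simp
  qed simp
qed simp

text \<open>The Cauchy-Schwarz inequality replaces the directional derivative by that of the scalar
  power at the norms.\<close>

lemma norm_power_tangent:
  fixes x y :: "'a::real_inner"
  assumes p: "p \<ge> 2"
  shows "norm x ^ p + real p * (norm x ^ (p - 2) * (x \<bullet> (y - x))) \<le> norm y ^ p"
proof -
  obtain q where q: "p = Suc (Suc q)" using p by (metis add_2_eq_Suc le_Suc_ex)
  have "x \<bullet> (y - x) \<le> norm x * (norm y - norm x)"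
    using norm_cauchy_schwarz[of x y] by (simp add: inner_diff_right right_diff_distrib power2_norm_eq_inner[symmetric] power2_eq_square)
  then have "norm x ^ q * (x \<bullet> (y - x)) \<le> norm x ^ q * (norm x * (norm y - norm x))"
    by (intro mult_left_mono) auto
  then have "real p * (norm x ^ q * (x \<bullet> (y - x))) \<le> real p * (norm x ^ q * (norm x * (norm y - norm x)))"
    by (rule mult_left_mono) simp
  then show ?thesis using power_tangent[of "norm x" "norm y" p] by (simp add: q mult_ac)
qed

lemma norm_power_convex:
  fixes x y :: "'a::real_normed_vector"
  assumes "0 \<le> t" "t \<le> 1"
  shows "norm (t *\<^sub>R x + (1 - t) *\<^sub>R y) ^ p \<le> t * norm x ^ p + (1 - t) * norm y ^ p"
proof -
  define s where "s = t * norm x + (1 - t) * norm y"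
  have s: "s \<ge> 0" using assms by (simp add: s_def)
  have "norm (t *\<^sub>R x + (1 - t) *\<^sub>R y) \<le> s"
    unfolding s_def using assms by (intro norm_triangle_le) simp
  then have "norm (t *\<^sub>R x + (1 - t) *\<^sub>R y) ^ p \<le> s ^ p" by (intro power_mono) auto
  \<comment> \<open>The tangent terms cancel because \<open>s\<close> is precisely the weighted mean
    of the two norms.\<close>
  also have "s ^ p = t * (s ^ p + real p * s ^ (p - 1) * (norm x - s)) +
      (1 - t) * (s ^ p + real p * s ^ (p - 1) * (norm y - s))"
  proof -
    have "t * (A + c * (X - s)) + (1 - t) * (A + c * (Y - s)) = A + c * (t * X + (1 - t) * Y - s)" for A c X Y
      by (simp add: algebra_simps)
    from this[of _ _ "norm x" "norm y"] show ?thesis by (simp add: s_def)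
  qed
  also have "\<dots> \<le> t * norm x ^ p + (1 - t) * norm y ^ p"
    using assms s by (intro add_mono mult_left_mono power_tangent) auto
  finally show ?thesis .
qed

lemma norm_square_convex_identity:
  fixes x y :: "'a::real_inner"
  shows "(norm (t *\<^sub>R x + (1 - t) *\<^sub>R y))\<^sup>2 = t * (norm x)\<^sup>2 + (1 - t) * (norm y)\<^sup>2 - t * (1 - t) * (norm (x - y))\<^sup>2"
  unfolding power2_norm_eq_inner
  by (simp add: inner_add_left inner_add_right inner_diff_left inner_diff_right inner_commute[of y x] algebra_simps power2_eq_square)

text \<open>The root test with an intermediate radius \<open>R\<close>, the midpoint of
  \<open>r\<close> and \<sigma>: eventually the terms are below (r/R)^p. The absolute value covers
  the indices 0 and 1, where no sign is prescribed.\<close>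

lemma summable_below_radius:
  fixes a :: "nat \<Rightarrow> real"
  assumes \<sigma>: "\<sigma> > 0" "ereal (1 / \<sigma>) = limsup (\<lambda>p. ereal (root p (a p)))"
    and a: "\<forall>p\<ge>2. a p \<ge> 0" and r: "0 \<le> r" "r < \<sigma>"
  shows "summable (\<lambda>p. \<bar>a p\<bar> * r ^ p)"
proof -
  define R where "R = (r + \<sigma>) / 2"
  have R: "r < R" "R < \<sigma>" "0 < R" using r by (auto simp: R_def)
  have "ereal (1 / \<sigma>) < ereal (1 / R)" using R by (simp add: divide_strict_left_mono)
  then have "\<forall>\<^sub>F p in sequentially. ereal (root p (a p)) < ereal (1 / R)"
    using \<sigma>(2) by (intro Limsup_lessD) simp
  then have ev: "\<forall>\<^sub>F p in sequentially. norm (\<bar>a p\<bar> * r ^ p) \<le> (r / R) ^ p"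
    using eventually_ge_at_top[of 2]
  proof eventually_elim
    case (elim p)
    have "a p = root p (a p) ^ p" using elim a by simp
    also have "\<dots> \<le> (1 / R) ^ p" using elim a by (intro power_mono) auto
    finally have "a p * r ^ p \<le> (1 / R) ^ p * r ^ p" using r by (intro mult_right_mono) auto
    then show ?case using a elim r by (simp add: power_divide)
  qed
  have "summable (\<lambda>p. (r / R) ^ p)" using r R by (intro summable_geometric) simp
  then show ?thesis by (rule summable_comparison_test_ev[OF ev])
qed

text \<open>Mediates between the unordered sums over index sets in the definitions and the ordered
  series used for estimates.\<close>

lemma infsum_eq_suminf_if:
  fixes f :: "nat \<Rightarrow> real"
  assumes "summable (\<lambda>p. norm (if p \<in> A then f p else 0))"
  shows "f summable_on A" "(\<Sum>\<^sub>\<infinity>p\<in>A. f p) = (\<Sum>p. if p \<in> A then f p else 0)"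
proof -
  have "(\<lambda>p. if p \<in> A then f p else 0) sums (\<Sum>p. if p \<in> A then f p else 0)"
    using summable_norm_cancel[OF assms] by (rule summable_sums)
  then have "((\<lambda>p. if p \<in> A then f p else 0) has_sum (\<Sum>p. if p \<in> A then f p else 0)) UNIV"
    by (rule norm_summable_imp_has_sum[OF assms])
  also have "?this \<longleftrightarrow> (f has_sum (\<Sum>p. if p \<in> A then f p else 0)) A"
    by (rule has_sum_cong_neutral) auto
  finally show "f summable_on A" "(\<Sum>\<^sub>\<infinity>p\<in>A. f p) = (\<Sum>p. if p \<in> A then f p else 0)"
    by (auto simp: infsumI summable_on_def)
qed

text \<open>Padding with zeros below 2 lets every series run over all natural numbers.\<close>

definition Phi_coeff :: "(nat \<Rightarrow> real) \<Rightarrow> nat \<Rightarrow> real" where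
  "Phi_coeff a p = (if p \<ge> 2 then a p / real p else 0)"

definition moment :: "'a::euclidean_space set \<Rightarrow> ('a \<Rightarrow> 'a) \<Rightarrow> nat \<Rightarrow> real" where
  "moment \<Omega> w p = (LINT x|lebesgue_on \<Omega>. norm (w x) ^ p)"

lemma moment_nonneg: "moment \<Omega> w p \<ge> 0"
  by (simp add: moment_def)

lemma Phi_coeff_nonneg: "\<forall>p\<ge>2. a p \<ge> 0 \<Longrightarrow> Phi_coeff a p \<ge> 0"
  by (simp add: Phi_coeff_def)

lemma Phi_eq_suminf: "Phi a t = (\<Sum>p. ennreal (Phi_coeff a p * t ^ p))"
proof -
  let ?f = "\<lambda>p. ennreal (Phi_coeff a p * t ^ p)"
  have "Phi a t = infsum ?f UNIV"
    unfolding Phi_def by (rule infsum_cong_neutral) (auto simp: Phi_coeff_def)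
  moreover have "(?f has_sum infsum ?f UNIV) UNIV"
    by (rule has_sum_infsum) (rule nonneg_summable_on_complete, simp)
  ultimately show ?thesis using has_sum_imp_sums sums_unique by metis
qed

lemma integrable_norm_power:
  fixes w :: "'a::euclidean_space \<Rightarrow> 'a"
  assumes "open \<Omega>" "bounded \<Omega>" "w \<in> borel_measurable (lebesgue_on \<Omega>)"
    and "AE x in lebesgue_on \<Omega>. norm (w x) \<le> B"
  shows "integrable (lebesgue_on \<Omega>) (\<lambda>x. norm (w x) ^ p)"
  using bounded_in_Lp_space[OF assms, of p] by (simp add: Lp_space_def)

lemma moment_le:
  fixes w :: "'a::euclidean_space \<Rightarrow> 'a"
  assumes \<Omega>: "open \<Omega>" "bounded \<Omega>" and w: "w \<in> borel_measurable (lebesgue_on \<Omega>)"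
    "AE x in lebesgue_on \<Omega>. norm (w x) \<le> B"
  shows "moment \<Omega> w p \<le> measure lebesgue \<Omega> * B ^ p"
proof -
  interpret finite_measure "lebesgue_on \<Omega>" by (rule finite_measure_lebesgue_on_open[OF \<Omega>])
  have "moment \<Omega> w p \<le> (LINT x|lebesgue_on \<Omega>. B ^ p)" unfolding moment_def
  proof (rule integral_mono_AE[OF integrable_norm_power[OF \<Omega> w]])
    show "AE x in lebesgue_on \<Omega>. norm (w x) ^ p \<le> B ^ p"
      using w(2) by eventually_elim (simp add: power_mono)
  qed simp
  also have "\<dots> = measure lebesgue \<Omega> * B ^ p"
    using \<Omega>(1) by (simp add: measure_restrict_space borel_open)
  finally show ?thesis .
qed

text \<open>All terms are nonnegative, so sum and integral may be exchanged in the extended reals,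
  even when the series diverges where the norm reaches \<sigma>.\<close>

lemma energy_eq_suminf:
  fixes w :: "'a::euclidean_space \<Rightarrow> 'a"
  assumes \<Omega>: "open \<Omega>" "bounded \<Omega>" and a: "\<forall>p\<ge>2. a p \<ge> 0"
    and w[measurable]: "w \<in> borel_measurable (lebesgue_on \<Omega>)" and b: "AE x in lebesgue_on \<Omega>. norm (w x) \<le> \<sigma>"
  shows "(\<integral>\<^sup>+x. G a \<sigma> (w x) \<partial>lebesgue_on \<Omega>) = (\<Sum>p. ennreal (Phi_coeff a p * moment \<Omega> w p))"
proof -
  have "(\<integral>\<^sup>+x. G a \<sigma> (w x) \<partial>lebesgue_on \<Omega>) =
      (\<integral>\<^sup>+x. (\<Sum>p. ennreal (Phi_coeff a p * norm (w x) ^ p)) \<partial>lebesgue_on \<Omega>)"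
    by (rule nn_integral_cong_AE) (use b in \<open>eventually_elim, simp add: G_def Phi_eq_suminf\<close>)
  also have "\<dots> = (\<Sum>p. \<integral>\<^sup>+x. ennreal (Phi_coeff a p * norm (w x) ^ p) \<partial>lebesgue_on \<Omega>)"
    by (rule nn_integral_suminf) measurable
  also have "\<dots> = (\<Sum>p. ennreal (Phi_coeff a p * moment \<Omega> w p))"
  proof (rule suminf_cong)
    fix p
    have "(\<integral>\<^sup>+x. ennreal (Phi_coeff a p * norm (w x) ^ p) \<partial>lebesgue_on \<Omega>) =
        ennreal (LINT x|lebesgue_on \<Omega>. Phi_coeff a p * norm (w x) ^ p)"
      using integrable_norm_power[OF \<Omega> w b, of p] Phi_coeff_nonneg[OF a, of p]
      by (intro nn_integral_eq_integral) auto
    then show "(\<integral>\<^sup>+x. ennreal (Phi_coeff a p * norm (w x) ^ p) \<partial>lebesgue_on \<Omega>) =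
        ennreal (Phi_coeff a p * moment \<Omega> w p)"
      by (simp add: moment_def)
  qed
  finally show ?thesis .
qed

lemma F_eq:
  fixes v :: "'a::euclidean_space \<Rightarrow> real"
  assumes \<Omega>: "open \<Omega>" "bounded \<Omega>" and a: "\<forall>p\<ge>2. a p \<ge> 0"
    and w: "wgrad \<Omega> v \<in> borel_measurable (lebesgue_on \<Omega>)" "AE x in lebesgue_on \<Omega>. norm (wgrad \<Omega> v x) \<le> \<sigma>"
  shows "F a \<sigma> \<Omega> f v = (if summable (\<lambda>p. Phi_coeff a p * moment \<Omega> (wgrad \<Omega> v) p)
     then ereal ((\<Sum>p. Phi_coeff a p * moment \<Omega> (wgrad \<Omega> v) p) - (LINT x|lebesgue_on \<Omega>. f x * v x)) else \<infinity>)"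
proof -
  let ?s = "\<lambda>p. Phi_coeff a p * moment \<Omega> (wgrad \<Omega> v) p"
  have nn: "?s p \<ge> 0" for p by (intro mult_nonneg_nonneg Phi_coeff_nonneg[OF a] moment_nonneg)
  have eq: "(\<integral>\<^sup>+x. G a \<sigma> (wgrad \<Omega> v x) \<partial>lebesgue_on \<Omega>) = (\<Sum>p. ennreal (?s p))"
    by (rule energy_eq_suminf[OF \<Omega> a w])
  show ?thesis
  proof (cases "summable ?s")
    case True
    then have "(\<Sum>p. ennreal (?s p)) = ennreal (\<Sum>p. ?s p)" using nn by (intro suminf_ennreal2) auto
    moreover have "(\<Sum>p. ?s p) \<ge> 0" by (rule suminf_nonneg[OF True nn])
    ultimately show ?thesis unfolding F_def eq by (simp only: True if_True enn2ereal_ennreal ereal_minus)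
  next
    case False
    then have top: "(\<Sum>p. ennreal (?s p)) = \<infinity>" using summable_suminf_not_top[of ?s, OF nn] by (auto simp: infinity_ennreal_def)
    show ?thesis unfolding F_def eq top by (simp add: False)
  qed
qed

text \<open>Every moment is convex. The quadratic one has the exact defect t (1 - t) times the
  squared L2 distance, which enters with the weight \<open>a 2 / 2\<close>. The combination
  \<open>w\<close> is prescribed only a.e. because weak gradients are determined only a.e.\<close>

lemma energy_strongly_convex:
  fixes w1 w2 :: "'a::euclidean_space \<Rightarrow> 'a"
  assumes \<Omega>: "open \<Omega>" "bounded \<Omega>" and a: "\<forall>p\<ge>2. a p \<ge> 0"
    and w1: "w1 \<in> borel_measurable (lebesgue_on \<Omega>)" "AE x in lebesgue_on \<Omega>. norm (w1 x) \<le> \<sigma>"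
    and w2: "w2 \<in> borel_measurable (lebesgue_on \<Omega>)" "AE x in lebesgue_on \<Omega>. norm (w2 x) \<le> \<sigma>"
    and s1: "summable (\<lambda>p. Phi_coeff a p * moment \<Omega> w1 p)"
    and s2: "summable (\<lambda>p. Phi_coeff a p * moment \<Omega> w2 p)"
    and t: "0 \<le> t" "t \<le> 1"
    and w: "w \<in> borel_measurable (lebesgue_on \<Omega>)" "AE x in lebesgue_on \<Omega>. norm (w x) \<le> \<sigma>"
      "AE x in lebesgue_on \<Omega>. w x = t *\<^sub>R w1 x + (1 - t) *\<^sub>R w2 x"
  shows "summable (\<lambda>p. Phi_coeff a p * moment \<Omega> w p)"
    and "(\<Sum>p. Phi_coeff a p * moment \<Omega> w p) + a 2 / 2 * (t * (1 - t)) * (LINT x|lebesgue_on \<Omega>. (norm (w1 x - w2 x))\<^sup>2)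
      \<le> t * (\<Sum>p. Phi_coeff a p * moment \<Omega> w1 p) + (1 - t) * (\<Sum>p. Phi_coeff a p * moment \<Omega> w2 p)"
proof -
  let ?E = "lebesgue_on \<Omega>"
  let ?D = "LINT x|?E. (norm (w1 x - w2 x))\<^sup>2"
  have s\<Omega>: "\<Omega> \<in> sets lebesgue" using \<Omega>(1) by (simp add: borel_open lmeasurable_open)
  note i1 = integrable_norm_power[OF \<Omega> w1] and i2 = integrable_norm_power[OF \<Omega> w2] and iw = integrable_norm_power[OF \<Omega> w(1,2)]
  have conv: "moment \<Omega> w p \<le> t * moment \<Omega> w1 p + (1 - t) * moment \<Omega> w2 p" for p
  proof -
    have "moment \<Omega> w p \<le> (LINT x|?E. t * norm (w1 x) ^ p + (1 - t) * norm (w2 x) ^ p)"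
      unfolding moment_def
    proof (rule integral_mono_AE[OF iw])
      show "integrable ?E (\<lambda>x. t * norm (w1 x) ^ p + (1 - t) * norm (w2 x) ^ p)" using i1 i2 by simp
      show "AE x in ?E. norm (w x) ^ p \<le> t * norm (w1 x) ^ p + (1 - t) * norm (w2 x) ^ p"
        using w(3) by eventually_elim (simp add: norm_power_convex t)
    qed
    then show ?thesis using i1 i2 by (simp add: moment_def)
  qed
  have d: "integrable ?E (\<lambda>x. (norm (w1 x - w2 x))\<^sup>2)"
  proof (rule integrable_norm_power[OF \<Omega>])
    show "(\<lambda>x. w1 x - w2 x) \<in> borel_measurable ?E" using w1(1) w2(1) by measurable
    show "AE x in ?E. norm (w1 x - w2 x) \<le> \<sigma> + \<sigma>"
      using w1(2) w2(2)
    proof eventually_elim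
      case (elim x)
      then show ?case using norm_triangle_ineq4[of "w1 x" "w2 x"] by linarith
    qed
  qed
  have sq: "moment \<Omega> w 2 = t * moment \<Omega> w1 2 + (1 - t) * moment \<Omega> w2 2 - t * (1 - t) * ?D"
  proof -
    have "moment \<Omega> w 2 = (LINT x|?E. t * (norm (w1 x))\<^sup>2 + (1 - t) * (norm (w2 x))\<^sup>2 - t * (1 - t) * (norm (w1 x - w2 x))\<^sup>2)"
      unfolding moment_def
      by (rule lebesgue_on_cong_AE(3)[OF s\<Omega>]) (use w(3) in \<open>eventually_elim, simp add: norm_square_convex_identity\<close>)
    then show ?thesis using i1[of 2] i2[of 2] d by (simp add: moment_def)
  qed
  let ?c = "\<lambda>p. Phi_coeff a p"
  let ?r = "\<lambda>p. t * (?c p * moment \<Omega> w1 p) + (1 - t) * (?c p * moment \<Omega> w2 p)"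
  have sr: "summable ?r" using s1 s2 by (intro summable_add summable_mult)
  have le: "?c p * moment \<Omega> w p \<le> ?r p" for p
    using mult_left_mono[OF conv Phi_coeff_nonneg[OF a], of p p] by (simp add: algebra_simps)
  show s: "summable (\<lambda>p. ?c p * moment \<Omega> w p)"
  proof (rule summable_comparison_test[OF _ sr], intro exI allI impI)
    fix p
    show "norm (?c p * moment \<Omega> w p) \<le> ?r p"
      using le[of p] Phi_coeff_nonneg[OF a, of p] moment_nonneg[of \<Omega> w p] by simp
  qed
  \<comment> \<open>The series of convexity defects has nonnegative terms; only the one with
    \<open>p = 2\<close> is kept.\<close>
  have "(\<Sum>p\<in>{2}. ?r p - ?c p * moment \<Omega> w p) \<le> (\<Sum>p. ?r p - ?c p * moment \<Omega> w p)"
    using le sr s by (intro sum_le_suminf summable_diff) auto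
  also have "\<dots> = (\<Sum>p. ?r p) - (\<Sum>p. ?c p * moment \<Omega> w p)" using sr s by (rule suminf_diff[symmetric])
  also have "(\<Sum>p. ?r p) = t * (\<Sum>p. ?c p * moment \<Omega> w1 p) + (1 - t) * (\<Sum>p. ?c p * moment \<Omega> w2 p)"
    using s1 s2 by (simp add: suminf_add[symmetric] summable_mult suminf_mult)
  also have "(\<Sum>p\<in>{2}. ?r p - ?c p * moment \<Omega> w p) = a 2 / 2 * (t * (1 - t)) * ?D"
    by (simp add: Phi_coeff_def sq) (simp add: algebra_simps)
  finally show "(\<Sum>p. ?c p * moment \<Omega> w p) + a 2 / 2 * (t * (1 - t)) * ?D
      \<le> t * (\<Sum>p. ?c p * moment \<Omega> w1 p) + (1 - t) * (\<Sum>p. ?c p * moment \<Omega> w2 p)" by linarith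
qed

lemma summable_energy:
  fixes w :: "'a::euclidean_space \<Rightarrow> 'a"
  assumes \<Omega>: "open \<Omega>" "bounded \<Omega>" and a: "\<forall>p\<ge>2. a p \<ge> 0"
    and w: "w \<in> borel_measurable (lebesgue_on \<Omega>)" "AE x in lebesgue_on \<Omega>. norm (w x) \<le> R"
    and s: "summable (\<lambda>p. \<bar>a p\<bar> * R ^ p)"
  shows "summable (\<lambda>p. Phi_coeff a p * moment \<Omega> w p)"
proof (rule summable_comparison_test)
  show "summable (\<lambda>p. measure lebesgue \<Omega> * (\<bar>a p\<bar> * R ^ p))" using s by (rule summable_mult)
  have "norm (Phi_coeff a p * moment \<Omega> w p) \<le> measure lebesgue \<Omega> * (\<bar>a p\<bar> * R ^ p)" for p
  proof -
    have c: "0 \<le> Phi_coeff a p" "Phi_coeff a p \<le> \<bar>a p\<bar>"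
      using a divide_left_mono[of 1 "real p" "a p"] by (auto simp: Phi_coeff_def)
    have m: "0 \<le> moment \<Omega> w p" "moment \<Omega> w p \<le> measure lebesgue \<Omega> * R ^ p"
      by (rule moment_nonneg, rule moment_le[OF \<Omega> w])
    have "Phi_coeff a p * moment \<Omega> w p \<le> \<bar>a p\<bar> * (measure lebesgue \<Omega> * R ^ p)"
      using c m by (intro mult_mono) auto
    then show ?thesis using c m by (simp add: mult.left_commute)
  qed
  then show "\<exists>N. \<forall>p\<ge>N. norm (Phi_coeff a p * moment \<Omega> w p) \<le> measure lebesgue \<Omega> * (\<bar>a p\<bar> * R ^ p)" by blast
qed

text \<open>The bound R^(p-1) M is written with the factor \<open>R ^ p\<close> so that it matches
  the summable series with terms \<open>\<bar>a p\<bar> * R ^ p\<close>.\<close>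

lemma p_integrand_bound:
  fixes x y :: "'a::real_inner"
  assumes "p \<ge> 2" "norm x \<le> R" "norm y \<le> M" "R > 0"
  shows "\<bar>norm x ^ (p - 2) * (x \<bullet> y)\<bar> \<le> R ^ p * M / R"
proof -
  obtain q where q: "p = Suc (Suc q)" using assms(1) by (metis add_2_eq_Suc le_Suc_ex)
  have "\<bar>x \<bullet> y\<bar> \<le> R * M"
    by (rule order_trans[OF Cauchy_Schwarz_ineq2]) (use assms in \<open>intro mult_mono, auto\<close>)
  then have "\<bar>norm x ^ q * (x \<bullet> y)\<bar> \<le> R ^ q * (R * M)"
    unfolding abs_mult using assms by (intro mult_mono) (auto intro: power_mono)
  also have "\<dots> = R ^ p * M / R" using assms(4) by (simp add: q)
  finally show ?thesis by (simp add: q)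
qed

lemma p_integral_bound:
  fixes \<xi> \<eta> :: "'a::euclidean_space \<Rightarrow> 'a"
  assumes \<Omega>: "open \<Omega>" "bounded \<Omega>"
    and \<xi>[measurable]: "\<xi> \<in> borel_measurable (lebesgue_on \<Omega>)" and \<xi>b: "AE x in lebesgue_on \<Omega>. norm (\<xi> x) \<le> R"
    and \<eta>[measurable]: "\<eta> \<in> borel_measurable (lebesgue_on \<Omega>)" and \<eta>b: "AE x in lebesgue_on \<Omega>. norm (\<eta> x) \<le> M"
    and R: "R > 0" and p: "p \<ge> 2"
  shows "integrable (lebesgue_on \<Omega>) (\<lambda>x. norm (\<xi> x) ^ (p - 2) * (\<xi> x \<bullet> \<eta> x))"
    and "\<bar>LINT x|lebesgue_on \<Omega>. norm (\<xi> x) ^ (p - 2) * (\<xi> x \<bullet> \<eta> x)\<bar> \<le> measure lebesgue \<Omega> * (R ^ p * M / R)"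
proof -
  interpret finite_measure "lebesgue_on \<Omega>" by (rule finite_measure_lebesgue_on_open[OF \<Omega>])
  have b: "AE x in lebesgue_on \<Omega>. norm (norm (\<xi> x) ^ (p - 2) * (\<xi> x \<bullet> \<eta> x)) \<le> R ^ p * M / R"
    using \<xi>b \<eta>b
  proof eventually_elim
    case (elim x)
    from p_integrand_bound[OF p elim R] show ?case unfolding real_norm_def .
  qed
  show i: "integrable (lebesgue_on \<Omega>) (\<lambda>x. norm (\<xi> x) ^ (p - 2) * (\<xi> x \<bullet> \<eta> x))"
    by (rule integrable_bounded_on[OF \<Omega> _ b]) measurable
  have "\<bar>LINT x|lebesgue_on \<Omega>. norm (\<xi> x) ^ (p - 2) * (\<xi> x \<bullet> \<eta> x)\<bar> \<le>
      (LINT x|lebesgue_on \<Omega>. \<bar>norm (\<xi> x) ^ (p - 2) * (\<xi> x \<bullet> \<eta> x)\<bar>)"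
    by (rule integral_abs_bound)
  also have "\<dots> \<le> (LINT x|lebesgue_on \<Omega>. R ^ p * M / R)"
    by (rule integral_mono_AE) (use i b in auto)
  also have "\<dots> = measure lebesgue \<Omega> * (R ^ p * M / R)"
    using \<Omega>(1) by (simp add: measure_restrict_space borel_open)
  finally show "\<bar>LINT x|lebesgue_on \<Omega>. norm (\<xi> x) ^ (p - 2) * (\<xi> x \<bullet> \<eta> x)\<bar> \<le> measure lebesgue \<Omega> * (R ^ p * M / R)" .
qed

text \<open>
  The gradient inequality is used at the perturbed point \<open>\<xi> + t \<eta>\<close>, so that only the limit of
  first-order terms as \<open>t \<rightarrow> 0\<close> has to be controlled and no second derivatives enter.
\<close>

lemma energy_first_variation:
  fixes \<xi> \<eta> :: "'a::euclidean_space \<Rightarrow> 'a"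
  assumes \<Omega>: "open \<Omega>" "bounded \<Omega>" and a: "\<forall>p\<ge>2. a p \<ge> 0"
    and \<xi>[measurable]: "\<xi> \<in> borel_measurable (lebesgue_on \<Omega>)" and \<xi>b: "AE x in lebesgue_on \<Omega>. norm (\<xi> x) \<le> K"
    and \<eta>[measurable]: "\<eta> \<in> borel_measurable (lebesgue_on \<Omega>)" and \<eta>b: "AE x in lebesgue_on \<Omega>. norm (\<eta> x) \<le> M"
    and R: "R > 0" "\<tau> > 0" "M \<ge> 0" "K + \<tau> * M \<le> R" and s: "summable (\<lambda>p. \<bar>a p\<bar> * R ^ p)"
    and lb: "\<And>t. 0 < t \<Longrightarrow> t \<le> \<tau> \<Longrightarrow> t * I + (\<Sum>p. Phi_coeff a p * moment \<Omega> \<xi> p)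
        \<le> (\<Sum>p. Phi_coeff a p * moment \<Omega> (\<lambda>x. \<xi> x + t *\<^sub>R \<eta> x) p)"
  shows "I \<le> (\<Sum>p. if p \<ge> 2 then a p * (LINT x|lebesgue_on \<Omega>. norm (\<xi> x) ^ (p - 2) * (\<xi> x \<bullet> \<eta> x)) else 0)"
proof -
  let ?E = "lebesgue_on \<Omega>"
  interpret finite_measure ?E by (rule finite_measure_lebesgue_on_open[OF \<Omega>])
  define \<xi>t where "\<xi>t t x = \<xi> x + t *\<^sub>R \<eta> x" for t x
  have m[measurable]: "\<xi>t t \<in> borel_measurable ?E" for t unfolding \<xi>t_def by measurable
  have bd: "AE x in ?E. norm (\<xi>t t x) \<le> R" if "0 \<le> t" "t \<le> \<tau>" for t
    using \<xi>b \<eta>b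
  proof eventually_elim
    case (elim x)
    have "norm (\<xi>t t x) \<le> norm (\<xi> x) + t * norm (\<eta> x)"
      unfolding \<xi>t_def using that norm_triangle_ineq[of "\<xi> x" "t *\<^sub>R \<eta> x"] by simp
    also have "\<dots> \<le> K + \<tau> * M" using elim that R by (intro add_mono mult_mono) auto
    finally show ?case using R by simp
  qed
  define A where "A p t = (if p \<ge> 2 then a p * (LINT x|?E. norm (\<xi>t t x) ^ (p - 2) * (\<xi>t t x \<bullet> \<eta> x)) else 0)" for p t
  \<comment> \<open>A summable majorant of the first-order terms, uniform in \<open>t\<close>; it is
    needed to pass to the limit under the sum.\<close>
  define B where "B p = measure lebesgue \<Omega> * M / R * (\<bar>a p\<bar> * R ^ p)" for p
  have sB: "summable B" unfolding B_def by (intro summable_mult s)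
  have AB: "norm (A p t) \<le> B p" if "0 \<le> t" "t \<le> \<tau>" for p t
  proof (cases "p \<ge> 2")
    case True
    have "\<bar>a p\<bar> * \<bar>LINT x|?E. norm (\<xi>t t x) ^ (p - 2) * (\<xi>t t x \<bullet> \<eta> x)\<bar> \<le> \<bar>a p\<bar> * (measure lebesgue \<Omega> * (R ^ p * M / R))"
      by (intro mult_left_mono p_integral_bound[OF \<Omega> m bd[OF that] \<eta> \<eta>b R(1) True]) auto
    then show ?thesis using True by (simp add: A_def B_def abs_mult mult_ac)
  qed (use R in \<open>simp add: A_def B_def\<close>)
  have sA: "summable (\<lambda>p. A p t)" if "0 \<le> t" "t \<le> \<tau>" for t
    by (rule summable_comparison_test[OF _ sB]) (use AB[OF that] in blast)
  have sm: "summable (\<lambda>p. Phi_coeff a p * moment \<Omega> (\<xi>t t) p)" if "0 \<le> t" "t \<le> \<tau>" for t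
    by (rule summable_energy[OF \<Omega> a m bd[OF that] s])
  have \<xi>0: "\<xi>t 0 = \<xi>" by (simp add: \<xi>t_def fun_eq_iff)
  have IA: "I \<le> (\<Sum>p. A p t)" if t: "0 < t" "t \<le> \<tau>" for t
  proof -
    have t0: "0 \<le> t" using t by simp
    have R': "0 \<le> \<tau>" using R by simp
    \<comment> \<open>The tangent inequality at the perturbed point, evaluated back at the
      unperturbed one, bounds the increase from above; the factor \<open>p\<close> cancels the
      denominator of the coefficient.\<close>
    have le: "Phi_coeff a p * moment \<Omega> (\<xi>t t) p - Phi_coeff a p * moment \<Omega> (\<xi>t 0) p \<le> t * A p t" for p
    proof (cases "p \<ge> 2")
      case True
      note i = p_integral_bound(1)[OF \<Omega> m bd[OF t0 t(2)] \<eta> \<eta>b R(1) True]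
      note it = integrable_norm_power[OF \<Omega> m bd[OF t0 t(2)], of p]
      note i0 = integrable_norm_power[OF \<Omega> m bd[OF order_refl R'], of p]
      have "moment \<Omega> (\<xi>t t) p \<le> (LINT x|?E. norm (\<xi>t 0 x) ^ p + real p * t * (norm (\<xi>t t x) ^ (p - 2) * (\<xi>t t x \<bullet> \<eta> x)))"
        unfolding moment_def
      proof (rule integral_mono[OF it])
        show "integrable ?E (\<lambda>x. norm (\<xi>t 0 x) ^ p + real p * t * (norm (\<xi>t t x) ^ (p - 2) * (\<xi>t t x \<bullet> \<eta> x)))"
          using i i0 by (intro Bochner_Integration.integrable_add integrable_mult_right) auto
        fix x
        have "\<xi>t 0 x - \<xi>t t x = - t *\<^sub>R \<eta> x" by (simp add: \<xi>t_def)
        then show "norm (\<xi>t t x) ^ p \<le> norm (\<xi>t 0 x) ^ p + real p * t * (norm (\<xi>t t x) ^ (p - 2) * (\<xi>t t x \<bullet> \<eta> x))"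
          using norm_power_tangent[OF True, of "\<xi>t t x" "\<xi>t 0 x"] by (simp add: mult_ac)
      qed
      also have "\<dots> = moment \<Omega> (\<xi>t 0) p + real p * t * (LINT x|?E. norm (\<xi>t t x) ^ (p - 2) * (\<xi>t t x \<bullet> \<eta> x))"
        unfolding moment_def using i i0 by (subst Bochner_Integration.integral_add) auto
      finally have "a p / real p * moment \<Omega> (\<xi>t t) p \<le> a p / real p * (moment \<Omega> (\<xi>t 0) p +
          real p * t * (LINT x|?E. norm (\<xi>t t x) ^ (p - 2) * (\<xi>t t x \<bullet> \<eta> x)))"
        using a True by (intro mult_left_mono) auto
      then show ?thesis using True by (simp add: Phi_coeff_def A_def distrib_left mult.left_commute[of t])
    qed (simp add: Phi_coeff_def A_def)
    have "t * I \<le> (\<Sum>p. Phi_coeff a p * moment \<Omega> (\<xi>t t) p) - (\<Sum>p. Phi_coeff a p * moment \<Omega> (\<xi>t 0) p)"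
      using lb[OF t] unfolding \<xi>0 by (simp add: \<xi>t_def[abs_def])
    also have "\<dots> = (\<Sum>p. Phi_coeff a p * moment \<Omega> (\<xi>t t) p - Phi_coeff a p * moment \<Omega> (\<xi>t 0) p)"
      by (rule suminf_diff[OF sm[OF t0 t(2)] sm[OF order_refl R']])
    also have "\<dots> \<le> (\<Sum>p. t * A p t)"
      using le by (intro suminf_le summable_diff summable_mult sm sA t0 t(2) R' order_refl)
    also have "\<dots> = t * (\<Sum>p. A p t)" by (rule suminf_mult[OF sA[OF t0 t(2)]])
    finally show ?thesis using t(1) by simp
  qed
  let ?t = "\<lambda>k. \<tau> * inverse (real (Suc k))"
  have t: "0 < ?t k" "?t k \<le> \<tau>" for k
    using R(2) mult_left_mono[of "inverse (real (Suc k))" 1 \<tau>] by (auto simp: inverse_le_1_iff)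
  have t_lim: "?t \<longlonglongrightarrow> 0" using tendsto_mult[OF tendsto_const LIMSEQ_inverse_real_of_nat, of \<tau>] by simp
  have mP: "(\<lambda>x. norm (\<xi>t t x) ^ (p - 2) * (\<xi>t t x \<bullet> \<eta> x)) \<in> borel_measurable ?E" for p t
    by measurable
  have "(\<lambda>k. A p (?t k)) \<longlonglongrightarrow> A p 0" for p
  proof (cases "p \<ge> 2")
    case True
    have "(\<lambda>k. LINT x|?E. norm (\<xi>t (?t k) x) ^ (p - 2) * (\<xi>t (?t k) x \<bullet> \<eta> x)) \<longlonglongrightarrow>
        (LINT x|?E. norm (\<xi>t 0 x) ^ (p - 2) * (\<xi>t 0 x \<bullet> \<eta> x))"
    proof (rule integral_dominated_convergence[where w = "\<lambda>_. R ^ p * M / R"])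
      show "AE x in ?E. (\<lambda>k. norm (\<xi>t (?t k) x) ^ (p - 2) * (\<xi>t (?t k) x \<bullet> \<eta> x)) \<longlonglongrightarrow> norm (\<xi>t 0 x) ^ (p - 2) * (\<xi>t 0 x \<bullet> \<eta> x)"
        unfolding \<xi>t_def by (intro AE_I2 tendsto_intros t_lim)
      show "AE x in ?E. norm (norm (\<xi>t (?t k) x) ^ (p - 2) * (\<xi>t (?t k) x \<bullet> \<eta> x)) \<le> R ^ p * M / R" for k
        using bd[OF less_imp_le[OF t(1)[of k]] t(2)] \<eta>b
      proof eventually_elim
        case (elim x)
        from p_integrand_bound[OF True elim R(1)] show ?case unfolding real_norm_def .
      qed
    qed (simp_all add: mP)
    then show ?thesis using True by (simp add: A_def tendsto_mult_left)
  qed (simp add: A_def)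
  \<comment> \<open>Termwise convergence and the majorant \<open>B\<close> give convergence of the
    sums, by Tannery's theorem.\<close>
  then have "(\<lambda>k. \<Sum>p. A p (?t k)) \<longlonglongrightarrow> (\<Sum>p. A p 0)"
  proof (rule tannerys_theorem[THEN conjunct2, THEN conjunct2])
    show "\<forall>\<^sub>F (p, k) in at_top \<times>\<^sub>F sequentially. norm (A p (?t k)) \<le> B p"
      using AB[OF less_imp_le[OF t(1)] t(2)] by (intro always_eventually) auto
  qed (use sB in auto)
  then have "I \<le> (\<Sum>p. A p 0)" using IA[OF t] by (intro LIMSEQ_le_const) auto
  then show ?thesis unfolding A_def \<xi>0 .
qed

text \<open>A value of size \<epsilon> at one point persists at size \<epsilon>/2 on a ball whose
  radius depends only on \<epsilon> and the common Lipschitz constant. Small integrals therefore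
  exclude it, uniformly in the point.\<close>

lemma uniform_limit_if_L1_tendsto:
  fixes Z :: "nat \<Rightarrow> 'a::euclidean_space \<Rightarrow> real"
  assumes lip: "\<And>k. L-lipschitz_on UNIV (Z k)" and int: "\<And>k. integrable lborel (\<lambda>x. \<bar>Z k x\<bar>)"
    and lim: "(\<lambda>k. LINT x|lborel. \<bar>Z k x\<bar>) \<longlonglongrightarrow> 0"
  shows "uniform_limit UNIV Z (\<lambda>_. 0) sequentially"
  unfolding uniform_limit_sequentially_iff
proof (intro allI impI)
  fix \<epsilon> :: real assume \<epsilon>: "\<epsilon> > 0"
  have L: "L \<ge> 0" using lip lipschitz_on_nonneg by blast
  define r where "r = \<epsilon> / (2 * (L + 1))"
  have r: "r > 0" "L * r \<le> \<epsilon> / 2" using \<epsilon> L by (auto simp: r_def field_simps)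
  let ?V = "unit_ball_vol (real DIM('a)) * r ^ DIM('a)"
  have V: "?V > 0" using r by simp
  obtain k0 where k0: "\<And>k. k \<ge> k0 \<Longrightarrow> \<bar>LINT x|lborel. \<bar>Z k x\<bar>\<bar> < \<epsilon> / 2 * ?V"
    using LIMSEQ_D[OF lim, of "\<epsilon> / 2 * ?V"] \<epsilon> V by (auto simp del: unit_ball_vol_pos)
  have "dist (Z k x) 0 < \<epsilon>" if k: "k \<ge> k0" for k x
  proof (rule ccontr)
    assume "\<not> dist (Z k x) 0 < \<epsilon>"
    then have Zx: "\<bar>Z k x\<bar> \<ge> \<epsilon>" by simp
    have "\<bar>Z k y\<bar> \<ge> \<epsilon> / 2" if "y \<in> ball x r" for y
    proof -
      have "\<bar>Z k x - Z k y\<bar> \<le> L * dist x y" using lipschitz_onD[OF lip, of x y k] by (simp add: dist_real_def)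
      also have "\<dots> \<le> L * r" using that L by (intro mult_left_mono) auto
      finally show ?thesis using Zx r(2) by linarith
    qed
    then have "(LINT y|lborel. \<epsilon> / 2 * indicator (ball x r) y) \<le> (LINT y|lborel. \<bar>Z k y\<bar>)"
      using int emeasure_bounded_finite[of "ball x r"] \<epsilon>
      by (intro integral_mono integrable_mult_right integrable_real_indicator) (auto simp: indicator_def)
    moreover have "(LINT y|lborel. \<epsilon> / 2 * indicator (ball x r) y) = \<epsilon> / 2 * ?V"
      using r by (simp add: content_ball)
    ultimately show False using k0[OF k] by linarith
  qed
  then show "\<exists>k0. \<forall>k\<ge>k0. \<forall>x\<in>UNIV. dist (Z k x) 0 < \<epsilon>" by blast
qed

subsection \<open>Convergence of the truncated problems\<close>

theorem theorem4p8:
  fixes \<Omega> :: "'a::euclidean_space set"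
    and a :: "nat \<Rightarrow> real" and \<sigma> K :: real
    and f g gbar u :: "'a \<Rightarrow> real" and un :: "nat \<Rightarrow> 'a \<Rightarrow> real"
  assumes "open \<Omega>" "connected \<Omega>" "bounded \<Omega>" "\<Omega> \<noteq> {}" "lipschitz_boundary \<Omega>"
    and "\<forall>p\<ge>2. a p \<ge> 0" "a 2 > 0" "infinite {p. p \<ge> 2 \<and> a p \<noteq> 0}"
    and "\<sigma> > 0" "ereal (1 / \<sigma>) = limsup (\<lambda>p. ereal (root p (a p)))"
    and "g \<in> C01 (frontier \<Omega>)" "lip_const (frontier \<Omega>) g \<le> \<sigma>"
    and "integrable (lebesgue_on \<Omega>) f"
    and "gbar \<in> S \<Omega> \<sigma> g" "F a \<sigma> \<Omega> f gbar < \<infinity>"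
    and "is_arg_min (F a \<sigma> \<Omega> f) (\<lambda>v. v \<in> S \<Omega> \<sigma> g) u"
    and "\<forall>n>DIM('a). is_arg_min (F_trunc a n \<Omega> f)
           (\<lambda>v. v \<in> W1 \<Omega> n \<and> (\<lambda>x. v x - gbar x) \<in> W1_0 \<Omega> n) (un n)"
    and "\<forall>n>DIM('a). AE x in lebesgue_on \<Omega>. norm (wgrad \<Omega> (un n) x) \<le> K"
    and "K < \<sigma>"
  shows "(\<exists>U. (\<forall>n>DIM('a). continuous_on (closure \<Omega>) (U n) \<and>
                          (AE x in lebesgue_on \<Omega>. U n x = un n x)) \<and>
              uniform_limit (closure \<Omega>) U u sequentially) \<and>
         (AE x in lebesgue_on \<Omega>. norm (wgrad \<Omega> u x) \<le> K) \<and>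
         weak_solution a \<sigma> \<Omega> f g u \<and>
         (\<forall>\<theta>. K / \<sigma> < \<theta> \<and> \<theta> < 1 \<longrightarrow> (\<exists>C>0. \<forall>n>DIM('a).
            ereal (a 2 / 2 * (LINT x|lebesgue_on \<Omega>. (norm (wgrad \<Omega> (un n) x - wgrad \<Omega> u x))\<^sup>2))
              \<le> F a \<sigma> \<Omega> f (un n) - F a \<sigma> \<Omega> f u \<and>
            F a \<sigma> \<Omega> f (un n) - F a \<sigma> \<Omega> f u
              \<le> ereal (measure lebesgue \<Omega> * (\<Sum>\<^sub>\<infinity>p\<in>{n<..}. a p / real p * K ^ p)) \<and>
            measure lebesgue \<Omega> * (\<Sum>\<^sub>\<infinity>p\<in>{n<..}. a p / real p * K ^ p) \<le> C * \<theta> ^ n))"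
proof -
  let ?E = "lebesgue_on \<Omega>"
  let ?c = "Phi_coeff a"
  note \<Omega> = assms(1,3) and a = assms(6) and \<sigma> = assms(9) and f = assms(13) and K\<sigma> = assms(19)
  note bK = assms(18)[rule_format]
  have s\<Omega>: "\<Omega> \<in> sets lebesgue" using \<Omega>(1) by (simp add: borel_open lmeasurable_open)
  have inE: "AE x in ?E. x \<in> \<Omega>" using s\<Omega> by (simp add: AE_restrict_space_iff)
  interpret finite_measure ?E by (rule finite_measure_lebesgue_on_open[OF \<Omega>])
  have dim: "2 \<le> n" "1 \<le> n" if "n > DIM('a)" for n using that DIM_positive[where 'a = 'a] by linarith+
  \<comment> \<open>A negative \<open>K\<close> would force the nonempty open domain to be a null
    set.\<close>
  have K0: "K \<ge> 0"
  proof (rule ccontr)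
    assume "\<not> K \<ge> 0"
    have "AE x in ?E. False" using bK[OF lessI]
    proof eventually_elim
      case (elim x)
      then show ?case using \<open>\<not> K \<ge> 0\<close> norm_ge_zero[of "wgrad \<Omega> (un (Suc DIM('a))) x"] by linarith
    qed
    then have "AE x in lebesgue. x \<notin> \<Omega>" using s\<Omega> by (simp add: AE_restrict_space_iff)
    then have "\<Omega> \<in> null_sets lebesgue" using s\<Omega> by (subst AE_iff_null_sets)
    then show False using open_not_negligible[OF \<Omega>(1) assms(4)] by (simp add: negligible_iff_null_sets)
  qed
  have rad: "summable (\<lambda>p. \<bar>a p\<bar> * r ^ p)" if "0 \<le> r" "r < \<sigma>" for r
    using summable_below_radius[OF \<sigma> assms(10) a that] .
  have c0: "?c p \<ge> 0" for p by (rule Phi_coeff_nonneg[OF a])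

  \<comment> \<open>Regularity of admissible functions\<close>
  have SD: "\<exists>L. L-lipschitz_on (closure \<Omega>) v" "wgrad \<Omega> v \<in> borel_measurable ?E"
      "has_weak_gradient \<Omega> v (wgrad \<Omega> v)"
      "AE x in ?E. norm (wgrad \<Omega> v x) \<le> \<sigma>" "\<And>x. x \<in> frontier \<Omega> \<Longrightarrow> v x = g x" "integrable ?E (\<lambda>x. f x * v x)"
    if v: "v \<in> S \<Omega> \<sigma> g" for v
  proof -
    obtain L where L: "L-lipschitz_on (closure \<Omega>) v" using v by (auto simp: S_def C01_def)
    then show "\<exists>L. L-lipschitz_on (closure \<Omega>) v" by blast
    have L': "L-lipschitz_on \<Omega> v" using L closure_subset by (rule lipschitz_on_subset)
    show "wgrad \<Omega> v \<in> borel_measurable ?E" "has_weak_gradient \<Omega> v (wgrad \<Omega> v)"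
      using lipschitz_wgrad[OF \<Omega> L'] by auto
    show "AE x in ?E. norm (wgrad \<Omega> v x) \<le> \<sigma>" "\<And>x. x \<in> frontier \<Omega> \<Longrightarrow> v x = g x"
      using v by (auto simp: S_def)
    show "integrable ?E (\<lambda>x. f x * v x)" by (rule integrable_times_lipschitz[OF \<Omega> f L'])
  qed

  \<comment> \<open>Real-valued form of the energy and minimality of \<open>u\<close>\<close>
  define En where "En w = (\<Sum>p. ?c p * moment \<Omega> w p)" for w
  define fin where "fin w \<longleftrightarrow> summable (\<lambda>p. ?c p * moment \<Omega> w p)" for w
  define J where "J v = (LINT x|?E. f x * v x)" for v
  have F_S: "F a \<sigma> \<Omega> f v = (if fin (wgrad \<Omega> v) then ereal (En (wgrad \<Omega> v) - J v) else \<infinity>)"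
    if "v \<in> S \<Omega> \<sigma> g" for v
    unfolding En_def fin_def J_def using F_eq[OF \<Omega> a SD(2,4)[OF that]] .
  have fin_lt: "fin w" if "w \<in> borel_measurable ?E" "AE x in ?E. norm (w x) \<le> r" "0 \<le> r" "r < \<sigma>" for w r
    unfolding fin_def using summable_energy[OF \<Omega> a that(1,2) rad[OF that(3,4)]] .

  have uS: "u \<in> S \<Omega> \<sigma> g" and umin: "\<And>v. v \<in> S \<Omega> \<sigma> g \<Longrightarrow> F a \<sigma> \<Omega> f u \<le> F a \<sigma> \<Omega> f v"
    using assms(16) by (auto simp: is_arg_min_linorder)
  let ?\<xi> = "wgrad \<Omega> u"
  note u = SD[OF uS] and gb = SD[OF assms(14)]
  have finu: "fin ?\<xi>"
    using umin[OF assms(14)] assms(15) F_S[OF uS] by (cases "fin ?\<xi>") auto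
  have Fu: "F a \<sigma> \<Omega> f u = ereal (En ?\<xi> - J u)" using F_S[OF uS] finu by simp
  have umin': "En ?\<xi> - J u \<le> En (wgrad \<Omega> v) - J v" if "v \<in> S \<Omega> \<sigma> g" "fin (wgrad \<Omega> v)" for v
    using umin[OF that(1)] that(2) by (simp add: Fu F_S[OF that(1)])
  obtain Lu where Lu: "Lu-lipschitz_on (closure \<Omega>) u" using u(1) by blast
  obtain Lg where Lg: "Lg-lipschitz_on (closure \<Omega>) gbar" using gb(1) by blast

  \<comment> \<open>Lipschitz representatives of the truncated minimizers\<close>
  define M where "M = K + \<sigma>"
  have M: "M \<ge> 0" using K0 \<sigma> by (simp add: M_def)
  have "\<exists>V. M-lipschitz_on UNIV V \<and> (\<forall>x. x \<notin> \<Omega> \<longrightarrow> V x = 0) \<and> (AE x in ?E. gbar x + V x = un n x)"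
    if n: "n > DIM('a)" for n
  proof -
    have un: "un n \<in> W1 \<Omega> n" "(\<lambda>x. un n x - gbar x) \<in> W1_0 \<Omega> n"
      using assms(17) n by (auto simp: is_arg_min_def)
    obtain w where w: "has_weak_gradient \<Omega> (un n) w" using un(1) by (auto simp: W1_def)
    have "AE x in ?E. norm (wgrad \<Omega> (\<lambda>x. un n x - gbar x) x) \<le> M"
      using wgrad_lincomb[OF \<Omega>(1) w gb(3), of 1 "-1"] bK[OF n] gb(4)
    proof eventually_elim
      case (elim x)
      then show ?case
        using norm_triangle_ineq4[of "wgrad \<Omega> (un n) x" "wgrad \<Omega> gbar x"] by (simp add: M_def)
    qed
    then obtain V where V: "M-lipschitz_on UNIV V"
      "AE x in lebesgue. V x = (if x \<in> \<Omega> then un n x - gbar x else 0)"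
      by (rule W1_0_lipschitz_representative[OF \<Omega> dim(2)[OF n] un(2) M]) blast
    have "AE x in lebesgue. x \<notin> \<Omega> \<longrightarrow> V x = 0" using V(2) by eventually_elim simp
    then have "V x = 0" if "x \<notin> \<Omega>" for x
      using zero_off_domain[OF \<Omega>(1) assms(5) lipschitz_on_continuous_on[OF V(1)] _ that] by blast
    moreover have "AE x in lebesgue. x \<in> \<Omega> \<longrightarrow> gbar x + V x = un n x" using V(2) by eventually_elim simp
    then have "AE x in ?E. gbar x + V x = un n x" using s\<Omega> by (simp add: AE_restrict_space_iff)
    ultimately show ?thesis using V(1) by blast
  qed
  then obtain V where V: "\<And>n. n > DIM('a) \<Longrightarrow> M-lipschitz_on UNIV (V n)"
    "\<And>n x. n > DIM('a) \<Longrightarrow> x \<notin> \<Omega> \<Longrightarrow> V n x = 0"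
    "\<And>n. n > DIM('a) \<Longrightarrow> AE x in ?E. gbar x + V n x = un n x"
    by metis
  define U where "U n x = gbar x + V n x" for n x
  have Ulip: "(Lg + M)-lipschitz_on (closure \<Omega>) (U n)" if "n > DIM('a)" for n
    unfolding U_def[abs_def] using lipschitz_on_subset[OF V(1)[OF that]] by (intro lipschitz_on_add Lg) auto
  have Uun: "AE x in ?E. U n x = un n x" if "n > DIM('a)" for n unfolding U_def by (rule V(3)[OF that])
  have wU: "wgrad \<Omega> (U n) = wgrad \<Omega> (un n)" if "n > DIM('a)" for n
    by (rule wgrad_cong_AE[OF \<Omega>(1) Uun[OF that]])
  have US: "U n \<in> S \<Omega> \<sigma> g" if n: "n > DIM('a)" for n
  proof -
    have "AE x in ?E. norm (wgrad \<Omega> (U n) x) \<le> \<sigma>"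
      unfolding wU[OF n] using bK[OF n] by eventually_elim (use K\<sigma> in simp)
    moreover have "U n x = g x" if "x \<in> frontier \<Omega>" for x
    proof -
      have "x \<notin> \<Omega>" using that \<Omega>(1) by (auto simp: frontier_def interior_open)
      then show ?thesis using gb(5)[OF that] V(2)[OF n] by (simp add: U_def)
    qed
    ultimately show ?thesis using Ulip[OF n] by (auto simp: S_def C01_def)
  qed
  have JU: "J (U n) = J (un n)" if "n > DIM('a)" for n
    unfolding J_def
    by (rule lebesgue_on_cong_AE(3)[OF s\<Omega>]) (use Uun[OF that] in \<open>eventually_elim, simp\<close>)
  have mun: "wgrad \<Omega> (un n) \<in> borel_measurable ?E" if "n > DIM('a)" for n
    using SD(2)[OF US[OF that]] wU[OF that] by simp
  have finn: "fin (wgrad \<Omega> (un n))" if "n > DIM('a)" for n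
    by (rule fin_lt[OF mun[OF that] bK[OF that] K0 K\<sigma>])
  \<comment> \<open>The functional depends on its argument only through \<open>wgrad\<close> and an
    integral, so replacing \<open>un n\<close> by its Lipschitz representative does not change its
    value.\<close>
  have Fun: "F a \<sigma> \<Omega> f (un n) = ereal (En (wgrad \<Omega> (un n)) - J (un n))" if "n > DIM('a)" for n
  proof -
    have "F a \<sigma> \<Omega> f (un n) = F a \<sigma> \<Omega> f (U n)"
      using JU[OF that] by (simp add: F_def wU[OF that] J_def)
    then show ?thesis using F_S[OF US[OF that]] finn[OF that] by (simp add: wU[OF that] JU[OF that])
  qed

  \<comment> \<open>Lower bound of the energy gap by strong convexity\<close>
  define D where "D n = (LINT x|?E. (norm (wgrad \<Omega> (un n) x - ?\<xi> x))\<^sup>2)" for n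
  have D0: "D n \<ge> 0" for n by (simp add: D_def)
  have lower: "a 2 / 2 * D n \<le> (En (wgrad \<Omega> (un n)) - J (un n)) - (En ?\<xi> - J u)" if n: "n > DIM('a)" for n
  proof (rule field_le_mult_one_interval)
    fix z :: real assume z: "0 < z" "z < 1"
    define t where "t = 1 - z"
    have t: "0 < t" "t < 1" using z by (auto simp: t_def)
    define v where "v x = t * U n x + (1 - t) * u x" for x
    have wv: "AE x in ?E. wgrad \<Omega> v x = t *\<^sub>R wgrad \<Omega> (un n) x + (1 - t) *\<^sub>R ?\<xi> x"
      unfolding v_def[abs_def] wU[OF n, symmetric] by (rule wgrad_lincomb[OF \<Omega>(1) SD(3)[OF US[OF n]] u(3)])
    have bv: "AE x in ?E. norm (wgrad \<Omega> v x) \<le> \<sigma>"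
      using wv bK[OF n] u(4)
    proof eventually_elim
      case (elim x)
      have "norm (wgrad \<Omega> v x) \<le> t * norm (wgrad \<Omega> (un n) x) + (1 - t) * norm (?\<xi> x)"
        unfolding elim(1) using t norm_triangle_ineq[of "t *\<^sub>R wgrad \<Omega> (un n) x" "(1 - t) *\<^sub>R ?\<xi> x"] by simp
      also have "\<dots> \<le> t * \<sigma> + (1 - t) * \<sigma>" using elim K\<sigma> t by (intro add_mono mult_left_mono) auto
      finally show ?case by (simp add: algebra_simps)
    qed
    have "(t * (Lg + M) + (1 - t) * Lu)-lipschitz_on (closure \<Omega>) v"
      unfolding v_def[abs_def] using t by (intro lipschitz_on_add lipschitz_on_cmult_real_nonneg Ulip[OF n] Lu) auto
    moreover have "v x = g x" if "x \<in> frontier \<Omega>" for x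
      using SD(5)[OF US[OF n] that] u(5)[OF that] by (simp add: v_def algebra_simps)
    ultimately have vS: "v \<in> S \<Omega> \<sigma> g" using bv by (auto simp: S_def C01_def)
    note v = SD[OF vS]
    note sc = energy_strongly_convex[OF \<Omega> a mun[OF n] _ u(2,4) finn[OF n, unfolded fin_def] finu[unfolded fin_def]
        less_imp_le[OF t(1)] less_imp_le[OF t(2)] v(2) bv wv]
    have bn: "AE x in ?E. norm (wgrad \<Omega> (un n) x) \<le> \<sigma>"
      using bK[OF n] by eventually_elim (use K\<sigma> in simp)
    have "fin (wgrad \<Omega> v)" unfolding fin_def by (rule sc(1)[OF bn])
    then have "En ?\<xi> - J u \<le> En (wgrad \<Omega> v) - J v" by (rule umin'[OF vS])
    moreover have "En (wgrad \<Omega> v) + a 2 / 2 * (t * (1 - t)) * D n \<le> t * En (wgrad \<Omega> (un n)) + (1 - t) * En ?\<xi>"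
      unfolding En_def D_def by (rule sc(2)[OF bn])
    moreover have "J v = t * J (un n) + (1 - t) * J u"
    proof -
      have "J v = (LINT x|?E. t * (f x * U n x) + (1 - t) * (f x * u x))"
        by (simp add: J_def v_def algebra_simps)
      also have "\<dots> = t * J (U n) + (1 - t) * J u"
        unfolding J_def using SD(6)[OF US[OF n]] u(6) by simp
      finally show ?thesis by (simp add: JU[OF n])
    qed
    moreover have "a 2 / 2 * (t * (1 - t)) * D n = t * (z * (a 2 / 2 * D n))" by (simp add: t_def)
    moreover have "t * ((x - y) - (x' - y')) = (t * x + (1 - t) * x') - (t * y + (1 - t) * y') - (x' - y')" for x y x' y'
      by (simp add: algebra_simps)
    ultimately have "t * (z * (a 2 / 2 * D n)) \<le> t * ((En (wgrad \<Omega> (un n)) - J (un n)) - (En ?\<xi> - J u))"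
      by (simp only:)
    then show "z * (a 2 / 2 * D n) \<le> (En (wgrad \<Omega> (un n)) - J (un n)) - (En ?\<xi> - J u)"
      using t(1) by simp
  qed

  \<comment> \<open>Upper bound of the energy gap by the tail of the series\<close>
  define T where "T n = (\<Sum>i. ?c (i + Suc n) * K ^ (i + Suc n))" for n
  have sK: "summable (\<lambda>p. ?c p * K ^ p)"
  proof (rule summable_comparison_test[OF _ rad[OF K0 K\<sigma>]], intro exI allI impI)
    fix p
    have "?c p \<le> \<bar>a p\<bar>" using a divide_left_mono[of 1 "real p" "a p"] by (auto simp: Phi_coeff_def)
    then show "norm (?c p * K ^ p) \<le> \<bar>a p\<bar> * K ^ p" using c0[of p] K0 by (simp add: mult_right_mono)
  qed
  have T: "(\<Sum>\<^sub>\<infinity>p\<in>{n<..}. a p / real p * K ^ p) = T n" if n: "n > DIM('a)" for n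
  proof -
    \<comment> \<open>The terms up to index \<open>n\<close> vanish, so the shift by
      \<open>Suc n\<close> begins exactly at the first term kept. There \<open>n \<ge> 2\<close>
      makes \<open>Phi_coeff\<close> equal to \<open>a p / real p\<close>.\<close>
    let ?h = "\<lambda>p. if p \<in> {n<..} then a p / real p * K ^ p else 0"
    have h: "?h (p + Suc n) = ?c (p + Suc n) * K ^ (p + Suc n)" for p
      using dim[OF n] by (auto simp: Phi_coeff_def)
    have s: "summable (\<lambda>p. ?c (p + Suc n) * K ^ (p + Suc n))"
      using sK by (subst summable_iff_shift[of "\<lambda>p. ?c p * K ^ p"])
    have nn: "norm (?h p) = ?h p" for p using a dim[OF n] K0 by auto
    have sh: "summable ?h" using s unfolding h[symmetric] by (subst (asm) summable_iff_shift[of ?h])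
    then have "(\<Sum>\<^sub>\<infinity>p\<in>{n<..}. a p / real p * K ^ p) = suminf ?h"
      by (intro infsum_eq_suminf_if(2)) (simp only: nn)
    also have "\<dots> = (\<Sum>p. ?h (p + Suc n)) + sum ?h {..<Suc n}" by (rule suminf_split_initial_segment[OF sh])
    also have "sum ?h {..<Suc n} = 0" by (intro sum.neutral) auto
    finally show ?thesis unfolding h T_def by simp
  qed
  have upper: "(En (wgrad \<Omega> (un n)) - J (un n)) - (En ?\<xi> - J u) \<le> measure lebesgue \<Omega> * T n" if n: "n > DIM('a)" for n
  proof -
    let ?m = "\<lambda>v p. ?c p * moment \<Omega> (wgrad \<Omega> v) p"
    have Ft: "F_trunc a n \<Omega> f v = sum (?m v) {..<Suc n} - J v" for v
    proof -
      have "sum (?m v) {..<Suc n} = (\<Sum>p=2..n. a p / real p * moment \<Omega> (wgrad \<Omega> v) p)"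
        by (rule sum.mono_neutral_cong_right) (auto simp: Phi_coeff_def)
      then show ?thesis by (simp add: F_trunc_def J_def moment_def)
    qed
    \<comment> \<open>Both functions equal \<open>g\<close> on the frontier, so their difference
      extends by zero to a Lipschitz function; this makes \<open>u\<close> a competitor for
      \<open>un n\<close>.\<close>
    have "(\<lambda>x. u x - gbar x) \<in> W1_0 \<Omega> n"
    proof (rule lipschitz_in_W1_0[OF \<Omega> dim(2)[OF n]])
      show "(Lu + Lg)-lipschitz_on UNIV (\<lambda>x. if x \<in> \<Omega> then u x - gbar x else 0)"
        by (rule lipschitz_extend_by_zero) (auto intro!: lipschitz_on_diff Lu Lg simp: u(5) gb(5))
    qed auto
    moreover have "u \<in> W1 \<Omega> n"
      using lipschitz_in_W1[OF \<Omega> lipschitz_on_subset[OF Lu closure_subset]] .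
    ultimately have "F_trunc a n \<Omega> f (un n) \<le> F_trunc a n \<Omega> f u"
      using assms(17) n by (auto simp: is_arg_min_linorder)
    then have "sum (?m (un n)) {..<Suc n} - J (un n) \<le> sum (?m u) {..<Suc n} - J u" unfolding Ft .
    moreover have "sum (?m u) {..<Suc n} \<le> En ?\<xi>"
      unfolding En_def using finu by (intro sum_le_suminf) (auto simp: fin_def c0 moment_nonneg)
    moreover have "En (wgrad \<Omega> (un n)) = (\<Sum>i. ?m (un n) (i + Suc n)) + sum (?m (un n)) {..<Suc n}"
      unfolding En_def using finn[OF n] by (intro suminf_split_initial_segment) (simp add: fin_def)
    moreover have "(\<Sum>i. ?m (un n) (i + Suc n)) \<le> (\<Sum>i. measure lebesgue \<Omega> * (?c (i + Suc n) * K ^ (i + Suc n)))"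
    proof (rule suminf_le)
      fix i
      show "?m (un n) (i + Suc n) \<le> measure lebesgue \<Omega> * (?c (i + Suc n) * K ^ (i + Suc n))"
        using mult_left_mono[OF moment_le[OF \<Omega> mun[OF n] bK[OF n], of "i + Suc n"] c0[of "i + Suc n"]]
        by (simp only: mult.left_commute)
      show "summable (\<lambda>i. ?m (un n) (i + Suc n))"
        using finn[OF n] unfolding fin_def by (rule summable_ignore_initial_segment)
      show "summable (\<lambda>i. measure lebesgue \<Omega> * (?c (i + Suc n) * K ^ (i + Suc n)))"
        using summable_ignore_initial_segment[OF sK, of "Suc n"] by (rule summable_mult)
    qed
    moreover have "(\<Sum>i. measure lebesgue \<Omega> * (?c (i + Suc n) * K ^ (i + Suc n))) = measure lebesgue \<Omega> * T n"
      unfolding T_def using summable_ignore_initial_segment[OF sK, of "Suc n"] by (rule suminf_mult)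
    ultimately show ?thesis by linarith
  qed

  \<comment> \<open>Geometric decay of the tail\<close>
  have geo: "\<exists>C>0. \<forall>n. measure lebesgue \<Omega> * T n \<le> C * \<theta> ^ n" if \<theta>: "K / \<sigma> < \<theta>" "\<theta> < 1" for \<theta>
  proof -
    have \<theta>0: "\<theta> > 0" using \<theta>(1) K0 \<sigma> by (meson divide_nonneg_pos le_less_trans)
    \<comment> \<open>The condition on \<theta> says exactly that \<open>r\<close> is below the
      radius of convergence. In K^p = r^p \<theta>^p the factor \<theta>^p is at most \<theta>^n on
      the tail, and the rest is summable.\<close>
    define r where "r = K / \<theta>"
    have r: "0 \<le> r" "r < \<sigma>" "K = r * \<theta>" using K0 \<theta>0 \<theta> \<sigma> by (auto simp: r_def field_simps)
    let ?s = "\<Sum>p. \<bar>a p\<bar> * r ^ p"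
    note sr = rad[OF r(1,2)]
    have s0: "?s \<ge> 0" using r by (intro suminf_nonneg sr) auto
    have Tn: "T n \<le> \<theta> ^ n * ?s" for n
    proof -
      have sr': "summable (\<lambda>i. \<bar>a (i + Suc n)\<bar> * r ^ (i + Suc n))" using sr by (rule summable_ignore_initial_segment)
      have "T n \<le> (\<Sum>i. \<theta> ^ n * (\<bar>a (i + Suc n)\<bar> * r ^ (i + Suc n)))" unfolding T_def
      proof (rule suminf_le)
        fix i
        let ?p = "i + Suc n"
        have "?c ?p \<le> \<bar>a ?p\<bar>" using a divide_left_mono[of 1 "real ?p" "a ?p"] by (auto simp: Phi_coeff_def)
        then have le: "?c ?p * r ^ ?p \<le> \<bar>a ?p\<bar> * r ^ ?p" using r by (intro mult_right_mono) auto
        have "\<theta> ^ ?p \<le> \<theta> ^ n" using \<theta>0 \<theta> by (intro power_decreasing) auto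
        then have "\<theta> ^ ?p * (?c ?p * r ^ ?p) \<le> \<theta> ^ n * (\<bar>a ?p\<bar> * r ^ ?p)"
          by (rule mult_mono[OF _ le]) (use \<theta>0 r(1) in \<open>auto intro!: mult_nonneg_nonneg c0\<close>)
        then show "?c ?p * K ^ ?p \<le> \<theta> ^ n * (\<bar>a ?p\<bar> * r ^ ?p)"
          by (simp only: r(3) power_mult_distrib mult_ac)
        show "summable (\<lambda>i. ?c (i + Suc n) * K ^ (i + Suc n))"
          using sK by (rule summable_ignore_initial_segment)
        show "summable (\<lambda>i. \<theta> ^ n * (\<bar>a (i + Suc n)\<bar> * r ^ (i + Suc n)))" using sr' by (rule summable_mult)
      qed
      also have "\<dots> = \<theta> ^ n * (\<Sum>i. \<bar>a (i + Suc n)\<bar> * r ^ (i + Suc n))" by (rule suminf_mult[OF sr'])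
      also have "\<dots> \<le> \<theta> ^ n * ?s"
        using suminf_split_initial_segment[OF sr, of "Suc n"] \<theta>0 r
        by (intro mult_left_mono) (auto intro!: add_nonneg_nonneg sum_nonneg)
      finally show ?thesis .
    qed
    \<comment> \<open>The summand 1 ensures that the constant is strictly positive.\<close>
    have "measure lebesgue \<Omega> * T n \<le> (measure lebesgue \<Omega> * ?s + 1) * \<theta> ^ n" for n
    proof -
      have "measure lebesgue \<Omega> * T n \<le> measure lebesgue \<Omega> * (\<theta> ^ n * ?s)" by (intro mult_left_mono Tn) auto
      also have "\<dots> \<le> (measure lebesgue \<Omega> * ?s + 1) * \<theta> ^ n" using \<theta>0 by (simp add: algebra_simps)
      finally show ?thesis .
    qed
    moreover have "measure lebesgue \<Omega> * ?s + 1 > 0" using s0 by (intro add_nonneg_pos mult_nonneg_nonneg) auto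
    ultimately show ?thesis by blast
  qed

  \<comment> \<open>Mean square convergence of the gradients\<close>
  have dk: "DIM('a) < k + Suc (DIM('a))" for k by simp
  have D_lim: "(\<lambda>k. D (k + Suc (DIM('a)))) \<longlonglongrightarrow> 0"
  proof -
    obtain \<theta> where \<theta>: "K / \<sigma> < \<theta>" "\<theta> < 1" using K\<sigma> \<sigma> dense[of "K / \<sigma>" 1] by auto
    have \<theta>0: "\<theta> > 0" using \<theta>(1) K0 \<sigma> by (meson divide_nonneg_pos le_less_trans)
    obtain C where C: "\<And>n. measure lebesgue \<Omega> * T n \<le> C * \<theta> ^ n" using geo[OF \<theta>] by blast
    have le: "D n \<le> 2 / a 2 * (C * \<theta> ^ n)" if "n > DIM('a)" for n
    proof -
      have "a 2 / 2 * D n \<le> C * \<theta> ^ n" using lower[OF that] upper[OF that] C[of n] by linarith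
      then show ?thesis using assms(7) by (simp add: field_simps)
    qed
    have "(\<lambda>n. 2 / a 2 * (C * \<theta> ^ n)) \<longlonglongrightarrow> 2 / a 2 * (C * 0)"
      using \<theta> \<theta>0 by (intro tendsto_intros LIMSEQ_realpow_zero) auto
    then have "(\<lambda>k. 2 / a 2 * (C * \<theta> ^ (k + Suc (DIM('a))))) \<longlonglongrightarrow> 0"
      by (intro LIMSEQ_ignore_initial_segment[of "\<lambda>n. 2 / a 2 * (C * \<theta> ^ n)"]) simp
    then show ?thesis
      by (rule tendsto_sandwich[OF _ _ tendsto_const, rotated 2]) (use D0 le[OF dk] in \<open>auto simp del: power_Suc\<close>)
  qed
  have iD: "integrable ?E (\<lambda>x. norm (wgrad \<Omega> (un n) x - ?\<xi> x) ^ p)" if n: "n > DIM('a)" for n p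
  proof (rule integrable_norm_power[OF \<Omega>])
    show "(\<lambda>x. wgrad \<Omega> (un n) x - ?\<xi> x) \<in> borel_measurable ?E" using mun[OF n] u(2) by measurable
    show "AE x in ?E. norm (wgrad \<Omega> (un n) x - ?\<xi> x) \<le> K + \<sigma>" using bK[OF n] u(4)
    proof eventually_elim
      case (elim x)
      then show ?case using norm_triangle_ineq4[of "wgrad \<Omega> (un n) x" "?\<xi> x"] by linarith
    qed
  qed

  \<comment> \<open>The gradient bound for the minimizer\<close>
  have uK: "AE x in ?E. norm (?\<xi> x) \<le> K"
  proof -
    \<comment> \<open>Since the other gradient has norm at most \<open>K\<close>, the excess over
      \<open>K\<close> is at most the distance of the gradients. Its square thus has an integral
      below every \<open>D n\<close> with n > N, so no a.e. convergent subsequence is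
      needed.\<close>
    let ?q = "\<lambda>x. (max 0 (norm (?\<xi> x) - K))\<^sup>2"
    have iq: "integrable ?E ?q"
    proof (rule integrable_bounded_on[OF \<Omega>])
      show "?q \<in> borel_measurable ?E" using u(2) by measurable
      show "AE x in ?E. norm (?q x) \<le> \<sigma>\<^sup>2" using u(4)
        by eventually_elim (use K0 \<sigma> in \<open>auto intro!: power_mono\<close>)
    qed
    have "(LINT x|?E. ?q x) \<le> D (k + Suc (DIM('a)))" for k
      unfolding D_def
    proof (rule integral_mono_AE[OF iq iD[OF dk]])
      show "AE x in ?E. ?q x \<le> (norm (wgrad \<Omega> (un (k + Suc (DIM('a)))) x - ?\<xi> x))\<^sup>2"
        using bK[OF dk[of k]]
      proof eventually_elim
        case (elim x)
        have "max 0 (norm (?\<xi> x) - K) \<le> norm (wgrad \<Omega> (un (k + Suc (DIM('a)))) x - ?\<xi> x)"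
          using elim norm_triangle_ineq2[of "?\<xi> x" "wgrad \<Omega> (un (k + Suc (DIM('a)))) x"]
          by (simp add: norm_minus_commute)
        then show ?case by (intro power_mono) auto
      qed
    qed
    then have "(LINT x|?E. ?q x) \<le> 0" using D_lim by (intro LIMSEQ_le_const) auto
    then have "(LINT x|?E. ?q x) = 0" by (simp add: antisym)
    then have "AE x in ?E. ?q x = 0" by (subst (asm) integral_nonneg_eq_0_iff_AE[OF iq]) auto
    then show ?thesis by eventually_elim simp
  qed

  \<comment> \<open>Uniform convergence\<close>
  have unif: "uniform_limit (closure \<Omega>) U u sequentially"
  proof -
    let ?n = "\<lambda>k. k + Suc (DIM('a))"
    \<comment> \<open>The common boundary values make this Lipschitz on the whole space with a
      constant independent of \<open>k\<close>. The index shift restricts attention to the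
      \<open>n\<close> for which the bounds are available.\<close>
    define Z where "Z k x = (if x \<in> \<Omega> then U (?n k) x - u x else 0)" for k x
    define L where "L = Lg + M + Lu"
    have Zl: "L-lipschitz_on UNIV (Z k)" for k
      unfolding Z_def[abs_def] L_def
    proof (rule lipschitz_extend_by_zero)
      show "(Lg + M + Lu)-lipschitz_on (closure \<Omega>) (\<lambda>x. U (?n k) x - u x)"
        by (intro lipschitz_on_diff Ulip[OF dk] Lu)
      fix x assume x: "x \<in> frontier \<Omega>"
      show "U (?n k) x - u x = 0" by (simp only: SD(5)[OF US[OF dk] x] u(5)[OF x] diff_self)
    qed
    have Z0: "Z k x = 0" if "x \<notin> \<Omega>" for k x using that by (simp add: Z_def)
    have cZ: "continuous_on UNIV (Z k)" for k by (rule lipschitz_on_continuous_on[OF Zl])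
    have iZ: "integrable lborel (\<lambda>x. \<bar>Z k x\<bar>)" for k
      using Z0 by (intro integrable_continuous_bounded_support[OF _ \<Omega>(2)] continuous_intros cZ) auto
    have ZE: "(LINT x|lborel. \<bar>Z k x\<bar>) = (LINT x|?E. \<bar>Z k x\<bar>)" for k
      using Z0 iZ[of k] by (subst lebesgue_on_supported(2)[OF s\<Omega>]) (auto simp: integral_completion)
    have wZ: "AE x in ?E. wgrad \<Omega> (Z k) x = wgrad \<Omega> (un (?n k)) x - ?\<xi> x" for k
    proof -
      have "AE x in ?E. Z k x = 1 * U (?n k) x + (-1) * u x"
        using inE by eventually_elim (simp add: Z_def)
      then have "wgrad \<Omega> (Z k) = wgrad \<Omega> (\<lambda>x. 1 * U (?n k) x + (-1) * u x)" by (rule wgrad_cong_AE[OF \<Omega>(1)])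
      then show ?thesis
        using wgrad_lincomb[OF \<Omega>(1) SD(3)[OF US[OF dk[of k]]] u(3), of 1 "-1"] unfolding wU[OF dk] by simp
    qed
    obtain R where R: "R > 0" "\<And>x. x \<in> \<Omega> \<Longrightarrow> norm x \<le> R" using \<Omega>(2) bounded_pos by metis
    have "(\<lambda>k. LINT x|?E. norm (wgrad \<Omega> (un (?n k)) x - ?\<xi> x)) \<longlonglongrightarrow> 0"
    proof (rule Lp_tendsto_imp_L1_tendsto(2)[OF \<Omega>, of 2])
      show "(\<lambda>x. norm (wgrad \<Omega> (un (?n k)) x - ?\<xi> x)) \<in> borel_measurable ?E" for k
        using mun[OF dk[of k]] u(2) by measurable
      show "(\<lambda>k. LINT x|?E. (norm (wgrad \<Omega> (un (?n k)) x - ?\<xi> x))\<^sup>2) \<longlonglongrightarrow> 0" using D_lim unfolding D_def .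
    qed (use iD[OF dk] in auto)
    then have "(\<lambda>k. 3 * R * (LINT x|?E. norm (wgrad \<Omega> (un (?n k)) x - ?\<xi> x))) \<longlonglongrightarrow> 3 * R * 0"
      by (intro tendsto_intros)
    moreover have "(LINT x|lborel. \<bar>Z k x\<bar>) \<le> 3 * R * (LINT x|?E. norm (wgrad \<Omega> (un (?n k)) x - ?\<xi> x))" for k
    proof -
      have "(LINT x|?E. \<bar>Z k x\<bar>) \<le> 3 * R * (LINT x|?E. norm (wgrad \<Omega> (Z k) x))"
        by (rule poincare_lipschitz[OF \<Omega>(1) R(2,1) Zl Z0])
      also have "(LINT x|?E. norm (wgrad \<Omega> (Z k) x)) = (LINT x|?E. norm (wgrad \<Omega> (un (?n k)) x - ?\<xi> x))"
        by (rule lebesgue_on_cong_AE(3)[OF s\<Omega>]) (use wZ[of k] in \<open>eventually_elim, simp\<close>)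
      finally show ?thesis unfolding ZE .
    qed
    ultimately have "(\<lambda>k. LINT x|lborel. \<bar>Z k x\<bar>) \<longlonglongrightarrow> 3 * R * 0"
      by (intro tendsto_sandwich[where f = "\<lambda>_. 0" and g = "\<lambda>k. LINT x|lborel. \<bar>Z k x\<bar>"]
            always_eventually allI Bochner_Integration.integral_nonneg abs_ge_zero) simp_all
    then have "(\<lambda>k. LINT x|lborel. \<bar>Z k x\<bar>) \<longlonglongrightarrow> 0" by simp
    then have lim: "uniform_limit UNIV Z (\<lambda>_. 0) sequentially" by (rule uniform_limit_if_L1_tendsto[OF Zl iZ])
    show ?thesis unfolding uniform_limit_sequentially_iff
    proof (intro allI impI)
      fix \<epsilon> :: real assume \<epsilon>: "\<epsilon> > 0"
      then obtain k0 where k0: "\<And>k x. k \<ge> k0 \<Longrightarrow> \<bar>Z k x\<bar> < \<epsilon>"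
        using lim unfolding uniform_limit_sequentially_iff dist_real_def diff_0_right by blast
      have "dist (U n x) (u x) < \<epsilon>" if n: "n \<ge> ?n k0" and x: "x \<in> closure \<Omega>" for n x
      proof (cases "x \<in> \<Omega>")
        case True
        have "n = ?n (n - Suc (DIM('a)))" "n - Suc (DIM('a)) \<ge> k0" using n by auto
        then show ?thesis using k0[of "n - Suc (DIM('a))" x] True by (simp add: Z_def dist_real_def)
      next
        case False
        then have "x \<in> frontier \<Omega>" using x \<Omega>(1) by (simp add: frontier_def interior_open)
        then have "U n x = u x" using u(5) SD(5)[OF US, of n] n by simp
        then show ?thesis using \<epsilon> by simp
      qed
      then show "\<exists>n0. \<forall>n\<ge>n0. \<forall>x\<in>closure \<Omega>. dist (U n x) (u x) < \<epsilon>" by blast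
    qed
  qed

  \<comment> \<open>The weak equation\<close>
  have weak: "weak_solution a \<sigma> \<Omega> f g u"
    unfolding weak_solution_def
  proof (intro conjI ballI impI uS)
    fix \<psi> assume \<psi>: "\<psi> \<in> W1_inf_0 \<Omega>"
    obtain L where L: "L-lipschitz_on (closure \<Omega>) \<psi>" using \<psi> by (auto simp: W1_inf_0_def C01_def)
    have \<psi>0: "\<psi> x = 0" if "x \<in> frontier \<Omega>" for x using \<psi> that by (simp add: W1_inf_0_def)
    have L0: "L \<ge> 0" using L lipschitz_on_nonneg by blast
    have L': "L-lipschitz_on \<Omega> \<psi>" using L closure_subset by (rule lipschitz_on_subset)
    note w\<psi> = lipschitz_wgrad[OF \<Omega> L']
    let ?\<eta> = "wgrad \<Omega> \<psi>"
    \<comment> \<open>Strictly between \<open>K\<close> and \<sigma>: large enough to admit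
      perturbed gradients, small enough for the series at \<open>R\<close> to converge.\<close>
    define R where "R = (K + \<sigma>) / 2"
    have R: "R > 0" "K < R" "R < \<sigma>" using K0 K\<sigma> \<sigma> by (auto simp: R_def)
    note sR = rad[OF less_imp_le[OF R(1)] R(3)]
    \<comment> \<open>The largest step in the direction \<psi>, whose gradient is bounded by
      \<open>L\<close>, for which the gradient provably stays below \<open>R\<close>; the 1 avoids a
      zero denominator.\<close>
    define \<tau> where "\<tau> = (R - K) / (L + 1)"
    have \<tau>: "\<tau> > 0" "K + \<tau> * L \<le> R"
    proof -
      show "\<tau> > 0" using R L0 by (simp add: \<tau>_def)
      then have "\<tau> * L \<le> \<tau> * (L + 1)" by simp
      also have "\<dots> = R - K" using L0 by (simp add: \<tau>_def)
      finally show "K + \<tau> * L \<le> R" by simp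
    qed
    let ?P = "\<lambda>p. if p \<ge> 2 then a p * p_form \<Omega> p u \<psi> else 0"
    have "norm (?P p) \<le> measure lebesgue \<Omega> * L / R * (\<bar>a p\<bar> * R ^ p)" for p
    proof (cases "p \<ge> 2")
      case True
      have bR: "AE x in ?E. norm (?\<xi> x) \<le> R" using uK by eventually_elim (use R in simp)
      have "\<bar>a p\<bar> * \<bar>p_form \<Omega> p u \<psi>\<bar> \<le> \<bar>a p\<bar> * (measure lebesgue \<Omega> * (R ^ p * L / R))"
        unfolding p_form_def
        by (intro mult_left_mono p_integral_bound[OF \<Omega> u(2) bR w\<psi>(2,3) R(1) True]) auto
      then show ?thesis using True by (simp add: abs_mult mult_ac)
    qed (use R L0 in simp)
    then have sP: "summable (\<lambda>p. norm (?P p))"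
      by (intro summable_comparison_test[OF _ summable_mult[OF sR, of "measure lebesgue \<Omega> * L / R"]]) auto
    have J\<psi>: "integrable ?E (\<lambda>x. f x * \<psi> x)" by (rule integrable_times_lipschitz[OF \<Omega> f L'])
    \<comment> \<open>The first variation is one-sided, with \<open>t > 0\<close>. Applying it to
      both signs of the direction gives two opposite inequalities, hence equality.\<close>
    have half: "s * J \<psi> \<le> s * suminf ?P" if s: "\<bar>s\<bar> = 1" for s
    proof -
      have "s * J \<psi> \<le> (\<Sum>p. if p \<ge> 2 then a p * (LINT x|?E. norm (?\<xi> x) ^ (p - 2) * (?\<xi> x \<bullet> (s *\<^sub>R ?\<eta> x))) else 0)"
      proof (rule energy_first_variation[OF \<Omega> a u(2) uK _ _ R(1) \<tau>(1) L0 \<tau>(2) sR])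
        show m\<eta>: "(\<lambda>x. s *\<^sub>R ?\<eta> x) \<in> borel_measurable ?E" using w\<psi>(2) by measurable
        show b\<eta>: "AE x in ?E. norm (s *\<^sub>R ?\<eta> x) \<le> L" using w\<psi>(3) by eventually_elim (simp add: s)
        fix t assume t: "0 < t" "t \<le> \<tau>"
        define v where "v x = 1 * u x + (s * t) * \<psi> x" for x
        have wv: "AE x in ?E. wgrad \<Omega> v x = ?\<xi> x + t *\<^sub>R (s *\<^sub>R ?\<eta> x)"
          using wgrad_lincomb[OF \<Omega>(1) u(3) w\<psi>(1), of 1 "s * t"]
          unfolding v_def[abs_def] by eventually_elim (simp add: mult.commute)
        have bv: "AE x in ?E. norm (wgrad \<Omega> v x) \<le> R" using wv uK b\<eta>
        proof eventually_elim
          case (elim x)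
          have "norm (wgrad \<Omega> v x) \<le> norm (?\<xi> x) + t * norm (s *\<^sub>R ?\<eta> x)"
            unfolding elim(1) using t norm_triangle_ineq[of "?\<xi> x" "t *\<^sub>R (s *\<^sub>R ?\<eta> x)"] by (simp add: abs_mult mult.assoc)
          also have "\<dots> \<le> K + \<tau> * L" using elim t \<tau> L0 by (intro add_mono mult_mono) auto
          finally show ?case using \<tau>(2) by simp
        qed
        have "(\<bar>1\<bar> * Lu + \<bar>s * t\<bar> * L)-lipschitz_on (closure \<Omega>) v"
          unfolding v_def[abs_def] by (intro lipschitz_on_add lipschitz_on_cmult_real Lu L)
        moreover have "AE x in ?E. norm (wgrad \<Omega> v x) \<le> \<sigma>" using bv by eventually_elim (use R in simp)
        moreover have "v x = g x" if "x \<in> frontier \<Omega>" for x using u(5)[OF that] \<psi>0[OF that] by (simp add: v_def)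
        ultimately have vS: "v \<in> S \<Omega> \<sigma> g" by (auto simp: S_def C01_def)
        have "fin (wgrad \<Omega> v)" by (rule fin_lt[OF SD(2)[OF vS] bv less_imp_le[OF R(1)] R(3)])
        then have "En ?\<xi> - J u \<le> En (wgrad \<Omega> v) - J v" by (rule umin'[OF vS])
        moreover have "J v = J u + s * t * J \<psi>"
        proof -
          have "J v = (LINT x|?E. f x * u x + s * t * (f x * \<psi> x))"
            by (simp add: J_def v_def algebra_simps)
          also have "\<dots> = J u + s * t * J \<psi>" unfolding J_def using u(6) J\<psi> by simp
          finally show ?thesis .
        qed
        moreover have "moment \<Omega> (wgrad \<Omega> v) p = moment \<Omega> (\<lambda>x. ?\<xi> x + t *\<^sub>R (s *\<^sub>R ?\<eta> x)) p" for p
          unfolding moment_def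
          by (rule lebesgue_on_cong_AE(3)[OF s\<Omega>]) (use wv in \<open>eventually_elim, simp\<close>)
        ultimately show "t * (s * J \<psi>) + (\<Sum>p. ?c p * moment \<Omega> ?\<xi> p) \<le>
            (\<Sum>p. ?c p * moment \<Omega> (\<lambda>x. ?\<xi> x + t *\<^sub>R (s *\<^sub>R ?\<eta> x)) p)"
          by (simp add: En_def mult_ac)
      qed
      also have "\<dots> = (\<Sum>p. s * ?P p)"
        by (intro suminf_cong) (simp add: p_form_def mult.left_commute[of _ s])
      also have "\<dots> = s * suminf ?P" using summable_norm_cancel[OF sP] by (rule suminf_mult)
      finally show ?thesis .
    qed
    have "suminf ?P = J \<psi>" using half[of 1] half[of "-1"] by simp
    moreover have "(\<Sum>\<^sub>\<infinity>p\<in>{2..}. a p * p_form \<Omega> p u \<psi>) = suminf ?P"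
      using infsum_eq_suminf_if(2)[of "{2..}" "\<lambda>p. a p * p_form \<Omega> p u \<psi>"] sP by simp
    ultimately show "(\<Sum>\<^sub>\<infinity>p\<in>{2..}. a p * p_form \<Omega> p u \<psi>) = (LINT x|?E. f x * \<psi> x)" by (simp add: J_def)
  qed

  \<comment> \<open>Assembly of the conclusions\<close>
  show ?thesis
  proof (intro conjI allI impI)
    show "\<exists>U. (\<forall>n>DIM('a). continuous_on (closure \<Omega>) (U n) \<and> (AE x in ?E. U n x = un n x)) \<and>
        uniform_limit (closure \<Omega>) U u sequentially"
      using lipschitz_on_continuous_on[OF Ulip] Uun unif by (intro exI[of _ U]) blast
    show "AE x in ?E. norm (?\<xi> x) \<le> K" by (rule uK)
    show "weak_solution a \<sigma> \<Omega> f g u" by (rule weak)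
    fix \<theta> assume \<theta>: "K / \<sigma> < \<theta> \<and> \<theta> < 1"
    then obtain C where C: "C > 0" "\<And>n. measure lebesgue \<Omega> * T n \<le> C * \<theta> ^ n" using geo by blast
    have "ereal (a 2 / 2 * D n) \<le> F a \<sigma> \<Omega> f (un n) - F a \<sigma> \<Omega> f u \<and>
        F a \<sigma> \<Omega> f (un n) - F a \<sigma> \<Omega> f u \<le> ereal (measure lebesgue \<Omega> * (\<Sum>\<^sub>\<infinity>p\<in>{n<..}. a p / real p * K ^ p)) \<and>
        measure lebesgue \<Omega> * (\<Sum>\<^sub>\<infinity>p\<in>{n<..}. a p / real p * K ^ p) \<le> C * \<theta> ^ n" if "n > DIM('a)" for n
      unfolding Fun[OF that] Fu T[OF that] using lower[OF that] upper[OF that] C(2)[of n] by simp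
    then show "\<exists>C>0. \<forall>n>DIM('a).
        ereal (a 2 / 2 * (LINT x|?E. (norm (wgrad \<Omega> (un n) x - ?\<xi> x))\<^sup>2)) \<le> F a \<sigma> \<Omega> f (un n) - F a \<sigma> \<Omega> f u \<and>
        F a \<sigma> \<Omega> f (un n) - F a \<sigma> \<Omega> f u \<le> ereal (measure lebesgue \<Omega> * (\<Sum>\<^sub>\<infinity>p\<in>{n<..}. a p / real p * K ^ p)) \<and>
        measure lebesgue \<Omega> * (\<Sum>\<^sub>\<infinity>p\<in>{n<..}. a p / real p * K ^ p) \<le> C * \<theta> ^ n"
      using C(1) unfolding D_def by blast
  qed
qed

end
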